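(* Let $\Omega_0,\mathbb{Y}^1,\dots,\mathbb{Y}^n,\mathbb{U}^1,\dots,\mathbb{U}^n$ be standard Borel spaces and let $\mu$ be a probability measure on $\Omega_0\times\mathbb{Y}^1\times\cdots\times\mathbb{Y}^n$. If the set $L_R(\mu)$ is compact under the weak convergence topology on $\mathcal{P}\big(\Omega_0\times\prod_{k=1}^n(\mathbb{Y}^k\times\mathbb{U}^k)\big)$, then $L_C(\mu)$ is compact under the weak convergence topology.
   Context: A team policy is $\bar\gamma=(\gamma^1,\dots,\gamma^n)$ with $\gamma^k:\mathbb{Y}^k\to\mathbb{U}^k$ measurable; its strategic measure $L_A(\mu,\bar\gamma)$ is the probability measure on $\Omega_0\times\prod_k(\mathbb{Y}^k\times\mathbb{U}^k)$ given by $L_A(\mu,\bar\gamma)(B)=\int \mu(d\omega_0,dy^1,\dots,dy^n)\,1_{\{(\omega_0,y^1,\gamma^1(y^1),\dots,y^n,\gamma^n(y^n))\in B\}}$, and $L_A(\mu)$ is the set of all such measures. $L_R(\mu)$ is the set of probability measures $P$ on $\Omega_0\times\prod_k(\mathbb{Y}^k\times\mathbb{U}^k)$ of the form $P(B)=\int_B\mu(d\omega_0,dy^1,\dots,dy^n)\prod_{k=1}^n\kappa^k(du^k|y^k)$, where each $\kappa^k$ is a stochastic kernel from $\mathbb{Y}^k$ to $\mathbb{U}^k$ (independently randomized policies). With $\mathcal{W}=[0,1]^n$, $L_C(\mu)$ is the set of probability measures $P$ of the form $P(B)=\int\eta(dz)\,L_A(\mu,\tilde\gamma(z))(B)$, where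 $\eta\in\mathcal{P}(\mathcal{W})$ and $z\mapsto\tilde\gamma(z)$ is a family of team policies such that $z\mapsto L_A(\mu,\tilde\gamma(z))$ is Borel measurable; equivalently, $P(B)=\int_{B\times\mathcal{W}}\eta(dz)\mu(d\omega_0,d\bar y)\prod_k\Pi^k(du^k|y^k,z)$ for some $\eta\in\mathcal{P}(\mathcal{W})$ and stochastic kernels $\Pi^k$ from $\mathbb{Y}^k\times\mathcal{W}$ to $\mathbb{U}^k$ (randomized policies with common randomness). *)

theory Defs
  imports "HOL-Analysis.Analysis" "HOL-Probability.Probability"
begin

text \<open>A Polish (separable, completely metrizable) topology; the standard Borel spaces of
  the paper are taken with a compatible Polish topology (needed for weak convergence).\<close>
definition polish_top :: "'a topology \<Rightarrow> bool" where
  "polish_top T \<longleftrightarrow> completely_metrizable_space T \<and> separable_space T"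

definition borel_of :: "'a topology \<Rightarrow> 'a measure" where
  "borel_of T = sigma (topspace T) {S. openin T S}"

definition weak_topology :: "'a topology \<Rightarrow> 'a measure topology" where
  "weak_topology T = topology_generated_by
     {{P \<in> space (prob_algebra (borel_of T)). (\<integral>x. f x \<partial>P) \<in> U} | f U.
        continuous_map T euclideanreal f \<and> bounded (f ` topspace T) \<and> open U}"

definition obs_top :: "'w topology \<Rightarrow> (nat \<Rightarrow> 'y topology) \<Rightarrow> nat \<Rightarrow> ('w \<times> (nat \<Rightarrow> 'y)) topology" where
  "obs_top OT YT n = prod_topology OT (product_topology YT {1..n})"

definition full_top :: "'w topology \<Rightarrow> (nat \<Rightarrow> 'y topology) \<Rightarrow> (nat \<Rightarrow> 'u topology) \<Rightarrow> nat
    \<Rightarrow> ('w \<times> (nat \<Rightarrow> 'y \<times> 'u)) topology" where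
  "full_top OT YT UT n = prod_topology OT (product_topology (\<lambda>k. prod_topology (YT k) (UT k)) {1..n})"

definition team_policy :: "(nat \<Rightarrow> 'y topology) \<Rightarrow> (nat \<Rightarrow> 'u topology) \<Rightarrow> nat
    \<Rightarrow> (nat \<Rightarrow> 'y \<Rightarrow> 'u) \<Rightarrow> bool" where
  "team_policy YT UT n \<gamma> \<longleftrightarrow> (\<forall>k\<in>{1..n}. \<gamma> k \<in> borel_of (YT k) \<rightarrow>\<^sub>M borel_of (UT k))"

definition strat_meas :: "'w topology \<Rightarrow> (nat \<Rightarrow> 'y topology) \<Rightarrow> (nat \<Rightarrow> 'u topology) \<Rightarrow> nat
    \<Rightarrow> ('w \<times> (nat \<Rightarrow> 'y)) measure \<Rightarrow> (nat \<Rightarrow> 'y \<Rightarrow> 'u) \<Rightarrow> ('w \<times> (nat \<Rightarrow> 'y \<times> 'u)) measure" where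
  "strat_meas OT YT UT n \<mu> \<gamma> =
     distr \<mu> (borel_of (full_top OT YT UT n))
       (\<lambda>(\<omega>, y). (\<omega>, restrict (\<lambda>k. (y k, \<gamma> k (y k))) {1..n}))"

definition L_R :: "'w topology \<Rightarrow> (nat \<Rightarrow> 'y topology) \<Rightarrow> (nat \<Rightarrow> 'u topology) \<Rightarrow> nat
    \<Rightarrow> ('w \<times> (nat \<Rightarrow> 'y)) measure \<Rightarrow> ('w \<times> (nat \<Rightarrow> 'y \<times> 'u)) measure set" where
  "L_R OT YT UT n \<mu> =
     {P \<in> space (prob_algebra (borel_of (full_top OT YT UT n))).
        \<exists>\<kappa> :: nat \<Rightarrow> 'y \<Rightarrow> 'u measure.
          (\<forall>k\<in>{1..n}. \<kappa> k \<in> borel_of (YT k) \<rightarrow>\<^sub>M prob_algebra (borel_of (UT k))) \<and>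
          (\<forall>B \<in> sets (borel_of (full_top OT YT UT n)).
             emeasure P B =
               (\<integral>\<^sup>+ (\<omega>, y). emeasure (PiM {1..n} (\<lambda>k. \<kappa> k (y k)))
                   {u \<in> space (PiM {1..n} (\<lambda>k. \<kappa> k (y k))).
                      (\<omega>, restrict (\<lambda>k. (y k, u k)) {1..n}) \<in> B} \<partial>\<mu>))}"

definition W_space :: "nat \<Rightarrow> (nat \<Rightarrow> real) measure" where
  "W_space n = PiM {1..n} (\<lambda>_. restrict_space borel {0..1::real})"

definition L_C :: "'w topology \<Rightarrow> (nat \<Rightarrow> 'y topology) \<Rightarrow> (nat \<Rightarrow> 'u topology) \<Rightarrow> nat
    \<Rightarrow> ('w \<times> (nat \<Rightarrow> 'y)) measure \<Rightarrow> ('w \<times> (nat \<Rightarrow> 'y \<times> 'u)) measure set" where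
  "L_C OT YT UT n \<mu> =
     {P \<in> space (prob_algebra (borel_of (full_top OT YT UT n))).
        \<exists>(\<eta> :: (nat \<Rightarrow> real) measure) (\<gamma> :: (nat \<Rightarrow> real) \<Rightarrow> nat \<Rightarrow> 'y \<Rightarrow> 'u).
          \<eta> \<in> space (prob_algebra (W_space n)) \<and>
          (\<forall>z\<in>space (W_space n). team_policy YT UT n (\<gamma> z)) \<and>
          (\<lambda>z. strat_meas OT YT UT n \<mu> (\<gamma> z))
             \<in> W_space n \<rightarrow>\<^sub>M borel_of (weak_topology (full_top OT YT UT n)) \<and>
          (\<forall>B \<in> sets (borel_of (full_top OT YT UT n)).
             emeasure P B = (\<integral>\<^sup>+ z. emeasure (strat_meas OT YT UT n \<mu> (\<gamma> z)) B \<partial>\<eta>))}"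

end

theory Submission
  imports Defs
begin

text \<open>
  The proof follows Choquet. A compact set of probability measures is a continuous image \<open>S ` K\<close> of a
  compact \<open>K \<subseteq> [0,1]\<close> (through the Cantor set), and the probability measures on \<open>K\<close> are compact by
  Helly's theorem, so the set of mixtures of elements of \<open>L_R\<close> is compact.
  Every element of \<open>L_R\<close> outside \<open>L_A\<close> is the midpoint of two distinct elements of \<open>L_R\<close>: a
  kernel that is not almost surely Dirac can be tilted in two opposite directions.
  Given a mixture of elements of \<open>L_R\<close>, choose among all measures on \<open>K\<close> with the same
  barycentre one that maximises the integral of a strictly convex function. It cannot charge proper
  midpoints, as splitting them would increase the integral; hence it is carried by \<open>L_A\<close> and the
  mixture lies in \<open>L_C\<close>. As \<open>L_C\<close> asks only for measurability of the strategic measures in the common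
  randomness, the policies themselves may be picked by choice.
\<close>

section \<open>Compact metrizable spaces as images of compact sets of reals\<close>

text \<open>Each value of the common randomness has to select deterministic policies. Realizing a
  random element of \<open>L_R\<close> by extra noise would call for a measurable choice of its
  kernels; arguing with the measures alone avoids this. \<open>L_R\<close> is in general not convex,
  but the maximality argument asks only that both halves of a split lie in the compact set again.
  The strictly convex function is a weighted sum of squares of countably many integrals of bounded
  continuous functions that together determine a measure: it is weakly continuous and grows strictly
  at every proper split. To split many points at once, the two halves must depend measurably on the
  point. Splits with gain at least \<open>1 / Suc m\<close> form a compact set, whose lowest points
  give a Borel selection. Because the parameters are reals, mixing measures can be replaced by their
  moments, so compactness and maximisation take place in a space of real sequences.\<close>

definition digit_sum :: "real \<Rightarrow> (nat \<Rightarrow> bool) \<Rightarrow> real" where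
  "digit_sum c b = (\<Sum>i. of_bool (b i) * c ^ Suc i)"

lemma summable_digit_sum:
  assumes "0 \<le> c" "c < 1"
  shows "summable (\<lambda>i. of_bool (b i) * c ^ Suc i :: real)"
proof (rule summable_comparison_test')
  show "summable (\<lambda>i. c ^ Suc i)"
    using assms by (simp add: summable_mult)
  show "norm (of_bool (b n) * c ^ Suc n) \<le> c ^ Suc n" if "n \<ge> 0" for n
    using assms by (auto simp: abs_mult)
qed

lemma digit_sum_nonneg:
  assumes "0 \<le> c" "c < 1"
  shows "0 \<le> digit_sum c b"
  unfolding digit_sum_def by (intro suminf_nonneg summable_digit_sum) (use assms in auto)

lemma digit_sum_le:
  assumes "0 \<le> c" "c < 1"
  shows "digit_sum c b \<le> c / (1 - c)"
proof -
  have "(\<lambda>i. c * c ^ i) sums (c * (1 / (1 - c)))"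
    by (intro sums_mult geometric_sums) (use assms in auto)
  then have "(\<lambda>i. c ^ Suc i) sums (c / (1 - c))" by simp
  moreover have "digit_sum c b \<le> (\<Sum>i. c ^ Suc i)"
    unfolding digit_sum_def
    by (intro suminf_le summable_digit_sum sums_summable[OF calculation]) (use assms in auto)
  ultimately show ?thesis by (simp add: sums_iff)
qed

lemma digit_sum_split:
  assumes "0 \<le> c" "c < 1"
  shows "digit_sum c b = (\<Sum>i<n. of_bool (b i) * c ^ Suc i) + c ^ n * digit_sum c (\<lambda>i. b (i + n))"
proof -
  have "digit_sum c b = (\<Sum>i. of_bool (b (i + n)) * c ^ Suc (i + n)) + (\<Sum>i<n. of_bool (b i) * c ^ Suc i)"
    unfolding digit_sum_def
    by (rule suminf_split_initial_segment[OF summable_digit_sum[OF assms]])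
  also have "(\<Sum>i. of_bool (b (i + n)) * c ^ Suc (i + n)) = c ^ n * digit_sum c (\<lambda>i. b (i + n))"
    unfolding digit_sum_def
    by (subst suminf_mult[symmetric])
       (use summable_digit_sum[OF assms, of "\<lambda>i. b (i + n)"] in \<open>auto simp: power_add algebra_simps\<close>)
  finally show ?thesis by simp
qed

text \<open>If two sequences first differ at index \<open>n\<close>, the later digits contribute at
  most \<open>c ^ Suc n * (c / (1 - c))\<close>, and \<open>c / (1 - c) < 1\<close> since
  \<open>c < 1/2\<close>. Base \<open>1/3\<close> thus embeds the binary sequences in the line,
  whereas base \<open>1/2\<close> covers the unit interval but is ambiguous at dyadic
  points.\<close>

lemma inj_digit_sum: 
  assumes "0 < c" "c < 1/2"
  shows "inj (digit_sum c)"
proof -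
  have less: "digit_sum c b < digit_sum c b'"
    if eq: "\<forall>i<n. b i = b' i" and "\<not> b n" "b' n" for b b' n
  proof -
    have "digit_sum c b = (\<Sum>i<n. of_bool (b i) * c ^ Suc i) + c ^ Suc n * digit_sum c (\<lambda>i. b (i + Suc n))"
      using that(2) by (subst digit_sum_split[where n = "Suc n"]) (use assms in auto)
    also have "\<dots> \<le> (\<Sum>i<n. of_bool (b i) * c ^ Suc i) + c ^ Suc n * (c / (1 - c))"
      by (intro add_left_mono mult_left_mono digit_sum_le) (use assms in auto)
    also have "\<dots> < (\<Sum>i<n. of_bool (b i) * c ^ Suc i) + c ^ Suc n * 1"
      by (intro add_strict_left_mono mult_strict_left_mono) (use assms in \<open>auto simp: field_simps\<close>)
    also have "\<dots> \<le> (\<Sum>i<n. of_bool (b i) * c ^ Suc i) + c ^ Suc n * 1 + c ^ Suc n * digit_sum c (\<lambda>i. b' (i + Suc n))"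
      using digit_sum_nonneg[of c "\<lambda>i. b' (i + Suc n)"] assms by auto
    also have "\<dots> = digit_sum c b'"
      using that(3) eq by (subst digit_sum_split[where b = b' and n = "Suc n"]) (use assms in auto)
    finally show ?thesis .
  qed
  show ?thesis
  proof (rule injI, rule ccontr)
    fix b b' assume *: "digit_sum c b = digit_sum c b'" "b \<noteq> b'"
    then obtain m where "b m \<noteq> b' m" by auto
    then obtain n where n: "b n \<noteq> b' n" "\<forall>i<n. b i = b' i"
      using exists_least_iff[of "\<lambda>i. b i \<noteq> b' i"] by blast
    then show False using less[of n b b'] less[of n b' b] * by (cases "b n") auto
  qed
qed

text \<open>Partial sums depend on finitely many digits and converge uniformly. The index map
  \<open>p\<close> selects the digits belonging to one coordinate when a single binary sequence
  encodes a whole sequence of reals.\<close>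

lemma continuous_on_digit_sum:
  fixes p :: "nat \<Rightarrow> nat"
  assumes "0 \<le> c" "c < 1"
  shows "continuous_on UNIV (\<lambda>b. digit_sum c (\<lambda>i. b (p i)))"
proof (rule uniform_limit_theorem[where F = sequentially])
  show "uniform_limit UNIV (\<lambda>n b. \<Sum>i<n. of_bool (b (p i)) * c ^ Suc i) (\<lambda>b. digit_sum c (\<lambda>i. b (p i))) sequentially"
    unfolding digit_sum_def
    by (rule Weierstrass_m_test[where M = "\<lambda>i. c ^ Suc i"])
       (use assms in \<open>auto simp: abs_mult summable_mult\<close>)
  have "continuous_on UNIV (\<lambda>b::nat\<Rightarrow>bool. of_bool (b k) :: real)" for k
    by (rule continuous_on_compose2[of UNIV "of_bool :: bool \<Rightarrow> real"])
       (auto intro!: continuous_on_discrete continuous_on_product_coordinates)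
  then show "\<forall>\<^sub>F n in sequentially. continuous_on UNIV (\<lambda>b. \<Sum>i<n. of_bool (b (p i)) * c ^ Suc i)"
    by (intro always_eventually allI continuous_intros)
qed auto

lemma ex_binary_expansion:
  assumes "x \<in> {0..1::real}"
  obtains b where "digit_sum (1/2) b = x"
proof -
  \<comment> \<open>\<open>r\<close> iterates the doubling map: \<open>r n\<close> is the remainder
    after \<open>n\<close> digits, rescaled to the unit interval. The point 1 is fixed by it and
    receives the all-ones expansion.\<close>
  define r where "r = rec_nat x (\<lambda>_ y. 2 * y - of_bool (y \<ge> 1/2))"
  have r0: "r 0 = x" and rS: "r (Suc n) = 2 * r n - of_bool (r n \<ge> 1/2)" for n
    by (auto simp: r_def)
  have r: "r n \<in> {0..1}" for n
    by (induction n) (use assms in \<open>auto simp: r0 rS\<close>)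
  define b where "b i = (r i \<ge> 1/2)" for i
  have part: "x = (\<Sum>i<n. of_bool (b i) * (1/2) ^ Suc i) + (1/2) ^ n * r n" for n
  proof (induction n)
    case (Suc n)
    show ?case by (subst Suc.IH) (simp add: rS b_def field_simps)
  qed (simp add: r0)
  have "(\<lambda>n. (1/2) ^ n * r n) \<longlonglongrightarrow> 0"
  proof (rule Lim_null_comparison)
    show "\<forall>\<^sub>F n in sequentially. norm ((1/2) ^ n * r n) \<le> (1/2) ^ n"
      using r by (intro always_eventually allI) (auto simp: abs_mult mult_left_le)
    show "(\<lambda>n. (1/2::real) ^ n) \<longlonglongrightarrow> 0" by (intro LIMSEQ_power_zero) auto
  qed
  then have "(\<lambda>n. x - (1/2) ^ n * r n) \<longlonglongrightarrow> x" using tendsto_diff[OF tendsto_const] by fastforce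
  moreover have "(\<lambda>n. x - (1/2) ^ n * r n) = (\<lambda>n. \<Sum>i<n. of_bool (b i) * (1/2) ^ Suc i)"
    using part by (auto simp: algebra_simps)
  ultimately have "(\<lambda>i. of_bool (b i) * (1/2) ^ Suc i) sums x" by (simp add: sums_def)
  then show ?thesis using that by (auto simp: digit_sum_def sums_iff)
qed

lemma compact_UNIV_bool_seq: "compact (UNIV :: (nat \<Rightarrow> bool) set)"
proof -
  have "compactin (product_topology (\<lambda>i::nat. euclidean) UNIV) (\<Pi>\<^sub>E i\<in>UNIV. (UNIV::bool set))"
    by (subst compactin_PiE) (auto intro!: finite_imp_compact)
  then show ?thesis by (simp add: euclidean_product_topology)
qed

text \<open>The digit-splitting map \<open>h\<close> sends binary sequences onto the Hilbert cube,
  so the preimage \<open>B\<close> of \<open>D\<close> is a compact set of binary sequences lying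
  over \<open>D\<close>. Base-3 digits transport it injectively into the line, which gives
  \<open>K\<close>.\<close>

lemma compact_image_of_Cantor:
  fixes D :: "(nat \<Rightarrow> real) set"
  assumes "compact D" and D: "D \<subseteq> {d. \<forall>i. d i \<in> {0..1}}"
  obtains K :: "real set" and \<theta> where "compact K" "K \<subseteq> {0..1}" "continuous_on K \<theta>" "\<theta> ` K = D"
proof -
  let ?e = "digit_sum (1/3)"
  define h :: "(nat \<Rightarrow> bool) \<Rightarrow> nat \<Rightarrow> real"
    where "h b i = digit_sum (1/2) (\<lambda>j. b (prod_encode (i, j)))" for b i
  have cont_h: "continuous_on UNIV h"
    by (rule continuous_on_coordinatewise_then_product)
       (auto simp: h_def intro!: continuous_on_digit_sum)
  have cont_e: "continuous_on UNIV ?e"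
    using continuous_on_digit_sum[of "1/3" "\<lambda>i. i"] by simp
  define B where "B = h -` D"
  have "closed B" unfolding B_def
    using compact_imp_closed[OF assms(1)] cont_h by (rule closed_vimage)
  then have B: "compact B"
    using compact_Int_closed[OF compact_UNIV_bool_seq, of B] by auto
  have "h ` B = D"
  proof -
    have "\<exists>b. h b = d" if "d \<in> D" for d
    proof -
      have "\<exists>b. digit_sum (1/2) b = d i" for i
        using ex_binary_expansion[of "d i"] D that by blast
      then obtain b where b: "\<And>i. digit_sum (1/2) (b i) = d i" by metis
      have "h (\<lambda>k. case prod_decode k of (i, j) \<Rightarrow> b i j) = d"
        by (auto simp: h_def b)
      then show ?thesis by blast
    qed
    then show ?thesis unfolding B_def by force
  qed
  have inv: "inv ?e (?e b) = b" for b
    using inj_digit_sum[of "1/3"] by (intro inv_f_f) auto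
  have "continuous_on (?e ` B) (inv ?e)"
    by (rule continuous_on_inv) (use B inv continuous_on_subset[OF cont_e] in auto)
  then have "continuous_on (?e ` B) (h \<circ> inv ?e)"
    by (intro continuous_on_compose continuous_on_subset[OF cont_h]) auto
  moreover have "compact (?e ` B)"
    using B by (intro compact_continuous_image continuous_on_subset[OF cont_e]) auto
  moreover have "?e ` B \<subseteq> {0..1}"
  proof -
    have "digit_sum (1/3) b \<le> 1/2" for b using digit_sum_le[of "1/3" b] by simp
    then have "digit_sum (1/3) b \<le> 1" for b by (rule order_trans) simp
    then show ?thesis using digit_sum_nonneg[of "1/3"] by auto
  qed
  moreover have "(h \<circ> inv ?e) ` ?e ` B = D"
    using \<open>h ` B = D\<close> by (simp add: image_image inv)
  ultimately show ?thesis using that by blast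
qed

text \<open>Countably many continuous functions that separate the points of \<open>C\<close> map it
  injectively into the Hilbert cube. The inverse is continuous by compactness, so a parametrization
  of the image by a compact set of reals carries back to \<open>C\<close>.\<close>

lemma compactin_image_of_Cantor:
  fixes F :: "nat \<Rightarrow> 'a \<Rightarrow> real"
  assumes C: "compactin X C"
    and cont: "\<And>i. continuous_map X euclideanreal (F i)"
    and range: "\<And>i x. x \<in> C \<Longrightarrow> F i x \<in> {0..1}"
    and inj: "\<And>x y. x \<in> C \<Longrightarrow> y \<in> C \<Longrightarrow> (\<And>i. F i x = F i y) \<Longrightarrow> x = y"
  obtains K :: "real set" and S where "compact K" "K \<subseteq> {0..1}"
    "continuous_map (top_of_set K) X S" "S ` K = C"
proof -
  define \<Phi> where "\<Phi> x = (\<lambda>i. F i x)" for x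
  have "continuous_map X (product_topology (\<lambda>i. euclideanreal) UNIV) \<Phi>"
    unfolding \<Phi>_def continuous_map_componentwise_UNIV using cont by blast
  then have cont_\<Phi>: "continuous_map X euclidean \<Phi>" by (simp add: euclidean_product_topology)
  define D where "D = \<Phi> ` C"
  have "compact D"
    using image_compactin[OF C cont_\<Phi>] by (simp add: D_def)
  moreover have "D \<subseteq> {d. \<forall>i. d i \<in> {0..1}}" using range by (auto simp: D_def \<Phi>_def)
  ultimately obtain K :: "real set" and \<theta> where K: "compact K" "K \<subseteq> {0..1}" "continuous_on K \<theta>" "\<theta> ` K = D"
    by (rule compact_image_of_Cantor) (rule that)
  have inj_\<Phi>: "inj_on \<Phi> C" using inj by (auto simp: inj_on_def \<Phi>_def fun_eq_iff)
  let ?\<Psi> = "inv_into C \<Phi>"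
  have CX: "C \<subseteq> topspace X" using C by (simp add: compactin_subset_topspace)
  have D_C: "?\<Psi> d \<in> C" "\<Phi> (?\<Psi> d) = d" if "d \<in> D" for d
    using inv_into_into[of d \<Phi> C] f_inv_into_f[of d \<Phi> C] that by (simp_all add: D_def)
  have "continuous_map (top_of_set D) X ?\<Psi>"
    unfolding continuous_map_closedin
  proof (intro conjI ballI allI impI)
    show "?\<Psi> \<in> topspace (top_of_set D) \<rightarrow> topspace X" using D_C CX by auto
    fix E assume E: "closedin X E"
    \<comment> \<open>A closed set pulled back along the inverse is the image under
      \<open>\<Phi>\<close> of a closed part of \<open>C\<close>, hence compact.\<close>
    have eq: "{x \<in> topspace (top_of_set D). ?\<Psi> x \<in> E} = \<Phi> ` (E \<inter> C)"
      using D_C by (auto simp: D_def inv_into_f_f[OF inj_\<Phi>])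
    have "compact (\<Phi> ` (E \<inter> C))"
      using image_compactin[OF closed_Int_compactin[OF E C] cont_\<Phi>] by simp
    then show "closedin (top_of_set D) {x \<in> topspace (top_of_set D). ?\<Psi> x \<in> E}"
      unfolding eq by (intro closed_subset compact_imp_closed) (auto simp: D_def)
  qed
  moreover have "continuous_map (top_of_set K) (top_of_set D) \<theta>" using K by auto
  ultimately have "continuous_map (top_of_set K) X (?\<Psi> \<circ> \<theta>)"
    by (rule continuous_map_compose[rotated])
  moreover have "(?\<Psi> \<circ> \<theta>) ` K = C"
    using K(4) inj_\<Phi> by (metis D_def image_comp inv_into_image_cancel order_refl)
  ultimately show ?thesis using that K by blast
qed

section \<open>Probability measures on a compact set of reals\<close>

text \<open>The measures live on the Borel sets of the whole line and are merely concentrated on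
  \<open>K\<close>, so that Helly's selection theorem for real distributions applies to them
  directly.\<close>

definition prob_on :: "real set \<Rightarrow> real measure set" where
  "prob_on K = {\<eta> \<in> space (prob_algebra borel). AE t in \<eta>. t \<in> K}"

text \<open>Moment sequences stand in for the measures: polynomials are uniformly dense in the
  continuous functions on a compact set, so the moments determine all integrals of such functions,
  and \<open>nat \<Rightarrow> real\<close> supplies the topology.\<close>

definition moments :: "real measure \<Rightarrow> nat \<Rightarrow> real" where
  "moments \<eta> i = (\<integral>t. t ^ i \<partial>\<eta>)"

lemma prob_on_D:
  assumes "\<eta> \<in> prob_on K"
  shows "prob_space \<eta>" "sets \<eta> = sets borel" "space \<eta> = UNIV" "AE t in \<eta>. t \<in> K" "real_distribution \<eta>"
proof -
  show *: "prob_space \<eta>" "sets \<eta> = sets borel" "AE t in \<eta>. t \<in> K"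
    using assms by (auto simp: prob_on_def space_prob_algebra)
  from *(2) show "space \<eta> = UNIV" by (simp add: sets_eq_imp_space_eq)
  from * show "real_distribution \<eta>"
    by (simp add: real_distribution_def real_distribution_axioms_def)
qed

lemma prob_on_integrable:
  fixes g :: "real \<Rightarrow> real"
  assumes "\<eta> \<in> prob_on K" "compact K" "continuous_on K g" and g: "g \<in> borel_measurable borel"
  shows "integrable \<eta> g"
proof -
  interpret prob_space \<eta> using prob_on_D[OF assms(1)] by simp
  note [measurable_cong] = prob_on_D(2)[OF assms(1)]
  obtain c where c: "\<And>x. x \<in> K \<Longrightarrow> norm (g x) \<le> c"
    using compact_imp_bounded[OF compact_continuous_image[OF assms(3,2)]] by (auto simp: bounded_iff)
  show ?thesis
    using prob_on_D(4)[OF assms(1)] g by (intro integrable_const_bound[where B = c]) (auto elim!: eventually_mono simp: c[unfolded real_norm_def])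
qed

text \<open>A polynomial approximation of \<open>g\<close>, uniform on \<open>K\<close>, turns the
  integral into a finite linear combination of moments, with an error that does not depend on the
  measure. The integral is thus a uniform limit of continuous functions of the moments.\<close>

lemma continuous_integral_moments:
  fixes g :: "real \<Rightarrow> real"
  assumes K: "compact K" and g: "continuous_on K g" "g \<in> borel_measurable borel"
  obtains G where "continuous_on (moments ` prob_on K) G" "\<And>\<eta>. \<eta> \<in> prob_on K \<Longrightarrow> G (moments \<eta>) = (\<integral>t. g t \<partial>\<eta>)"
proof -
  have "\<exists>(a :: nat \<Rightarrow> real) N. \<forall>t\<in>K. \<bar>g t - (\<Sum>i\<le>N. a i * t ^ i)\<bar> < 1 / Suc n" for n :: nat
    using Stone_Weierstrass_real_polynomial_function[OF K g(1), of "1 / Suc n"]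
    by (metis real_polynomial_function_iff_sum of_nat_0_less_iff zero_less_Suc zero_less_divide_1_iff)
  then obtain a :: "nat \<Rightarrow> nat \<Rightarrow> real" and N
    where a: "\<And>n t. t \<in> K \<Longrightarrow> \<bar>g t - (\<Sum>i\<le>N n. a n i * t ^ i)\<bar> < 1 / Suc n" by metis
  define G' where "G' n x = (\<Sum>i\<le>N n. a n i * x i)" for n and x :: "nat \<Rightarrow> real"
  \<comment> \<open>Being a limit in terms of the sequence \<open>x\<close> and not of a chosen
    measure, \<open>G\<close> gives measures with equal moments the same value.\<close>
  define G where "G x = lim (\<lambda>n. G' n x)" for x
  have bd: "\<bar>G' n (moments \<eta>) - (\<integral>t. g t \<partial>\<eta>)\<bar> \<le> 1 / Suc n" if \<eta>: "\<eta> \<in> prob_on K" for n \<eta>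
  proof -
    interpret prob_space \<eta> using prob_on_D[OF \<eta>] by simp
    note [measurable_cong] = prob_on_D(2)[OF \<eta>]
    have ig: "integrable \<eta> g" by (rule prob_on_integrable[OF \<eta> K g])
    have ip: "integrable \<eta> (\<lambda>t. t ^ i)" for i
      by (rule prob_on_integrable[OF \<eta> K]) (auto intro!: continuous_intros)
    have "G' n (moments \<eta>) = (\<integral>t. (\<Sum>i\<le>N n. a n i * t ^ i) \<partial>\<eta>)"
      using ip by (simp add: G'_def moments_def)
    then have "\<bar>G' n (moments \<eta>) - (\<integral>t. g t \<partial>\<eta>)\<bar> = \<bar>\<integral>t. (\<Sum>i\<le>N n. a n i * t ^ i) - g t \<partial>\<eta>\<bar>"
      using ip ig by simp
    also have "\<dots> \<le> (\<integral>t. \<bar>(\<Sum>i\<le>N n. a n i * t ^ i) - g t\<bar> \<partial>\<eta>)"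
      using ip ig by (intro integral_abs_bound)
    also have "\<dots> \<le> (\<integral>t. 1 / Suc n \<partial>\<eta>)"
    proof (rule integral_mono_AE)
      show "AE t in \<eta>. \<bar>(\<Sum>i\<le>N n. a n i * t ^ i) - g t\<bar> \<le> 1 / Suc n"
        using prob_on_D(4)[OF \<eta>] by eventually_elim (use a in \<open>force simp: abs_minus_commute intro: less_imp_le\<close>)
    qed (use ip ig in auto)
    finally show ?thesis using prob_space by simp
  qed
  have lim0: "(\<lambda>n. 1 / real (Suc n)) \<longlonglongrightarrow> 0"
    using LIMSEQ_inverse_real_of_nat by (simp add: inverse_eq_divide)
  have G: "G (moments \<eta>) = (\<integral>t. g t \<partial>\<eta>)" if "\<eta> \<in> prob_on K" for \<eta>
  proof -
    have "(\<lambda>n. G' n (moments \<eta>) - (\<integral>t. g t \<partial>\<eta>)) \<longlonglongrightarrow> 0"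
      by (rule Lim_null_comparison[OF _ lim0]) (use bd[OF that] in auto)
    then have "(\<lambda>n. G' n (moments \<eta>)) \<longlonglongrightarrow> (\<integral>t. g t \<partial>\<eta>)"
      by (simp add: LIM_zero_iff)
    then show ?thesis unfolding G_def by (rule limI)
  qed
  have "uniform_limit (moments ` prob_on K) G' G sequentially"
  proof (rule uniform_limitI)
    fix e :: real assume "e > 0"
    then have "\<forall>\<^sub>F n in sequentially. 1 / real (Suc n) < e"
      using order_tendstoD(2)[OF lim0] by blast
    then show "\<forall>\<^sub>F n in sequentially. \<forall>x\<in>moments ` prob_on K. dist (G' n x) (G x) < e"
    proof eventually_elim
      case (elim n)
      show ?case
      proof
        fix x assume "x \<in> moments ` prob_on K"
        then obtain \<eta> where "\<eta> \<in> prob_on K" "x = moments \<eta>" by auto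
        then show "dist (G' n x) (G x) < e" using bd[of \<eta> n] G elim by (simp add: dist_real_def)
      qed
    qed
  qed
  moreover have "continuous_on UNIV (\<lambda>x::nat \<Rightarrow> real. x i)" for i
    by (rule continuous_on_product_coordinates)
  then have "continuous_on UNIV (G' n)" for n
    unfolding G'_def by (intro continuous_intros)
  then have "\<forall>\<^sub>F n in sequentially. continuous_on (moments ` prob_on K) (G' n)"
    by (meson always_eventually continuous_on_subset subset_UNIV)
  ultimately have "continuous_on (moments ` prob_on K) G"
    by (intro uniform_limit_theorem) auto
  then show ?thesis using that G by blast
qed

text \<open>Helly's theorem yields a weakly convergent subsequence. Its limit is still concentrated
  on \<open>K\<close>, since the truncated distance to \<open>K\<close> has integral 0 along the
  sequence; the moments converge, since powers agree on \<open>K\<close> with bounded continuous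
  functions.\<close>

lemma compact_moments:
  assumes K: "compact K" "K \<subseteq> {0..1}"
  shows "compact (moments ` prob_on K)"
  unfolding compact_eq_seq_compact_metric
proof (rule seq_compactI)
  fix f :: "nat \<Rightarrow> nat \<Rightarrow> real" assume "\<forall>n. f n \<in> moments ` prob_on K"
  then have "\<forall>n. \<exists>\<eta>. \<eta> \<in> prob_on K \<and> f n = moments \<eta>" by auto
  then obtain \<eta> where \<eta>: "\<And>n. \<eta> n \<in> prob_on K" and f: "\<And>n. f n = moments (\<eta> n)"
    by metis
  have ae: "AE t in \<eta> n. t \<in> {0..1}" for n
    using prob_on_D(4)[OF \<eta>] by eventually_elim (use K in auto)
  have "tight \<eta>"
    unfolding tight_def
  proof (intro conjI allI impI)
    show "real_distribution (\<eta> n)" for n using prob_on_D[OF \<eta>] by blast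
    fix e :: real assume "e > 0"
    \<comment> \<open>Tightness is phrased with intervals open on the left, so the left end must lie
      strictly below 0.\<close>
    have "measure (\<eta> n) {-1<..2} = 1" for n
    proof -
      interpret prob_space "\<eta> n" using prob_on_D[OF \<eta>] by simp
      have "AE t in \<eta> n. t \<in> {-1<..2}" using ae[of n] by eventually_elim auto
      then show ?thesis
        by (subst prob_eq_1) (use prob_on_D(2)[OF \<eta>] in auto)
    qed
    then show "\<exists>a b. a < b \<and> (\<forall>n. 1 - e < measure (\<eta> n) {a<..b})"
      using \<open>e > 0\<close> by (intro exI[of _ "-1"] exI[of _ "2"]) auto
  qed
  then obtain r M where r: "strict_mono (r :: nat \<Rightarrow> nat)" and M: "real_distribution M"
    and w: "weak_conv_m (\<eta> \<circ> id \<circ> r) M"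
    using tight_imp_convergent_subsubsequence[of \<eta> id] by (auto simp: strict_mono_id)
  interpret M: real_distribution M by fact
  have conv: "(\<lambda>n. \<integral>t. g t \<partial>\<eta> (r n)) \<longlonglongrightarrow> (\<integral>t. g t \<partial>M)"
    if "continuous_on UNIV g" "\<And>x. \<bar>g x\<bar> \<le> 1" for g :: "real \<Rightarrow> real"
    using weak_conv_imp_integral_bdd_continuous_conv[of "\<eta> \<circ> id \<circ> r" M g 1] prob_on_D(5)[OF \<eta>] M w that
    by (auto simp: continuous_on_eq_continuous_at)
  have K_ne: "K \<noteq> {}"
  proof
    assume "K = {}"
    then have "AE t in \<eta> 0. False" using prob_on_D(4)[OF \<eta>, of 0] by simp
    then show False using prob_space.AE_False[OF prob_on_D(1)[OF \<eta>]] by blast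
  qed
  have "AE t in M. t \<in> K"
  proof -
    \<comment> \<open>Truncation at 1 makes the distance a bounded test function with the same
      zeros.\<close>
    define d where "d t = min 1 (infdist t K)" for t
    have d: "continuous_on UNIV d" "\<And>t. \<bar>d t\<bar> \<le> 1" "\<And>t. 0 \<le> d t"
      unfolding d_def by (auto intro!: continuous_intros simp: infdist_nonneg)
    have [measurable]: "d \<in> borel_measurable borel" using d(1) by (rule borel_measurable_continuous_onI)
    have "(\<integral>t. d t \<partial>\<eta> n) = 0" for n
    proof (rule integral_eq_zero_AE)
      show "AE t in \<eta> n. d t = 0" using prob_on_D(4)[OF \<eta>, of n] by eventually_elim (simp add: d_def)
    qed
    then have "(\<integral>t. d t \<partial>M) = 0"
      using conv[OF d(1,2)] by (simp add: LIMSEQ_const_iff)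
    moreover have "integrable M d"
      by (rule M.integrable_const_bound[where B = 1]) (use d in auto)
    ultimately have "AE t in M. d t = 0"
      using integral_nonneg_eq_0_iff_AE[of M d] d(3) by simp
    then show ?thesis
      by eventually_elim
         (use in_closed_iff_infdist_zero[OF compact_imp_closed[OF K(1)] K_ne] in \<open>auto simp: d_def min_def split: if_splits\<close>)
  qed
  then have MK: "M \<in> prob_on K"
    using M.prob_space_axioms by (auto simp: prob_on_def space_prob_algebra)
  \<comment> \<open>Clamping the argument to the unit interval bounds the powers on the whole line
    without changing them on \<open>K\<close>.\<close>
  define c where "c i t = (max 0 (min 1 t)) ^ i" for i and t :: real
  have c: "continuous_on UNIV (c i)" "\<bar>c i t\<bar> \<le> 1" for i t
    unfolding c_def by (auto intro!: continuous_intros power_le_one simp: abs_mult power_abs)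
  have [measurable]: "c i \<in> borel_measurable borel" for i using c(1) by (rule borel_measurable_continuous_onI)
  have mom: "moments \<nu> i = (\<integral>t. c i t \<partial>\<nu>)" if "\<nu> \<in> prob_on K" for \<nu> i
    unfolding moments_def
  proof (rule integral_cong_AE)
    note [measurable_cong] = prob_on_D(2)[OF that]
    show "(\<lambda>t. t ^ i) \<in> borel_measurable \<nu>" "c i \<in> borel_measurable \<nu>" by measurable
    show "AE t in \<nu>. t ^ i = c i t"
      using prob_on_D(4)[OF that] by eventually_elim (use K(2) in \<open>force simp: c_def max_def min_def\<close>)
  qed
  have "(\<lambda>n. f (r n) i) \<longlonglongrightarrow> moments M i" for i
    using conv[OF c, of i] by (simp add: f mom[OF \<eta>] mom[OF MK])
  then have "limitin (product_topology (\<lambda>i. euclideanreal) UNIV) (\<lambda>n. f (r n)) (moments M) sequentially"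
    by (simp add: limitin_componentwise)
  then have "(f \<circ> r) \<longlonglongrightarrow> moments M"
    by (simp add: euclidean_product_topology o_def)
  then show "\<exists>l\<in>moments ` prob_on K. \<exists>r. strict_mono r \<and> (f \<circ> r) \<longlonglongrightarrow> l"
    using r MK by blast
qed

text \<open>Each fibre over the projection is compact, so its least element exists and defines
  \<open>\<sigma>\<close>. As the minimum is attained, \<open>\<sigma> x \<le> a\<close> holds there
  exactly when the fibre meets \<open>{..a}\<close>; this sublevel set is a projection of a compact
  set and hence closed.\<close>

lemma measurable_compact_section:
  fixes A :: "('a :: metric_space \<times> real) set"
  assumes A: "compact A"
  obtains \<sigma> where "\<sigma> \<in> borel_measurable borel" "\<And>x. x \<in> fst ` A \<Longrightarrow> (x, \<sigma> x) \<in> A"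
proof -
  define \<sigma> where "\<sigma> x = (if x \<in> fst ` A then Inf {y. (x, y) \<in> A} else 0)" for x
  have cl: "closed (fst ` (A \<inter> UNIV \<times> T))" if "closed T" for T :: "real set"
    by (intro compact_imp_closed compact_continuous_image continuous_intros compact_Int_closed A closed_Times that closed_UNIV)
  have fiber: "\<sigma> x \<in> {y. (x, y) \<in> A}" "(x, y) \<in> A \<Longrightarrow> \<sigma> x \<le> y" if "x \<in> fst ` A" for x y
  proof -
    have eq: "{y. (x, y) \<in> A} = snd ` (A \<inter> {x} \<times> UNIV)" by force
    have "compact {y. (x, y) \<in> A}"
      unfolding eq by (intro compact_continuous_image continuous_intros compact_Int_closed A closed_Times)
    moreover have "{y. (x, y) \<in> A} \<noteq> {}" using that by force
    ultimately show "\<sigma> x \<in> {y. (x, y) \<in> A}"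
      unfolding \<sigma>_def using that
      by (metis (no_types, lifting) bounded_imp_bdd_below closed_contains_Inf compact_eq_bounded_closed)
    show "\<sigma> x \<le> y" if "(x, y) \<in> A"
      unfolding \<sigma>_def using that \<open>x \<in> fst ` A\<close> \<open>compact {y. (x, y) \<in> A}\<close>
      by (auto intro!: cInf_lower bounded_imp_bdd_below compact_imp_bounded)
  qed
  have "{x. \<sigma> x \<le> a} = fst ` (A \<inter> UNIV \<times> {..a}) \<union> (if 0 \<le> a then - fst ` A else {})" for a
  proof (rule set_eqI)
    fix x
    show "x \<in> {x. \<sigma> x \<le> a} \<longleftrightarrow> x \<in> fst ` (A \<inter> UNIV \<times> {..a}) \<union> (if 0 \<le> a then - fst ` A else {})"
    proof (cases "x \<in> fst ` A")
      case True
      have "\<sigma> x \<le> a \<longleftrightarrow> (\<exists>y\<le>a. (x, y) \<in> A)"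
        using fiber[OF True] by (auto intro: order_trans)
      then show ?thesis using True by (auto intro!: image_eqI[where x = "(x, _)"])
    next
      case False
      then have "x \<notin> fst ` (A \<inter> UNIV \<times> {..a})" by blast
      then show ?thesis using False by (simp add: \<sigma>_def)
    qed
  qed
  moreover have "closed (fst ` (A \<inter> UNIV \<times> {..a}))" "closed (fst ` A)" for a
    using cl[of "{..a}"] cl[of UNIV] by auto
  ultimately have "{x \<in> space borel. \<sigma> x \<le> a} \<in> sets borel" for a
    by (auto intro!: sets.Un borel_closed borel_comp)
  then have "\<sigma> \<in> borel_measurable borel" by (intro borel_measurableI_le) auto
  then show ?thesis using that fiber by blast
qed

section \<open>Choquet's maximality argument\<close>

text \<open>The mixture is built as a bind over a fair coin, so that its sigma-algebra, total mass
  and integrals all follow from the rules for \<open>bind\<close>.\<close>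

lemma mixture_prob_algebra:
  assumes P: "P \<in> space (prob_algebra N)" "Q \<in> space (prob_algebra N)"
  obtains R where "R \<in> space (prob_algebra N)"
    "\<And>A. A \<in> sets N \<Longrightarrow> emeasure R A = emeasure P A * ennreal (1/2) + emeasure Q A * ennreal (1/2)"
    "\<And>f :: _ \<Rightarrow> real. f \<in> borel_measurable N \<Longrightarrow> (\<And>x. x \<in> space N \<Longrightarrow> \<bar>f x\<bar> \<le> 1) \<Longrightarrow>
      (\<integral>x. f x \<partial>R) = ((\<integral>x. f x \<partial>P) + (\<integral>x. f x \<partial>Q)) / 2"
proof
  let ?k = "\<lambda>b::bool. if b then P else Q"
  let ?R = "measure_pmf (bernoulli_pmf (1/2)) \<bind> ?k"
  have pmf: "measure_pmf (bernoulli_pmf (1/2)) \<in> space (prob_algebra (count_space UNIV))"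
    by (simp add: space_prob_algebra measure_pmf.prob_space_axioms)
  have k': "?k \<in> count_space UNIV \<rightarrow>\<^sub>M prob_algebra N" using P by auto
  have k: "?k \<in> measure_pmf (bernoulli_pmf (1/2)) \<rightarrow>\<^sub>M prob_algebra N"
    using P by (auto simp: measurable_def)
  show "?R \<in> space (prob_algebra N)"
    using prob_space_bind'[OF pmf k'] sets_bind'[OF pmf k'] by (simp add: space_prob_algebra)
  show "emeasure ?R A = emeasure P A * ennreal (1/2) + emeasure Q A * ennreal (1/2)" if "A \<in> sets N" for A
    using that by (subst emeasure_bind_prob_algebra[OF pmf k']) auto
  show "(\<integral>x. f x \<partial>?R) = ((\<integral>x. f x \<partial>P) + (\<integral>x. f x \<partial>Q)) / 2"
    if "f \<in> borel_measurable N" "\<And>x. x \<in> space N \<Longrightarrow> \<bar>f x\<bar> \<le> 1" for f :: "_ \<Rightarrow> real"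
    using that P
    by (subst integral_bind[where K = N and B = 1 and B' = 1])
       (auto simp: space_prob_algebra space_subprob_algebra prob_space_imp_subprob_space prob_space.emeasure_space_1
          intro!: measurable_prob_algebraD[OF k] measure_pmf.finite_measure_axioms)
qed

text \<open>The functions \<open>F i\<close> are the coordinates of a map from \<open>K\<close> into
  a cube; in the application \<open>F i t\<close> is the integral of the \<open>i\<close>-th test
  function against the measure with parameter \<open>t\<close>. Midpoints and convexity refer to
  that image, not to the linear structure of the reals in \<open>K\<close>.\<close>

locale midpoint_system =
  fixes K :: "real set" and F :: "nat \<Rightarrow> real \<Rightarrow> real"
  assumes K: "compact K" "K \<subseteq> {0..1}"
    and F_cont: "\<And>i. continuous_on K (F i)"
    and F_meas[measurable]: "\<And>i. F i \<in> borel_measurable borel"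
    and F_range: "\<And>i t. F i t \<in> {0..1}"
begin

definition midpoint :: "real \<Rightarrow> real \<Rightarrow> real \<Rightarrow> bool" where
  "midpoint t t1 t2 \<longleftrightarrow> (\<forall>i. F i t = (F i t1 + F i t2) / 2)"

text \<open>A strictly convex function of the coordinates \<open>F i t\<close>. The weights add up
  to 1, which bounds the values by 1 and makes the series converge uniformly, so that continuity on
  \<open>K\<close> survives.\<close>

definition potential :: "real \<Rightarrow> real" where
  "potential t = (\<Sum>i. (1/2) ^ Suc i * (F i t)\<^sup>2)"

lemma F_square: "0 \<le> (F i t)\<^sup>2" "(F i t)\<^sup>2 \<le> 1" "\<bar>F i t\<bar> \<le> 1"
  using F_range[of i t] by (auto simp: power_le_one)

lemma summable_potential: "summable (\<lambda>i. (1/2) ^ Suc i * (F i t)\<^sup>2)"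
proof (rule summable_comparison_test')
  show "summable (\<lambda>i. (1/2::real) ^ Suc i)" by (simp add: summable_mult)
  show "norm ((1/2) ^ Suc n * (F n t)\<^sup>2) \<le> (1/2) ^ Suc n" if "n \<ge> 0" for n
    using F_square[of n t] by (simp add: abs_mult)
qed

lemma potential_measurable[measurable]: "potential \<in> borel_measurable borel"
  unfolding potential_def by measurable

lemma potential_bound: "\<bar>potential t\<bar> \<le> 1"
proof -
  have "0 \<le> potential t" unfolding potential_def by (intro suminf_nonneg summable_potential) auto
  moreover have "potential t \<le> (\<Sum>i. (1/2) ^ Suc i)"
    unfolding potential_def
    by (intro suminf_le summable_potential sums_summable[OF power_half_series]) (use F_square in auto)
  moreover have "(\<Sum>i. (1/2::real) ^ Suc i) = 1" using power_half_series by (rule sums_unique[symmetric])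
  ultimately show ?thesis by auto
qed

lemma potential_cont: "continuous_on K potential"
proof (rule uniform_limit_theorem[where F = sequentially])
  show "uniform_limit K (\<lambda>n t. \<Sum>i<n. (1/2) ^ Suc i * (F i t)\<^sup>2) potential sequentially"
    unfolding potential_def
    by (rule Weierstrass_m_test[where M = "\<lambda>i. (1/2) ^ Suc i"])
       (use F_square in \<open>auto simp: abs_mult intro!: sums_summable[OF power_half_series[simplified]] summable_mult\<close>)
  show "\<forall>\<^sub>F n in sequentially. continuous_on K (\<lambda>t. \<Sum>i<n. (1/2) ^ Suc i * (F i t)\<^sup>2)"
    by (intro always_eventually allI continuous_intros F_cont)
qed auto

text \<open>By the parallelogram identity the convexity defect is the weighted sum of the squares of
  \<open>(F i t1 - F i t2) / 2\<close>, whose \<open>j\<close>-th term is positive.\<close>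

lemma potential_strict:
  assumes "midpoint t t1 t2" "F j t1 \<noteq> F j t2"
  shows "potential t < (potential t1 + potential t2) / 2"
proof -
  let ?d = "\<lambda>i. (1/2) ^ Suc i * ((F i t1 - F i t2) / 2)\<^sup>2"
  have Ft: "F i t = (F i t1 + F i t2) / 2" for i using assms(1) by (simp add: midpoint_def)
  have eq: "(1/2) ^ Suc i * (F i t1)\<^sup>2 / 2 + (1/2) ^ Suc i * (F i t2)\<^sup>2 / 2 - (1/2) ^ Suc i * (F i t)\<^sup>2 = ?d i" for i
    by (subst Ft) (simp add: power2_eq_square field_simps)
  have "(\<lambda>i. (1/2) ^ Suc i * (F i t1)\<^sup>2 / 2 + (1/2) ^ Suc i * (F i t2)\<^sup>2 / 2 - (1/2) ^ Suc i * (F i t)\<^sup>2)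
    sums (potential t1 / 2 + potential t2 / 2 - potential t)"
    unfolding potential_def
    by (intro sums_diff sums_add sums_divide summable_sums summable_potential)
  then have "?d sums (potential t1 / 2 + potential t2 / 2 - potential t)" unfolding eq .
  moreover have "0 < (\<Sum>i. ?d i)"
    by (rule suminf_pos2[of _ j]) (use assms(2) sums_summable[OF calculation] in auto)
  ultimately show ?thesis by (simp add: sums_iff)
qed

section \<open>Maximal measures and measurable splitting\<close>

lemma integrable_bounded:
  assumes "\<eta> \<in> prob_on A" "g \<in> borel_measurable borel" "\<And>t. \<bar>g t :: real\<bar> \<le> 1"
  shows "integrable \<eta> g"
proof -
  interpret prob_space \<eta> using prob_on_D[OF assms(1)] by simp
  note [measurable_cong] = prob_on_D(2)[OF assms(1)]
  show ?thesis using assms by (intro integrable_const_bound[where B = 1]) auto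
qed

text \<open>Prescribing the integrals of all \<open>F i\<close> cuts out a closed part of the
  compact set of moment sequences, and the integral of \<open>potential\<close> is continuous on
  it.\<close>

lemma ex_maximal:
  assumes \<eta>0: "\<eta>0 \<in> prob_on K"
  obtains \<eta> where "\<eta> \<in> prob_on K" "\<And>i. (\<integral>t. F i t \<partial>\<eta>) = (\<integral>t. F i t \<partial>\<eta>0)"
    "\<And>\<nu>. \<nu> \<in> prob_on K \<Longrightarrow> (\<And>i. (\<integral>t. F i t \<partial>\<nu>) = (\<integral>t. F i t \<partial>\<eta>0)) \<Longrightarrow>
      (\<integral>t. potential t \<partial>\<nu>) \<le> (\<integral>t. potential t \<partial>\<eta>)"
proof -
  let ?M = "moments ` prob_on K"
  have "\<exists>G. continuous_on ?M G \<and> (\<forall>\<eta>\<in>prob_on K. G (moments \<eta>) = (\<integral>t. F i t \<partial>\<eta>))" for i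
    using continuous_integral_moments[OF K(1) F_cont F_meas] by metis
  then obtain G where G: "\<And>i. continuous_on ?M (G i)"
    "\<And>i \<eta>. \<eta> \<in> prob_on K \<Longrightarrow> G i (moments \<eta>) = (\<integral>t. F i t \<partial>\<eta>)" by metis
  obtain H where H: "continuous_on ?M H"
    "\<And>\<eta>. \<eta> \<in> prob_on K \<Longrightarrow> H (moments \<eta>) = (\<integral>t. potential t \<partial>\<eta>)"
    using continuous_integral_moments[OF K(1) potential_cont potential_measurable] by metis
  define C where "C = {x \<in> ?M. (\<lambda>i. G i x) = (\<lambda>i. \<integral>t. F i t \<partial>\<eta>0)}"
  have "closedin (top_of_set ?M) C"
    unfolding C_def
    by (intro continuous_closedin_preimage_constant continuous_on_coordinatewise_then_product G)
  then have "compact C" using compact_moments[OF K] by (rule closedin_compact[rotated])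
  moreover have "C \<noteq> {}" using \<eta>0 G(2) by (auto simp: C_def)
  moreover have "continuous_on C H" by (rule continuous_on_subset[OF H(1)]) (auto simp: C_def)
  ultimately obtain x where x: "x \<in> C" "\<And>y. y \<in> C \<Longrightarrow> H y \<le> H x"
    using continuous_attains_sup by metis
  then obtain \<eta> where \<eta>: "\<eta> \<in> prob_on K" "x = moments \<eta>" "\<And>i. (\<integral>t. F i t \<partial>\<eta>) = (\<integral>t. F i t \<partial>\<eta>0)"
    using G(2) by (auto simp: C_def fun_eq_iff)
  show ?thesis
  proof
    fix \<nu> assume \<nu>: "\<nu> \<in> prob_on K" "\<And>i. (\<integral>t. F i t \<partial>\<nu>) = (\<integral>t. F i t \<partial>\<eta>0)"
    then have "moments \<nu> \<in> C" using G(2) by (auto simp: C_def)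
    then show "(\<integral>t. potential t \<partial>\<nu>) \<le> (\<integral>t. potential t \<partial>\<eta>)"
      using x(2)[of "moments \<nu>"] H(2) \<nu>(1) \<eta> by simp
  qed (use \<eta> in auto)
qed

text \<open>A gain of at least \<open>1 / Suc m\<close> is a closed condition, unlike a strictly
  positive gain; letting \<open>m\<close> vary recovers all proper splits. The pairs nest to the
  left because \<open>t1\<close> is selected as a function of \<open>t\<close>, and then
  \<open>t2\<close> as a function of \<open>(t, t1)\<close>.\<close>

definition split_set :: "nat \<Rightarrow> ((real \<times> real) \<times> real) set" where
  "split_set m = {((t, t1), t2) | t t1 t2. t \<in> K \<and> t1 \<in> K \<and> t2 \<in> K \<and> midpoint t t1 t2 \<and>
     (potential t1 + potential t2) / 2 - potential t \<in> {1 / Suc m..}}"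

lemma compact_split_set: "compact (split_set m)"
proof -
  let ?K3 = "(K \<times> K) \<times> K"
  have comp: "continuous_on ?K3 (\<lambda>p. f (fst (fst p)))" "continuous_on ?K3 (\<lambda>p. f (snd (fst p)))"
    "continuous_on ?K3 (\<lambda>p. f (snd p))" if "continuous_on K f" for f :: "real \<Rightarrow> real"
    by (rule continuous_on_compose2[OF that]; force intro!: continuous_intros)+
  have "closedin (top_of_set ?K3) {p \<in> ?K3. (\<lambda>i. F i (fst (fst p)) - (F i (snd (fst p)) + F i (snd p)) / 2) = (\<lambda>i. 0)}"
    by (intro continuous_closedin_preimage_constant continuous_on_coordinatewise_then_product
        continuous_intros comp F_cont) auto
  moreover have "closedin (top_of_set ?K3) (?K3 \<inter> (\<lambda>p. (potential (snd (fst p)) + potential (snd p)) / 2 - potential (fst (fst p))) -` {1 / Suc m..})"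
    by (intro continuous_closedin_preimage continuous_intros comp potential_cont) auto
  ultimately have "closedin (top_of_set ?K3) ({p \<in> ?K3. (\<lambda>i. F i (fst (fst p)) - (F i (snd (fst p)) + F i (snd p)) / 2) = (\<lambda>i. 0)} \<inter>
    (?K3 \<inter> (\<lambda>p. (potential (snd (fst p)) + potential (snd p)) / 2 - potential (fst (fst p))) -` {1 / Suc m..}))"
    by (rule closedin_Int)
  also have "\<dots> = split_set m"
    unfolding split_set_def midpoint_def fun_eq_iff by (auto simp del: divide_eq_eq_numeral1 eq_divide_eq_numeral1)
  finally show ?thesis
    by (rule closedin_compact[rotated]) (intro compact_Times K)
qed

text \<open>Let \<open>P\<close> be the set of points with a split in \<open>split_set m\<close>.
  Moving half of the mass at each \<open>t\<close> in \<open>P\<close> to \<open>\<tau>1 t\<close>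
  and half to \<open>\<tau>2 t\<close> keeps the integrals of all \<open>F i\<close> and raises that
  of \<open>potential\<close> by at least \<open>prob P / Suc m\<close>, so maximality forces
  \<open>prob P = 0\<close>.\<close>

lemma maximal_imp_null_split:
  assumes \<eta>: "\<eta> \<in> prob_on K"
    and max: "\<And>\<nu>. \<nu> \<in> prob_on K \<Longrightarrow> (\<And>i. (\<integral>t. F i t \<partial>\<nu>) = (\<integral>t. F i t \<partial>\<eta>)) \<Longrightarrow>
      (\<integral>t. potential t \<partial>\<nu>) \<le> (\<integral>t. potential t \<partial>\<eta>)"
  shows "AE t in \<eta>. t \<notin> fst ` fst ` split_set m"
proof -
  interpret prob_space \<eta> using prob_on_D[OF \<eta>] by simp
  note [measurable_cong] = prob_on_D(2)[OF \<eta>]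
  let ?A = "split_set m"
  have cA: "compact (fst ` ?A)" "compact (fst ` fst ` ?A)"
    by (intro compact_continuous_image continuous_intros compact_split_set)+
  define P where "P = fst ` fst ` ?A"
  have [measurable]: "P \<in> sets borel" using cA(2) by (auto simp: P_def intro: borel_compact)
  obtain \<sigma>1 :: "real \<Rightarrow> real" where \<sigma>1[measurable]: "\<sigma>1 \<in> borel_measurable borel"
    and \<sigma>1A: "\<And>t. t \<in> P \<Longrightarrow> (t, \<sigma>1 t) \<in> fst ` ?A"
    using measurable_compact_section[OF cA(1)] unfolding P_def by metis
  obtain \<sigma>2 :: "real \<times> real \<Rightarrow> real" where \<sigma>2: "\<sigma>2 \<in> borel_measurable borel"
    and \<sigma>2A: "\<And>x. x \<in> fst ` ?A \<Longrightarrow> (x, \<sigma>2 x) \<in> ?A"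
    using measurable_compact_section[OF compact_split_set] by metis
  have [measurable]: "(\<lambda>t. \<sigma>2 (t, \<sigma>1 t)) \<in> borel_measurable borel"
    by (rule measurable_compose[OF _ \<sigma>2]) (simp add: borel_prod[symmetric])
  \<comment> \<open>Outside \<open>P\<close> both maps are the identity, so the mass there stays in
    place.\<close>
  define \<tau>1 where "\<tau>1 t = (if t \<in> P then \<sigma>1 t else t)" for t
  define \<tau>2 where "\<tau>2 t = (if t \<in> P then \<sigma>2 (t, \<sigma>1 t) else t)" for t
  have [measurable]: "\<tau>1 \<in> borel_measurable borel" "\<tau>2 \<in> borel_measurable borel"
    unfolding \<tau>1_def \<tau>2_def by measurable
  have A: "((t, \<tau>1 t), \<tau>2 t) \<in> ?A" if "t \<in> P" for t
    using \<sigma>2A[OF \<sigma>1A[OF that]] that by (simp add: \<tau>1_def \<tau>2_def)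
  have \<tau>K: "\<tau>1 t \<in> K" "\<tau>2 t \<in> K" if "t \<in> K" for t
    using A[of t] that by (cases "t \<in> P"; auto simp: split_set_def \<tau>1_def \<tau>2_def)+
  have mid: "(F i (\<tau>1 t) + F i (\<tau>2 t)) / 2 = F i t" for i t
    using A[of t] by (cases "t \<in> P") (auto simp: split_set_def midpoint_def \<tau>1_def \<tau>2_def)
  have gain: "indicator P t / Suc m \<le> (potential (\<tau>1 t) + potential (\<tau>2 t)) / 2 - potential t" for t
    using A[of t] by (cases "t \<in> P") (auto simp: split_set_def \<tau>1_def \<tau>2_def)
  have \<tau>_distr: "distr \<eta> borel \<tau> \<in> space (prob_algebra borel)" if "\<tau> \<in> borel_measurable borel" for \<tau>
    using that by (auto simp: space_prob_algebra intro!: prob_space_distr)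
  obtain R where R: "R \<in> space (prob_algebra borel)"
    "\<And>B. B \<in> sets borel \<Longrightarrow> emeasure R B = emeasure (distr \<eta> borel \<tau>1) B * ennreal (1/2) + emeasure (distr \<eta> borel \<tau>2) B * ennreal (1/2)"
    "\<And>f :: _ \<Rightarrow> real. f \<in> borel_measurable borel \<Longrightarrow> (\<And>x. x \<in> space borel \<Longrightarrow> \<bar>f x\<bar> \<le> 1) \<Longrightarrow>
      (\<integral>x. f x \<partial>R) = ((\<integral>x. f x \<partial>distr \<eta> borel \<tau>1) + (\<integral>x. f x \<partial>distr \<eta> borel \<tau>2)) / 2"
    using mixture_prob_algebra[OF \<tau>_distr \<tau>_distr, of \<tau>1 \<tau>2] by auto
  have int_R: "(\<integral>x. f x \<partial>R) = (\<integral>t. (f (\<tau>1 t) + f (\<tau>2 t)) / 2 \<partial>\<eta>)"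
    if [measurable]: "f \<in> borel_measurable borel" and "\<And>x. \<bar>f x\<bar> \<le> 1" for f :: "real \<Rightarrow> real"
  proof -
    have "integrable \<eta> (\<lambda>t. f (\<tau>1 t))" "integrable \<eta> (\<lambda>t. f (\<tau>2 t))"
      by (rule integrable_bounded[OF \<eta>]; use that in auto)+
    then show ?thesis using that by (subst R(3)) (auto simp: integral_distr)
  qed
  have Kb[measurable]: "K \<in> sets borel" using K by (auto intro: borel_compact)
  have "emeasure (distr \<eta> borel \<tau>) (-K) = 0" if [measurable]: "\<tau> \<in> borel_measurable borel" and "\<And>t. t \<in> K \<Longrightarrow> \<tau> t \<in> K" for \<tau>
  proof -
    have "AE x in distr \<eta> borel \<tau>. x \<in> K"
      by (subst AE_distr_iff) (use prob_on_D(4)[OF \<eta>] that in \<open>auto elim: eventually_mono\<close>)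
    then show ?thesis by (subst (asm) AE_iff_measurable[of "-K"]) auto
  qed
  then have "emeasure R (-K) = 0" using \<tau>K by (subst R(2)) auto
  then have "AE t in R. t \<in> K"
    using R(1) by (intro AE_I[of _ _ "-K"]) (auto simp: space_prob_algebra)
  then have RK: "R \<in> prob_on K" using R(1) by (simp add: prob_on_def)
  have "(\<integral>t. F i t \<partial>R) = (\<integral>t. F i t \<partial>\<eta>)" for i
    using F_square by (subst int_R) (auto simp: mid)
  from max[OF RK this] have le: "(\<integral>t. potential t \<partial>R) \<le> (\<integral>t. potential t \<partial>\<eta>)" .
  have int: "integrable \<eta> potential" "integrable \<eta> (\<lambda>t. indicator P t / Suc m)"
    "integrable \<eta> (\<lambda>t. (potential (\<tau>1 t) + potential (\<tau>2 t)) / 2)"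
  proof -
    have "\<bar>(potential a + potential b) / 2\<bar> \<le> 1" for a b
      using potential_bound[of a] potential_bound[of b]
      by (auto simp: abs_le_iff)
    then show "integrable \<eta> (\<lambda>t. (potential (\<tau>1 t) + potential (\<tau>2 t)) / 2)"
      by (intro integrable_bounded[OF \<eta>]) auto
  qed (rule integrable_bounded[OF \<eta>]; use potential_bound in \<open>auto simp: indicator_def\<close>)+
  have "prob P / Suc m = (\<integral>t. indicator P t / Suc m \<partial>\<eta>)"
    by (simp add: prob_on_D(3)[OF \<eta>])
  also have "\<dots> \<le> (\<integral>t. (potential (\<tau>1 t) + potential (\<tau>2 t)) / 2 - potential t \<partial>\<eta>)"
    using int gain by (intro integral_mono Bochner_Integration.integrable_diff) auto
  also have "\<dots> = (\<integral>t. potential t \<partial>R) - (\<integral>t. potential t \<partial>\<eta>)"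
    using potential_bound int by (subst int_R) auto
  finally have "prob P / Suc m \<le> 0" using le by simp
  then have "prob P = 0" using measure_nonneg[of \<eta> P] by (simp add: field_simps)
  then show ?thesis
    unfolding P_def[symmetric] by (intro AE_I[of _ _ P]) (auto simp: emeasure_eq_measure)
qed

text \<open>The points with some proper split form the countable union of the projections of the
  compact sets \<open>split_set m\<close>, a Borel set that is null for a maximal measure.
  \<open>E\<close> is its complement in \<open>K\<close>.\<close>

lemma ex_concentrated_on_non_midpoints:
  assumes \<eta>0: "\<eta>0 \<in> prob_on K"
  obtains \<eta> E where "\<eta> \<in> prob_on K" "\<And>i. (\<integral>t. F i t \<partial>\<eta>) = (\<integral>t. F i t \<partial>\<eta>0)"
    "E \<in> sets borel" "AE t in \<eta>. t \<in> E" "E \<subseteq> K"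
    "\<And>t t1 t2 j. t \<in> E \<Longrightarrow> t1 \<in> K \<Longrightarrow> t2 \<in> K \<Longrightarrow> midpoint t t1 t2 \<Longrightarrow> F j t1 = F j t2"
proof -
  obtain \<eta> where \<eta>: "\<eta> \<in> prob_on K" "\<And>i. (\<integral>t. F i t \<partial>\<eta>) = (\<integral>t. F i t \<partial>\<eta>0)"
    "\<And>\<nu>. \<nu> \<in> prob_on K \<Longrightarrow> (\<And>i. (\<integral>t. F i t \<partial>\<nu>) = (\<integral>t. F i t \<partial>\<eta>0)) \<Longrightarrow>
      (\<integral>t. potential t \<partial>\<nu>) \<le> (\<integral>t. potential t \<partial>\<eta>)"
    using ex_maximal[OF \<eta>0] by metis
  define E where "E = K - (\<Union>m. fst ` fst ` split_set m)"
  have "compact (fst ` fst ` split_set m)" for m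
    by (intro compact_continuous_image continuous_intros compact_split_set)
  then have "E \<in> sets borel"
    unfolding E_def using K(1) by (intro sets.Diff sets.countable_UN borel_compact) (auto intro: borel_compact)
  moreover have "AE t in \<eta>. t \<notin> fst ` fst ` split_set m" for m
    using \<eta> by (intro maximal_imp_null_split) auto
  then have "AE t in \<eta>. \<forall>m. t \<notin> fst ` fst ` split_set m" by (subst AE_all_countable) blast
  then have "AE t in \<eta>. t \<in> E"
    using prob_on_D(4)[OF \<eta>(1)] by eventually_elim (auto simp: E_def)
  moreover have "F j t1 = F j t2" if *: "t \<in> E" "t1 \<in> K" "t2 \<in> K" "midpoint t t1 t2" for t t1 t2 j
  proof (rule ccontr)
    assume "F j t1 \<noteq> F j t2"
    then have "0 < (potential t1 + potential t2) / 2 - potential t"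
      using potential_strict *(4) by auto
    then obtain m where "1 / Suc m < (potential t1 + potential t2) / 2 - potential t"
      using nat_approx_posE by blast
    then have "((t, t1), t2) \<in> split_set m" using * by (auto simp: split_set_def E_def)
    then have "t \<in> fst ` fst ` split_set m" by force
    then show False using *(1) by (auto simp: E_def)
  qed
  ultimately show ?thesis using that[of \<eta> E] \<eta> by (auto simp: E_def)
qed

end

section \<open>The weak topology\<close>

lemma space_borel_of [simp]: "space (borel_of T) = topspace T"
  unfolding borel_of_def by (rule space_measure_of) (auto dest: openin_subset)

lemma sets_borel_of: "sets (borel_of T) = sigma_sets (topspace T) {S. openin T S}"
  unfolding borel_of_def by (rule sets_measure_of) (auto dest: openin_subset)

lemma openin_borel_of: "openin T S \<Longrightarrow> S \<in> sets (borel_of T)"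
  by (simp add: sets_borel_of)

lemma closedin_borel_of: "closedin T S \<Longrightarrow> S \<in> sets (borel_of T)"
  using sets.compl_sets[of "topspace T - S" "borel_of T"] openin_borel_of[of T "topspace T - S"]
  by (auto simp: closedin_def double_diff)

lemma measurable_borel_ofI:
  assumes "\<And>x. x \<in> space M \<Longrightarrow> f x \<in> topspace T" "\<And>U. openin T U \<Longrightarrow> f -` U \<inter> space M \<in> sets M"
  shows "f \<in> M \<rightarrow>\<^sub>M borel_of T"
  unfolding borel_of_def
  by (rule measurable_measure_of) (use assms in \<open>auto dest: openin_subset\<close>)

lemma measurable_continuous_map:
  assumes "continuous_map X Y f"
  shows "f \<in> borel_of X \<rightarrow>\<^sub>M borel_of Y"
proof (rule measurable_borel_ofI)
  show "f x \<in> topspace Y" if "x \<in> space (borel_of X)" for x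
    using continuous_map_funspace[OF assms] that by auto
  fix U assume "openin Y U"
  then have "openin X {x \<in> topspace X. f x \<in> U}" by (rule openin_continuous_map_preimage[OF assms])
  then show "f -` U \<inter> space (borel_of X) \<in> sets (borel_of X)"
    by (auto dest!: openin_borel_of simp: vimage_def Collect_conj_eq[symmetric] conj_commute Int_def)
qed

lemma sets_borel_of_euclidean: "sets (borel_of euclidean) = sets borel"
  by (simp add: sets_borel_of borel_def)

lemma measurable_continuous_map_real:
  assumes "continuous_map X euclideanreal f"
  shows "f \<in> borel_measurable (borel_of X)"
  using measurable_continuous_map[OF assms] by (simp cong: measurable_cong_sets add: sets_borel_of_euclidean)

lemma topspace_weak_topology [simp]: "topspace (weak_topology T) = space (prob_algebra (borel_of T))"
proof -
  have "space (prob_algebra (borel_of T)) \<in> {{P \<in> space (prob_algebra (borel_of T)). (\<integral>x. f x \<partial>P) \<in> U} | f U.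
        continuous_map T euclideanreal f \<and> bounded (f ` topspace T) \<and> open U}"
    by (auto intro!: exI[of _ "\<lambda>_. 0"] exI[of _ "UNIV::real set"] simp: bounded_iff)
  then show ?thesis unfolding weak_topology_def topology_generated_by_topspace by blast
qed

lemma continuous_map_weak_integral:
  assumes "continuous_map T euclideanreal f" "bounded (f ` topspace T)"
  shows "continuous_map (weak_topology T) euclideanreal (\<lambda>P. \<integral>x. f x \<partial>P)"
  unfolding continuous_map_def
proof (intro conjI allI impI)
  fix U :: "real set" assume "openin euclideanreal U"
  then show "openin (weak_topology T) {P \<in> topspace (weak_topology T). (\<integral>x. f x \<partial>P) \<in> U}"
    unfolding topspace_weak_topology
    unfolding weak_topology_def by (intro topology_generated_by_Basis) (use assms in auto)
qed auto

lemma continuous_map_into_weak: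
  assumes "g \<in> topspace X \<rightarrow> space (prob_algebra (borel_of T))"
    and "\<And>f. continuous_map T euclideanreal f \<Longrightarrow> bounded (f ` topspace T) \<Longrightarrow>
      continuous_map X euclideanreal (\<lambda>x. \<integral>y. f y \<partial>g x)"
  shows "continuous_map X (weak_topology T) g"
  unfolding weak_topology_def
proof (rule continuous_on_generated_topo)
  show "g ` topspace X \<subseteq> \<Union> {{P \<in> space (prob_algebra (borel_of T)). (\<integral>x. f x \<partial>P) \<in> U} | f U.
        continuous_map T euclideanreal f \<and> bounded (f ` topspace T) \<and> open U}"
    using assms(1) topspace_weak_topology[of T]
    unfolding weak_topology_def topology_generated_by_topspace by (metis image_subset_iff_funcset subset_refl)
  fix V assume "V \<in> {{P \<in> space (prob_algebra (borel_of T)). (\<integral>x. f x \<partial>P) \<in> U} | f U.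
        continuous_map T euclideanreal f \<and> bounded (f ` topspace T) \<and> open U}"
  then obtain f U where V: "V = {P \<in> space (prob_algebra (borel_of T)). (\<integral>x. f x \<partial>P) \<in> U}"
    "continuous_map T euclideanreal f" "bounded (f ` topspace T)" "open U" by auto
  have "openin X {x \<in> topspace X. (\<integral>y. f y \<partial>g x) \<in> U}"
    using openin_continuous_map_preimage[OF assms(2)[OF V(2,3)]] V(4) by simp
  also have "{x \<in> topspace X. (\<integral>y. f y \<partial>g x) \<in> U} = g -` V \<inter> topspace X"
    using assms(1) V(1) by auto
  finally show "openin X (g -` V \<inter> topspace X)" .
qed

text \<open>The indicators of a countable intersection-stable base \<open>Ob\<close> are pointwise
  limits of continuous functions \<open>f i m\<close>. The countably many integrals of the
  \<open>f i m\<close> are therefore weakly continuous and determine a probability measure; they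
  serve as separating coordinates on a compact set of measures.\<close>

locale borel_approx =
  fixes T :: "'a topology" and Ob :: "nat \<Rightarrow> 'a set" and f :: "nat \<Rightarrow> nat \<Rightarrow> 'a \<Rightarrow> real"
  assumes Ob_open: "\<And>i. openin T (Ob i)"
    and Ob_Int: "Int_stable (range Ob)"
    and Ob_sets: "sets (borel_of T) = sigma_sets (topspace T) (range Ob)"
    and Ob_base: "\<And>U x. openin T U \<Longrightarrow> x \<in> U \<Longrightarrow> \<exists>i. x \<in> Ob i \<and> Ob i \<subseteq> U"
    and Ob_UNIV: "topspace T \<in> range Ob"
    and f_cont: "\<And>i m. continuous_map T euclideanreal (f i m)"
    and f_range: "\<And>i m x. f i m x \<in> {0..1}"
    and f_lim: "\<And>i x. x \<in> topspace T \<Longrightarrow> (\<lambda>m. f i m x) \<longlonglongrightarrow> indicator (Ob i) x"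
begin

lemma f_meas[measurable]: "f i m \<in> borel_measurable (borel_of T)"
  by (rule measurable_continuous_map_real[OF f_cont])

lemma f_bounded: "bounded (f i m ` topspace T)"
  using f_range[of i m] by (auto simp: bounded_iff intro!: exI[of _ 1])

lemma integral_f_range:
  assumes "P \<in> space (prob_algebra (borel_of T))"
  shows "(\<integral>x. f i m x \<partial>P) \<in> {0..1}"
proof -
  interpret prob_space P using assms by (simp add: space_prob_algebra)
  have [measurable_cong]: "sets P = sets (borel_of T)" using assms by (simp add: space_prob_algebra)
  have "integrable P (f i m)"
    by (rule integrable_const_bound[where B = 1]) (use f_range[of i m] in auto)
  then show ?thesis
    using f_range[of i m] integral_le_const[of "f i m" 1] by (auto intro!: integral_nonneg)
qed

lemma integral_tendsto_Ob:
  assumes "P \<in> space (prob_algebra (borel_of T))"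
  shows "(\<lambda>m. \<integral>x. f i m x \<partial>P) \<longlonglongrightarrow> measure P (Ob i)"
proof -
  interpret prob_space P using assms by (simp add: space_prob_algebra)
  have [measurable_cong]: "sets P = sets (borel_of T)" using assms by (simp add: space_prob_algebra)
  have sp: "space P = topspace T" using assms by (auto simp: space_prob_algebra dest: sets_eq_imp_space_eq)
  have [measurable]: "Ob i \<in> sets (borel_of T)" by (intro openin_borel_of Ob_open)
  have "(\<lambda>m. \<integral>x. f i m x \<partial>P) \<longlonglongrightarrow> (\<integral>x. indicator (Ob i) x \<partial>P)"
    by (rule integral_dominated_convergence[where w = "\<lambda>_. 1"]) (use f_range f_lim sp in auto)
  then show ?thesis using openin_subset[OF Ob_open[of i]] sp by (simp add: Int_absorb2)
qed

text \<open>In the limit the integrals fix the measure of each \<open>Ob i\<close>, and the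
  \<open>Ob i\<close> form an intersection-stable generator that contains the whole space.\<close>

lemma prob_eqI:
  assumes P: "P \<in> space (prob_algebra (borel_of T))" and Q: "Q \<in> space (prob_algebra (borel_of T))"
    and eq: "\<And>i m. (\<integral>x. f i m x \<partial>P) = (\<integral>x. f i m x \<partial>Q)"
  shows "P = Q"
proof -
  interpret P: prob_space P using P by (simp add: space_prob_algebra)
  interpret Q: prob_space Q using Q by (simp add: space_prob_algebra)
  have sets: "sets P = sigma_sets (topspace T) (range Ob)" "sets Q = sigma_sets (topspace T) (range Ob)"
    using P Q by (auto simp: space_prob_algebra Ob_sets)
  have "measure P (Ob i) = measure Q (Ob i)" for i
    using LIMSEQ_unique[OF integral_tendsto_Ob[OF P, of i]] integral_tendsto_Ob[OF Q, of i] by (simp add: eq)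
  then show ?thesis
    by (intro measure_eqI_generator_eq[OF Ob_Int _ _ sets, of "\<lambda>_. topspace T"])
       (use Ob_open Ob_UNIV in \<open>auto simp: P.emeasure_eq_measure Q.emeasure_eq_measure dest: openin_subset\<close>)
qed

text \<open>Evaluation at \<open>Ob i\<close> is a pointwise limit of the given measurable
  integrals, and it suffices to check evaluations on an intersection-stable generator.\<close>

lemma measurable_prob_algebraI_integral:
  assumes S: "\<And>a. a \<in> space M \<Longrightarrow> S a \<in> space (prob_algebra (borel_of T))"
    and meas: "\<And>i m. (\<lambda>a. \<integral>x. f i m x \<partial>S a) \<in> borel_measurable M"
  shows "S \<in> M \<rightarrow>\<^sub>M prob_algebra (borel_of T)"
proof (rule measurable_prob_algebra_generated[OF Ob_sets Ob_Int])
  show "range Ob \<subseteq> Pow (topspace T)" using openin_subset[OF Ob_open] by auto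
  show "prob_space (S a)" "sets (S a) = sets (borel_of T)" if "a \<in> space M" for a
    using S[OF that] by (auto simp: space_prob_algebra)
  fix A assume "A \<in> range Ob"
  then obtain i where A: "A = Ob i" by auto
  have "(\<lambda>a. measure (S a) (Ob i)) \<in> borel_measurable M"
    by (rule borel_measurable_LIMSEQ_real[OF integral_tendsto_Ob meas]) (rule S)
  then have "(\<lambda>a. ennreal (measure (S a) (Ob i))) \<in> borel_measurable M" by measurable
  also have "?this \<longleftrightarrow> (\<lambda>a. emeasure (S a) A) \<in> borel_measurable M"
    using S by (intro measurable_cong)
      (simp add: A space_prob_algebra finite_measure.emeasure_eq_measure prob_space.finite_measure)
  finally show "(\<lambda>a. emeasure (S a) A) \<in> borel_measurable M" .
qed

lemma Hausdorff_weak_topology: "Hausdorff_space (weak_topology T)"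
  unfolding Hausdorff_space_def
proof (intro allI impI)
  fix P Q assume PQ: "P \<in> topspace (weak_topology T) \<and> Q \<in> topspace (weak_topology T) \<and> P \<noteq> Q"
  then obtain i m where ne: "(\<integral>x. f i m x \<partial>P) \<noteq> (\<integral>x. f i m x \<partial>Q)" using prob_eqI by (metis topspace_weak_topology)
  then obtain U V :: "real set" where UV: "open U" "open V" "(\<integral>x. f i m x \<partial>P) \<in> U" "(\<integral>x. f i m x \<partial>Q) \<in> V" "U \<inter> V = {}"
    using hausdorff[OF ne] by auto
  let ?pre = "\<lambda>U. {P \<in> topspace (weak_topology T). (\<integral>x. f i m x \<partial>P) \<in> U}"
  have "openin (weak_topology T) (?pre V)" if "open V" for V
    by (rule openin_continuous_map_preimage[OF continuous_map_weak_integral[OF f_cont f_bounded]])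
       (use that in simp)
  then have "openin (weak_topology T) (?pre U)" "openin (weak_topology T) (?pre V)" using UV by blast+
  moreover have "P \<in> ?pre U" "Q \<in> ?pre V" "disjnt (?pre U) (?pre V)"
    using PQ UV by (auto simp: disjnt_def)
  ultimately show "\<exists>U V. openin (weak_topology T) U \<and> openin (weak_topology T) V \<and> P \<in> U \<and> Q \<in> V \<and> disjnt U V"
    by blast
qed

end

text \<open>The sets are finite intersections of balls of radii \<open>1 / Suc j\<close> around the
  points of a dense sequence, coded by lists of index pairs: appending lists intersects the sets,
  and the empty list gives the whole space. The functions are products of clamped multiples of
  \<open>1 / Suc j - d (e i) x\<close>; they are eventually 1 inside all the balls and 0 outside one
  of them.\<close>

lemma ex_borel_approx:
  assumes "metrizable_space T" "separable_space T"
  obtains Ob f where "borel_approx T Ob f"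
proof -
  obtain M d where "Metric_space M d" and T: "T = Metric_space.mtopology M d"
    using assms(1) unfolding metrizable_space_def by blast
  then interpret Metric_space M d by simp
  obtain A where A: "countable A" "A \<subseteq> M" "mtopology closure_of A = M"
    using assms(2) unfolding separable_space_def T by auto
  define e where "e = from_nat_into A"
  define clamp where "clamp t = max 0 (min 1 t)" for t :: real
  define O' where "O' L = {x \<in> M. \<forall>(i, j) \<in> set L. d (e i) x < 1 / Suc j}" for L :: "(nat \<times> nat) list"
  define g where "g L m x = (\<Prod>(i, j) \<leftarrow> L. clamp (real m * (1 / Suc j - d (e i) x)))" for L :: "(nat \<times> nat) list" and m x
  have eM: "e i \<in> M" if "x \<in> M" for i x
  proof -
    have "A \<noteq> {}" using A(3) that by auto
    then show ?thesis using A(2) from_nat_into[of A i] by (auto simp: e_def)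
  qed
  have O'_Cons: "O' ((i, j) # L) = mball (e i) (1 / Suc j) \<inter> O' L" for i j L
    using eM by (auto simp: O'_def in_mball)
  have O'_Nil: "O' [] = M" by (simp add: O'_def)
  have O'_open: "openin mtopology (O' L)" for L
  proof (induction L)
    case (Cons p L)
    then show ?case by (cases p) (auto simp: O'_Cons intro: openin_mball)
  qed (auto simp: O'_Nil)
  have g_range: "g L m x \<in> {0..1}" for L m x
  proof (induction L)
    case (Cons p L)
    then show ?case by (cases p) (auto simp: g_def clamp_def intro!: mult_le_one)
  qed (auto simp: g_def)
  have g_lim: "(\<lambda>m. g L m x) \<longlonglongrightarrow> indicator (O' L) x" if x: "x \<in> M" for L x
  proof (induction L)
    case (Cons p L)
    obtain i j where p: "p = (i, j)" by force
    let ?s = "1 / Suc j - d (e i) x"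
    have "(\<lambda>m. clamp (real m * ?s)) \<longlonglongrightarrow> of_bool (?s > 0)"
    proof (cases "?s > 0")
      case True
      obtain N :: nat where N: "1 / ?s \<le> N" using real_arch_simple by blast
      have "clamp (real m * ?s) = 1" if "m \<ge> N" for m
      proof -
        have "1 \<le> real N * ?s" using N True by (simp only: divide_le_eq if_True)
        also have "\<dots> \<le> real m * ?s" using that True by (intro mult_right_mono) auto
        finally show ?thesis by (simp add: clamp_def)
      qed
      then show ?thesis using True
        by (intro tendsto_eventually eventually_sequentiallyI[of N]) auto
    next
      case False
      have "clamp (real m * ?s) = 0" for m
      proof -
        have "real m * ?s \<le> 0" using False by (intro mult_nonneg_nonpos) auto
        then show ?thesis by (simp add: clamp_def)
      qed
      then show ?thesis using False by simp
    qed
    then have "(\<lambda>m. clamp (real m * ?s) * g L m x) \<longlonglongrightarrow> of_bool (?s > 0) * indicator (O' L) x"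
      using Cons.IH by (rule tendsto_mult)
    moreover have "of_bool (?s > 0) * indicator (O' L) x = (indicator (O' (p # L)) x :: real)"
      using x by (auto simp: p O'_def indicator_def)
    ultimately show ?case by (simp add: g_def p)
  qed (auto simp: g_def O'_Nil x)
  have g_cont: "continuous_map mtopology euclideanreal (g L m)" for L m
  \<comment> \<open>In an empty space the centres \<open>e i\<close> need not be points of
    \<open>M\<close>, so nothing is known about distances to them.\<close>
  proof (cases "M = {}")
    case True
    then have empty: "topspace mtopology = {}" by (metis topspace_mtopology)
    show ?thesis unfolding continuous_map_def empty by simp
  next
    case False
    show ?thesis
    proof (induction L)
      case (Cons p L)
      obtain i j where p: "p = (i, j)" by force
      have "continuous_map mtopology euclideanreal (\<lambda>x. d (e i) x)"
        using eM False continuous_on_mdist[of "e i" Self] by (auto simp: mtopology_of_def)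
      then have "continuous_map mtopology euclideanreal (\<lambda>x. clamp (real m * (1 / Suc j - d (e i) x)) * g L m x)"
        unfolding clamp_def
        by (intro continuous_map_real_mult Cons.IH continuous_map_real_max continuous_map_real_min
            continuous_map_diff) auto
      then show ?case by (simp add: g_def p)
    qed (simp add: g_def)
  qed
  have O'_base: "\<exists>i j. x \<in> O' [(i, j)] \<and> O' [(i, j)] \<subseteq> U" if U: "openin mtopology U" "x \<in> U" for x U
  proof -
    obtain r where r: "r > 0" "mball x r \<subseteq> U" and x: "x \<in> M"
      using U unfolding openin_mtopology by (meson subsetD)
    \<comment> \<open>A ball of radius \<open>1 / Suc j\<close> whose centre is closer than
      \<open>1 / Suc j\<close> to \<open>x\<close> stays within \<open>2 / Suc j < r\<close> of
      \<open>x\<close>.\<close>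
    obtain j where j: "1 / Suc j < r / 2" using nat_approx_posE[of "r / 2"] r by auto
    have "x \<in> mtopology closure_of A" using A(3) x by simp
    then obtain y where y: "y \<in> A" "y \<in> mball x (1 / Suc j)"
      using j r unfolding metric_closure_of by (smt (verit) mem_Collect_eq of_nat_0_less_iff zero_less_Suc zero_less_divide_1_iff)
    then obtain i where i: "y = e i" using A(1) unfolding e_def by (metis from_nat_into_to_nat_on)
    have yx: "d (e i) x < 1 / Suc j" using y(2) by (simp add: i commute)
    moreover have "z \<in> U" if "z \<in> O' [(i, j)]" for z
    proof -
      have z: "z \<in> M" "d (e i) z < 1 / Suc j" using that by (auto simp: O'_def)
      have "d x z \<le> d x (e i) + d (e i) z" using triangle x z(1) eM[OF x] by blast
      then have "d x z < r" using yx z j by (simp add: commute)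
      then show ?thesis using r x z by auto
    qed
    ultimately show ?thesis using x by (force simp: O'_def)
  qed
  let ?O = "\<lambda>n. O' (from_nat n)"
  have rng: "range ?O = range O'"
    using image_image[of O' from_nat "UNIV :: nat set"] by simp
  have "borel_approx T ?O (\<lambda>n. g (from_nat n))"
  proof
    show "Int_stable (range ?O)"
    proof -
      have "O' L \<inter> O' L' = O' (L @ L')" for L L' by (auto simp: O'_def)
      then show ?thesis unfolding rng by (auto simp: Int_stable_def)
    qed
    show "\<exists>n. x \<in> ?O n \<and> ?O n \<subseteq> U" if "openin T U" "x \<in> U" for U x
      using O'_base that unfolding T by (metis from_nat_to_nat)
    show "topspace T \<in> range ?O" unfolding rng T using O'_Nil by auto
    show "sets (borel_of T) = sigma_sets (topspace T) (range ?O)"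
      unfolding sets_borel_of rng
    proof (rule sigma_sets_eqI)
      fix U assume "U \<in> {S. openin T S}"
      then have U: "openin mtopology U" by (simp add: T)
      have "U = (\<Union>p\<in>{p. O' [p] \<subseteq> U}. O' [p])" using O'_base[OF U] by fast
      moreover have "countable {p. O' [p] \<subseteq> U}" by simp
      then have "(\<Union>p\<in>{p. O' [p] \<subseteq> U}. O' [p]) \<in> sigma_sets (topspace T) (range O')"
        by (intro sigma_sets_UNION) auto
      ultimately show "U \<in> sigma_sets (topspace T) (range O')" by simp
    next
      fix U assume "U \<in> range O'"
      then show "U \<in> sigma_sets (topspace T) {S. openin T S}" using O'_open by (auto simp: T)
    qed
  qed (use O'_open g_cont g_range g_lim in \<open>auto simp: T\<close>)
  then show ?thesis by (rule that)
qed

lemma second_countable_metrizable_separable: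
  assumes "metrizable_space T" "separable_space T"
  shows "second_countable T"
proof -
  obtain Ob f where "borel_approx T Ob f" using ex_borel_approx[OF assms] .
  then interpret borel_approx T Ob f .
  show ?thesis
    unfolding second_countable_def
  proof (intro exI[of _ "range Ob"] conjI ballI allI impI)
    show "\<exists>V\<in>range Ob. x \<in> V \<and> V \<subseteq> U" if "openin T U \<and> x \<in> U" for U x
      using Ob_base[of U x] that by auto
  qed (use Ob_open in auto)
qed

section \<open>Mixtures over a compact set of measures\<close>

text \<open>With \<open>N\<close> the strategic measures of deterministic teams and \<open>W\<close>
  the cube, this is the shape of \<open>L_C\<close>. The parameter space is left general because the
  argument only has to find a copy of the unit interval in it.\<close>

definition mixtures :: "'a topology \<Rightarrow> 'a measure set \<Rightarrow> 'z measure \<Rightarrow> 'a measure set" where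
  "mixtures T N W = {P \<in> space (prob_algebra (borel_of T)). \<exists>\<eta> \<in> space (prob_algebra W). \<exists>t.
     (\<forall>z\<in>space W. t z \<in> N) \<and> t \<in> W \<rightarrow>\<^sub>M borel_of (weak_topology T) \<and>
     (\<forall>B \<in> sets (borel_of T). emeasure P B = (\<integral>\<^sup>+ z. emeasure (t z) B \<partial>\<eta>))}"

text \<open>\<open>S\<close> is continuous on \<open>K\<close> only, but is measurable with values
  in \<open>C\<close> on the whole line, so that measures on the reals can be bound with it.\<close>

locale compact_param = borel_approx T Ob f
  for T :: "'a topology" and Ob f +
  fixes C :: "'a measure set" and K :: "real set" and S :: "real \<Rightarrow> 'a measure"
  assumes K: "compact K" "K \<subseteq> {0..1}"
    and C: "C \<subseteq> space (prob_algebra (borel_of T))"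
    and S_K: "S ` K = C" and S_C: "\<And>t. S t \<in> C"
    and S_cont: "continuous_map (top_of_set K) (weak_topology T) S"
    and S_meas: "S \<in> borel \<rightarrow>\<^sub>M prob_algebra (borel_of T)"
begin

lemma S_prob: "S t \<in> space (prob_algebra (borel_of T))"
  using S_C C by auto

lemma K_borel[measurable]: "K \<in> sets borel"
  using K(1) by (rule borel_compact)

lemma integral_S_cont:
  assumes "continuous_map T euclideanreal g" "bounded (g ` topspace T)"
  shows "continuous_on K (\<lambda>t. \<integral>x. g x \<partial>S t)"
  using continuous_map_compose[OF S_cont continuous_map_weak_integral[OF assms]] by (simp add: o_def)

lemma integral_S_meas:
  assumes "g \<in> borel_measurable (borel_of T)"
  shows "(\<lambda>t. \<integral>x. g x \<partial>S t :: real) \<in> borel_measurable borel"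
  using measurable_prob_algebraD[OF S_meas] integral_measurable_subprob_algebra[OF assms]
  by (rule measurable_compose)

lemma bind_S:
  assumes "\<eta> \<in> prob_on K"
  shows "\<eta> \<bind> S \<in> space (prob_algebra (borel_of T))"
    and "B \<in> sets (borel_of T) \<Longrightarrow> emeasure (\<eta> \<bind> S) B = (\<integral>\<^sup>+ t. emeasure (S t) B \<partial>\<eta>)"
    and "g \<in> borel_measurable (borel_of T) \<Longrightarrow> bounded (g ` topspace T) \<Longrightarrow>
      (\<integral>x. g x \<partial>(\<eta> \<bind> S)) = (\<integral>t. (\<integral>x. g x \<partial>S t) \<partial>\<eta> :: real)"
proof -
  have \<eta>: "\<eta> \<in> space (prob_algebra borel)" using assms by (simp add: prob_on_def)
  show "\<eta> \<bind> S \<in> space (prob_algebra (borel_of T))"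
    using prob_space_bind'[OF \<eta> S_meas] sets_bind'[OF \<eta> S_meas] by (simp add: space_prob_algebra)
  show "B \<in> sets (borel_of T) \<Longrightarrow> emeasure (\<eta> \<bind> S) B = (\<integral>\<^sup>+ t. emeasure (S t) B \<partial>\<eta>)"
    by (rule emeasure_bind_prob_algebra[OF \<eta> S_meas])
  assume g: "g \<in> borel_measurable (borel_of T)" "bounded (g ` topspace T)"
  then obtain c where "\<And>x. x \<in> topspace T \<Longrightarrow> \<bar>g x\<bar> \<le> c" by (auto simp: bounded_iff)
  moreover have "emeasure (S t) (space (S t)) = 1" for t
    using S_prob[of t] by (simp add: space_prob_algebra prob_space.emeasure_space_1)
  moreover have "S \<in> \<eta> \<rightarrow>\<^sub>M subprob_algebra (borel_of T)"
    using measurable_prob_algebraD[OF S_meas] prob_on_D(2)[OF assms] by (simp cong: measurable_cong_sets)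
  ultimately show "(\<integral>x. g x \<partial>(\<eta> \<bind> S)) = (\<integral>t. (\<integral>x. g x \<partial>S t) \<partial>\<eta> :: real)"
    using g(1) prob_on_D(1)[OF assms]
    by (intro integral_bind[where K = "borel_of T" and B = c and B' = 1])
       (auto simp: prob_space.finite_measure)
qed

lemma bind_S_eqI:
  assumes "\<eta> \<in> prob_on K" "\<nu> \<in> prob_on K"
    and "\<And>i m. (\<integral>t. (\<integral>x. f i m x \<partial>S t) \<partial>\<eta>) = (\<integral>t. (\<integral>x. f i m x \<partial>S t) \<partial>\<nu>)"
  shows "\<eta> \<bind> S = \<nu> \<bind> S"
  using assms by (intro prob_eqI bind_S) (simp_all add: bind_S(3) f_bounded)

text \<open>The barycentre \<open>\<eta> \<bind> S\<close> depends on \<open>\<eta>\<close> only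
  through its moments, and its integrals of bounded continuous functions are continuous in them. The
  set of barycentres is thus a continuous image of the compact set of moment sequences.\<close>

lemma compactin_bind_S: "compactin (weak_topology T) ((\<lambda>\<eta>. \<eta> \<bind> S) ` prob_on K)"
proof -
  let ?M = "moments ` prob_on K"
  \<comment> \<open>A representing measure is picked for each moment sequence;
    \<open>\<beta>_moments\<close> shows that the pick does not affect the barycentre.\<close>
  define \<beta> where "\<beta> x = inv_into (prob_on K) moments x \<bind> S" for x
  have inv: "inv_into (prob_on K) moments x \<in> prob_on K" "moments (inv_into (prob_on K) moments x) = x"
    if "x \<in> ?M" for x
    using that by (auto intro: inv_into_into f_inv_into_f)
  have G: "\<exists>G. continuous_on ?M G \<and> (\<forall>\<eta>\<in>prob_on K. G (moments \<eta>) = (\<integral>t. (\<integral>x. g x \<partial>S t) \<partial>\<eta>))"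
    if "continuous_map T euclideanreal g" "bounded (g ` topspace T)" for g
    using continuous_integral_moments[OF K(1) integral_S_cont[OF that] integral_S_meas[OF measurable_continuous_map_real[OF that(1)]]]
    by metis
  have \<beta>_moments: "\<beta> (moments \<eta>) = \<eta> \<bind> S" if "\<eta> \<in> prob_on K" for \<eta>
    unfolding \<beta>_def
  proof (rule bind_S_eqI)
    show "inv_into (prob_on K) moments (moments \<eta>) \<in> prob_on K" using inv that by auto
    show "(\<integral>t. (\<integral>x. f i m x \<partial>S t) \<partial>inv_into (prob_on K) moments (moments \<eta>)) = (\<integral>t. (\<integral>x. f i m x \<partial>S t) \<partial>\<eta>)" for i m
      using G[OF f_cont f_bounded, of i m] inv[of "moments \<eta>"] that by (metis imageI)
  qed (rule that)
  have "continuous_map (top_of_set ?M) (weak_topology T) \<beta>"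
  proof (rule continuous_map_into_weak)
    show "\<beta> \<in> topspace (top_of_set ?M) \<rightarrow> space (prob_algebra (borel_of T))"
      using \<beta>_moments bind_S(1) by auto
    fix g assume g: "continuous_map T euclideanreal g" "bounded (g ` topspace T)"
    then obtain G where G: "continuous_on ?M G" "\<And>\<eta>. \<eta> \<in> prob_on K \<Longrightarrow> G (moments \<eta>) = (\<integral>t. (\<integral>x. g x \<partial>S t) \<partial>\<eta>)"
      using G by blast
    have "(\<integral>y. g y \<partial>\<beta> x) = G x" if "x \<in> ?M" for x
      using that \<beta>_moments G(2) bind_S(3)[OF _ measurable_continuous_map_real[OF g(1)] g(2)] by auto
    then show "continuous_map (top_of_set ?M) euclideanreal (\<lambda>x. \<integral>y. g y \<partial>\<beta> x)"
      using G(1) by (simp cong: continuous_on_cong)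
  qed
  then have "compactin (weak_topology T) (\<beta> ` ?M)"
    using compact_moments[OF K] by (intro image_compactin[of "top_of_set ?M"]) (auto simp: compactin_subtopology)
  also have "\<beta> ` ?M = (\<lambda>\<eta>. \<eta> \<bind> S) ` prob_on K"
    using \<beta>_moments by (auto simp: image_iff)
  finally show ?thesis .
qed

text \<open>The least parameter in each fibre of \<open>S\<close> works:
  \<open>\<sigma> z \<le> a\<close> means that \<open>t z\<close> lies in the image of
  \<open>K \<inter> {..a}\<close> under \<open>S\<close>, which is compact and hence closed in the
  Hausdorff weak topology.\<close>

lemma measurable_lift:
  assumes t: "t \<in> W \<rightarrow>\<^sub>M borel_of (weak_topology T)" and tC: "\<And>z. z \<in> space W \<Longrightarrow> t z \<in> C"
  obtains \<sigma> where "\<sigma> \<in> borel_measurable W" "\<And>z. z \<in> space W \<Longrightarrow> \<sigma> z \<in> K" "\<And>z. z \<in> space W \<Longrightarrow> S (\<sigma> z) = t z"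
proof -
  define \<sigma> where "\<sigma> z = Inf {s \<in> K. S s = t z}" for z
  have fiber: "\<sigma> z \<in> {s \<in> K. S s = t z}" "s \<in> K \<Longrightarrow> S s = t z \<Longrightarrow> \<sigma> z \<le> s" if z: "z \<in> space W" for z s
  proof -
    have "closedin (weak_topology T) {t z}"
      using tC[OF z] C by (intro closedin_Hausdorff_singleton Hausdorff_weak_topology) auto
    from closedin_continuous_map_preimage[OF S_cont this]
    have "compact {s \<in> K. S s = t z}" using K(1) by (auto intro: closedin_compact)
    moreover have "{s \<in> K. S s = t z} \<noteq> {}" using S_K tC[OF z] by auto
    ultimately show "\<sigma> z \<in> {s \<in> K. S s = t z}"
      unfolding \<sigma>_def by (intro closed_contains_Inf bounded_imp_bdd_below compact_imp_bounded compact_imp_closed)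
    show "\<sigma> z \<le> s" if "s \<in> K" "S s = t z"
      unfolding \<sigma>_def using that \<open>compact {s \<in> K. S s = t z}\<close>
      by (intro cInf_lower bounded_imp_bdd_below compact_imp_bounded) auto
  qed
  have "{z \<in> space W. \<sigma> z \<le> a} \<in> sets W" for a
  proof -
    have "compactin (top_of_set K) (K \<inter> {..a})"
      using K(1) by (auto simp: compactin_subtopology intro: compact_Int_closed)
    then have "closedin (weak_topology T) (S ` (K \<inter> {..a}))"
      by (intro compactin_imp_closedin Hausdorff_weak_topology image_compactin[OF _ S_cont])
    then have "t -` (S ` (K \<inter> {..a})) \<inter> space W \<in> sets W"
      by (intro measurable_sets[OF t] closedin_borel_of)
    also have "t -` (S ` (K \<inter> {..a})) \<inter> space W = {z \<in> space W. \<sigma> z \<le> a}"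
    proof safe
      fix z s assume "z \<in> space W" "t z = S s" "s \<in> K" "s \<le> a"
      then show "\<sigma> z \<le> a" using fiber(2)[of z s] by auto
    next
      fix z assume "z \<in> space W" "\<sigma> z \<le> a"
      then show "z \<in> t -` S ` (K \<inter> {..a})"
        using fiber(1)[of z] by (auto intro!: image_eqI[of "t z" S "\<sigma> z"])
    qed
    finally show ?thesis .
  qed
  then have "\<sigma> \<in> borel_measurable W" by (intro borel_measurableI_le) auto
  then show ?thesis using that fiber by blast
qed

text \<open>Pushing the mixing measure forward along a measurable lift of the family to
  \<open>K\<close> turns a mixture over \<open>W\<close> into the barycentre of a measure on
  \<open>K\<close>.\<close>

lemma mixtures_subset: 
  assumes "N \<subseteq> C"
  shows "mixtures T N W \<subseteq> (\<lambda>\<eta>. \<eta> \<bind> S) ` prob_on K"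
proof
  fix P assume "P \<in> mixtures T N W"
  then obtain \<eta> t where P: "P \<in> space (prob_algebra (borel_of T))" and \<eta>: "\<eta> \<in> space (prob_algebra W)"
    and t: "\<And>z. z \<in> space W \<Longrightarrow> t z \<in> N" "t \<in> W \<rightarrow>\<^sub>M borel_of (weak_topology T)"
    and Pt: "\<And>B. B \<in> sets (borel_of T) \<Longrightarrow> emeasure P B = (\<integral>\<^sup>+ z. emeasure (t z) B \<partial>\<eta>)"
    unfolding mixtures_def by blast
  interpret prob_space \<eta> using \<eta> by (simp add: space_prob_algebra)
  have \<eta>W: "sets \<eta> = sets W" "space \<eta> = space W" 
    using \<eta> by (auto simp: space_prob_algebra dest: sets_eq_imp_space_eq)
  obtain \<sigma> where \<sigma>: "\<sigma> \<in> borel_measurable W" "\<And>z. z \<in> space W \<Longrightarrow> \<sigma> z \<in> K" "\<And>z. z \<in> space W \<Longrightarrow> S (\<sigma> z) = t z"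
    using measurable_lift[OF t(2)] t(1) assms by (metis subsetD)
  have \<sigma>\<eta>: "\<sigma> \<in> borel_measurable \<eta>" using \<sigma>(1) \<eta>W by (simp cong: measurable_cong_sets)
  let ?\<nu> = "distr \<eta> borel \<sigma>"
  have \<nu>: "?\<nu> \<in> prob_on K"
    using \<sigma>\<eta> \<sigma>(2) \<eta>W by (auto simp: prob_on_def space_prob_algebra AE_distr_iff intro!: prob_space_distr)
  have "P = ?\<nu> \<bind> S"
  proof (rule measure_eqI)
    show "sets P = sets (?\<nu> \<bind> S)"
      using P bind_S(1)[OF \<nu>] by (simp add: space_prob_algebra)
    fix B assume "B \<in> sets P"
    then have B: "B \<in> sets (borel_of T)" using P by (simp add: space_prob_algebra)
    have "(\<lambda>t. emeasure (S t) B) \<in> borel_measurable borel"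
      by (rule measurable_compose[OF measurable_prob_algebraD[OF S_meas] measurable_emeasure_subprob_algebra[OF B]])
    then have "emeasure (?\<nu> \<bind> S) B = (\<integral>\<^sup>+ z. emeasure (S (\<sigma> z)) B \<partial>\<eta>)"
      using \<sigma>\<eta> by (simp add: bind_S(2)[OF \<nu> B] nn_integral_distr)
    also have "\<dots> = emeasure P B"
      using \<sigma>(3) \<eta>W by (auto simp: Pt[OF B] intro!: nn_integral_cong)
    finally show "emeasure P B = emeasure (?\<nu> \<bind> S) B" ..
  qed
  then show "P \<in> (\<lambda>\<eta>. \<eta> \<bind> S) ` prob_on K" using \<nu> by blast
qed

text \<open>Continuity of \<open>S\<close> on \<open>K\<close> gives measurability for the Borel
  sets of the weak topology directly, without comparing them with the sigma-algebra of
  \<open>prob_algebra\<close>.\<close>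

lemma measurable_S_weak:
  assumes E: "E \<in> sets borel" "E \<subseteq> K" and Q: "Q \<in> space (prob_algebra (borel_of T))"
  shows "(\<lambda>t. if t \<in> E then S t else Q) \<in> borel \<rightarrow>\<^sub>M borel_of (weak_topology T)"
proof (rule measurable_borel_ofI)
  show "(if t \<in> E then S t else Q) \<in> topspace (weak_topology T)" for t
    using S_prob Q by simp
  fix U assume "openin (weak_topology T) U"
  then have "openin (top_of_set K) {t \<in> K. S t \<in> U}"
    using openin_continuous_map_preimage[OF S_cont] by simp
  then obtain V where "open V" "{t \<in> K. S t \<in> U} = K \<inter> V" by (auto simp: openin_open)
  then have "{t \<in> K. S t \<in> U} \<in> sets borel" by auto
  then have "E \<inter> {t \<in> K. S t \<in> U} \<union> (if Q \<in> U then - E else {}) \<in> sets borel"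
    using E by auto
  also have "E \<inter> {t \<in> K. S t \<in> U} \<union> (if Q \<in> U then - E else {}) = (\<lambda>t. if t \<in> E then S t else Q) -` U \<inter> space borel"
    using E(2) by (auto split: if_splits)
  finally show "(\<lambda>t. if t \<in> E then S t else Q) -` U \<inter> space borel \<in> sets borel" .
qed

text \<open>With the integrals of the test functions as coordinates, a split of \<open>S t\<close>
  inside \<open>C\<close> is a midpoint relation between parameters in \<open>K\<close>. A measure
  with the same barycentre that avoids proper midpoints then lives on parameters \<open>t\<close>
  with \<open>S t \<in> N\<close>. The maps \<open>i\<close> and \<open>r\<close> place the unit
  interval in \<open>W\<close> and read it back, which moves this measure to
  \<open>W\<close>.\<close>

lemma subset_mixtures:
  assumes N: "N \<subseteq> C"
    and split: "\<And>Q. Q \<in> C \<Longrightarrow> Q \<notin> N \<Longrightarrow> \<exists>Q1\<in>C. \<exists>Q2\<in>C. Q1 \<noteq> Q2 \<and>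
      (\<forall>g. continuous_map T euclideanreal g \<longrightarrow> bounded (g ` topspace T) \<longrightarrow>
        (\<integral>x. g x \<partial>Q) = ((\<integral>x. g x \<partial>Q1) + (\<integral>x. g x \<partial>Q2)) / 2)"
    and r: "r \<in> borel_measurable W" and i: "i \<in> borel \<rightarrow>\<^sub>M W" and ri: "\<And>t. t \<in> {0..1::real} \<Longrightarrow> r (i t) = t"
  shows "(\<lambda>\<eta>. \<eta> \<bind> S) ` prob_on K \<subseteq> mixtures T N W"
proof safe
  fix \<eta>0 assume \<eta>0: "\<eta>0 \<in> prob_on K"
  let ?F = "\<lambda>k t. \<integral>x. f (fst (prod_decode k)) (snd (prod_decode k)) x \<partial>S t"
  interpret midpoint_system K ?F
  proof
    show "?F k t \<in> {0..1}" for k t by (intro integral_f_range S_prob)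
  qed (use K integral_S_cont[OF f_cont f_bounded] integral_S_meas[OF f_meas] in auto)
  have F: "?F (prod_encode (i, m)) t = (\<integral>x. f i m x \<partial>S t)" for i m t by simp
  obtain \<eta> E where \<eta>: "\<eta> \<in> prob_on K" "\<And>k. (\<integral>t. ?F k t \<partial>\<eta>) = (\<integral>t. ?F k t \<partial>\<eta>0)"
    and E: "E \<in> sets borel" "AE t in \<eta>. t \<in> E" "E \<subseteq> K"
    and mid: "\<And>t t1 t2 j. t \<in> E \<Longrightarrow> t1 \<in> K \<Longrightarrow> t2 \<in> K \<Longrightarrow> midpoint t t1 t2 \<Longrightarrow> ?F j t1 = ?F j t2"
    by (rule ex_concentrated_on_non_midpoints[OF \<eta>0]) (rule that)
  have "\<eta>0 \<bind> S = \<eta> \<bind> S"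
  proof (rule bind_S_eqI[OF \<eta>0 \<eta>(1)])
    show "(\<integral>t. (\<integral>x. f i m x \<partial>S t) \<partial>\<eta>0) = (\<integral>t. (\<integral>x. f i m x \<partial>S t) \<partial>\<eta>)" for i m
      using \<eta>(2)[of "prod_encode (i, m)"] by simp
  qed
  have EN: "S t \<in> N" if "t \<in> E" for t
  proof (rule ccontr)
    assume "S t \<notin> N"
    then obtain Q1 Q2 where Q: "Q1 \<in> C" "Q2 \<in> C" "Q1 \<noteq> Q2"
      "\<And>g. continuous_map T euclideanreal g \<Longrightarrow> bounded (g ` topspace T) \<Longrightarrow>
        (\<integral>x. g x \<partial>S t) = ((\<integral>x. g x \<partial>Q1) + (\<integral>x. g x \<partial>Q2)) / 2"
      using split[OF S_C] by meson
    then obtain t1 t2 where t12: "t1 \<in> K" "Q1 = S t1" "t2 \<in> K" "Q2 = S t2" using S_K by blast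
    have "midpoint t t1 t2"
      unfolding midpoint_def using Q(4)[OF f_cont f_bounded] t12 by simp
    then have "?F j t1 = ?F j t2" for j using mid[OF that] t12 by blast
    then have "(\<integral>x. f i m x \<partial>S t1) = (\<integral>x. f i m x \<partial>S t2)" for i m using F by metis
    then have "S t1 = S t2" by (intro prob_eqI S_prob)
    then show False using Q(3) t12 by simp
  qed
  interpret prob_space \<eta> using prob_on_D[OF \<eta>(1)] by simp
  have "E \<noteq> {}" using E(2) by auto
  then obtain t0 where "t0 \<in> E" by auto
  \<comment> \<open>The family over \<open>W\<close> must take values in \<open>N\<close> at every
    point, not only almost surely; parameters outside \<open>E\<close> receive this fixed element of
    \<open>N\<close>.\<close>
  define Q0 where "Q0 = S t0"
  have Q0: "Q0 \<in> N" "Q0 \<in> space (prob_algebra (borel_of T))"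
    using EN \<open>t0 \<in> E\<close> S_prob by (auto simp: Q0_def)
  let ?T = "\<lambda>t. if t \<in> E then S t else Q0"
  have i\<eta>: "i \<in> \<eta> \<rightarrow>\<^sub>M W" using i prob_on_D(2)[OF \<eta>(1)] by (simp cong: measurable_cong_sets)
  have T_prob: "?T \<in> borel \<rightarrow>\<^sub>M prob_algebra (borel_of T)"
    using E(1) Q0(2) S_meas by (intro measurable_If_set) auto
  show "\<eta>0 \<bind> S \<in> mixtures T N W"
    unfolding mixtures_def
  proof (safe intro!: bexI exI[of _ "\<lambda>z. ?T (r z)"])
    show "\<eta>0 \<bind> S \<in> space (prob_algebra (borel_of T))" by (rule bind_S(1)[OF \<eta>0])
    show "distr \<eta> W i \<in> space (prob_algebra W)"
      using i\<eta> by (auto simp: space_prob_algebra intro!: prob_space_distr)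
    show "?T (r z) \<in> N" for z using EN Q0 by auto
    show "(\<lambda>z. ?T (r z)) \<in> W \<rightarrow>\<^sub>M borel_of (weak_topology T)"
      using r measurable_S_weak[OF E(1,3) Q0(2)] by (rule measurable_compose)
    fix B assume B: "B \<in> sets (borel_of T)"
    have "(\<lambda>z. emeasure (?T (r z)) B) \<in> borel_measurable W"
      using measurable_compose[OF r measurable_compose[OF measurable_prob_algebraD[OF T_prob] measurable_emeasure_subprob_algebra[OF B]]]
      by simp
    then have "(\<integral>\<^sup>+ z. emeasure (?T (r z)) B \<partial>distr \<eta> W i) = (\<integral>\<^sup>+ t. emeasure (?T (r (i t))) B \<partial>\<eta>)"
      by (subst nn_integral_distr[OF i\<eta>]) (simp_all del: emeasure_distr)
    also have "\<dots> = (\<integral>\<^sup>+ t. emeasure (S t) B \<partial>\<eta>)"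
    proof (rule nn_integral_cong_AE)
      show "AE t in \<eta>. emeasure (?T (r (i t))) B = emeasure (S t) B"
        using E(2)
      proof eventually_elim
        case (elim t)
        then have "r (i t) = t" using ri E(3) K(2) by auto
        then show ?case using elim by simp
      qed
    qed
    also have "\<dots> = emeasure (\<eta>0 \<bind> S) B"
      unfolding \<open>\<eta>0 \<bind> S = \<eta> \<bind> S\<close> by (rule bind_S(2)[OF \<eta>(1) B, symmetric])
    finally show "emeasure (\<eta>0 \<bind> S) B = (\<integral>\<^sup>+ z. emeasure (?T (r z)) B \<partial>distr \<eta> W i)" ..
  qed
qed

end

theorem compactin_mixtures:
  assumes T: "metrizable_space T" "separable_space T"
    and C: "compactin (weak_topology T) C" and N: "N \<subseteq> C"
    and split: "\<And>Q. Q \<in> C \<Longrightarrow> Q \<notin> N \<Longrightarrow> \<exists>Q1\<in>C. \<exists>Q2\<in>C. Q1 \<noteq> Q2 \<and>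
      (\<forall>g. continuous_map T euclideanreal g \<longrightarrow> bounded (g ` topspace T) \<longrightarrow>
        (\<integral>x. g x \<partial>Q) = ((\<integral>x. g x \<partial>Q1) + (\<integral>x. g x \<partial>Q2)) / 2)"
    and W: "r \<in> borel_measurable W" "i \<in> borel \<rightarrow>\<^sub>M W" "\<And>t. t \<in> {0..1::real} \<Longrightarrow> r (i t) = t"
  shows "compactin (weak_topology T) (mixtures T N W)"
proof (cases "C = {}")
  case True
  \<comment> \<open>Since \<open>W\<close> has a point, every mixture uses at least one element of
    \<open>N\<close>.\<close>
  have "i 0 \<in> space W" using measurable_space[OF W(2)] by simp
  then have "mixtures T N W = {}" using N True by (auto simp: mixtures_def)
  then show ?thesis by simp
next
  case False
  obtain Ob f where "borel_approx T Ob f" using ex_borel_approx[OF T] .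
  then interpret borel_approx T Ob f .
  have C_prob: "C \<subseteq> space (prob_algebra (borel_of T))"
    using compactin_subset_topspace[OF C] by simp
  let ?F = "\<lambda>k Q. \<integral>x. f (fst (prod_decode k)) (snd (prod_decode k)) x \<partial>Q"
  obtain K :: "real set" and S0 where K: "compact K" "K \<subseteq> {0..1}"
    and S0: "continuous_map (top_of_set K) (weak_topology T) S0" "S0 ` K = C"
  proof (rule compactin_image_of_Cantor[OF C])
    show "continuous_map (weak_topology T) euclideanreal (?F k)" for k
      by (intro continuous_map_weak_integral f_cont f_bounded)
    show "?F k Q \<in> {0..1}" if "Q \<in> C" for k Q
      using that C_prob by (intro integral_f_range) auto
    show "P = Q" if "P \<in> C" "Q \<in> C" "\<And>k. ?F k P = ?F k Q" for P Q
      using that(1,2) C_prob that(3)[of "prod_encode (_, _)"] by (intro prob_eqI) auto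
  qed
  from False S0(2) obtain t0 where t0: "t0 \<in> K" by auto
  \<comment> \<open>Extension by a constant element of \<open>C\<close> off the compact set
    \<open>K\<close>: it takes values in \<open>C\<close> everywhere and its integrals of test
    functions are Borel.\<close>
  define S where "S t = (if t \<in> K then S0 t else S0 t0)" for t
  have S_C: "S t \<in> C" for t using S0(2) t0 by (auto simp: S_def)
  have S_cont: "continuous_map (top_of_set K) (weak_topology T) S"
    by (rule continuous_map_eq[OF S0(1)]) (auto simp: S_def)
  have "(\<lambda>t. \<integral>x. f i m x \<partial>S t) \<in> borel_measurable borel" for i m
  proof -
    have "(\<lambda>t. if t \<in> K then \<integral>x. f i m x \<partial>S t else \<integral>x. f i m x \<partial>S0 t0) \<in> borel_measurable borel"
      using K(1) continuous_map_compose[OF S_cont continuous_map_weak_integral[OF f_cont f_bounded, of i m]]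
      by (intro borel_measurable_continuous_on_if) (auto simp: o_def borel_compact)
    also have "(\<lambda>t. if t \<in> K then \<integral>x. f i m x \<partial>S t else \<integral>x. f i m x \<partial>S0 t0) = (\<lambda>t. \<integral>x. f i m x \<partial>S t)"
      by (auto simp: S_def)
    finally show ?thesis .
  qed
  then have "S \<in> borel \<rightarrow>\<^sub>M prob_algebra (borel_of T)"
    using S_C C_prob by (intro measurable_prob_algebraI_integral) auto
  moreover have "S ` K = C" using S0(2) by (auto simp: S_def)
  ultimately interpret compact_param T Ob f C K S
    by unfold_locales (use K C_prob S_C S_cont in auto)
  have "mixtures T N W = (\<lambda>\<eta>. \<eta> \<bind> S) ` prob_on K"
    using mixtures_subset[OF N] subset_mixtures[OF N split W] by blast
  then show ?thesis using compactin_bind_S by simp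
qed

section \<open>Product spaces and product kernels\<close>

lemma second_countableE:
  assumes "second_countable X"
  obtains A where "countable A" "\<And>V. V \<in> A \<Longrightarrow> openin X V" "\<And>U x. openin X U \<Longrightarrow> x \<in> U \<Longrightarrow> \<exists>V\<in>A. x \<in> V \<and> V \<subseteq> U"
proof -
  obtain A where A: "countable A" "\<forall>V\<in>A. openin X V" "\<forall>U x. openin X U \<and> x \<in> U \<longrightarrow> (\<exists>V\<in>A. x \<in> V \<and> V \<subseteq> U)"
    using assms unfolding second_countable_def by (elim exE conjE)
  show ?thesis by (rule that[OF A(1)]) (use A(2,3) in simp_all)
qed

lemma second_countable_familyE:
  assumes "\<And>i. i \<in> I \<Longrightarrow> second_countable (X i)"
  obtains A where "\<And>i. i \<in> I \<Longrightarrow> countable (A i)" "\<And>i V. i \<in> I \<Longrightarrow> V \<in> A i \<Longrightarrow> openin (X i) V"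
    "\<And>i U x. i \<in> I \<Longrightarrow> openin (X i) U \<Longrightarrow> x \<in> U \<Longrightarrow> \<exists>V\<in>A i. x \<in> V \<and> V \<subseteq> U"
proof -
  have "\<forall>i\<in>I. \<exists>A. countable A \<and> (\<forall>V\<in>A. openin (X i) V) \<and> (\<forall>U x. openin (X i) U \<and> x \<in> U \<longrightarrow> (\<exists>V\<in>A. x \<in> V \<and> V \<subseteq> U))"
  proof
    fix i assume "i \<in> I"
    from assms[OF this] show "\<exists>A. countable A \<and> (\<forall>V\<in>A. openin (X i) V) \<and> (\<forall>U x. openin (X i) U \<and> x \<in> U \<longrightarrow> (\<exists>V\<in>A. x \<in> V \<and> V \<subseteq> U))"
      unfolding second_countable_def .
  qed
  from bchoice[OF this] obtain A where A: "\<forall>i\<in>I. countable (A i) \<and> (\<forall>V\<in>A i. openin (X i) V) \<and>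
      (\<forall>U x. openin (X i) U \<and> x \<in> U \<longrightarrow> (\<exists>V\<in>A i. x \<in> V \<and> V \<subseteq> U))"
    by (elim exE)
  show ?thesis by (rule that[of A]) (use A in simp_all)
qed

lemma second_countable_prod_topology:
  assumes "second_countable X" "second_countable Y"
  shows "second_countable (prod_topology X Y)"
proof -
  obtain A where A: "countable A" "\<And>V. V \<in> A \<Longrightarrow> openin X V" "\<And>U x. openin X U \<Longrightarrow> x \<in> U \<Longrightarrow> \<exists>V\<in>A. x \<in> V \<and> V \<subseteq> U"
    by (rule second_countableE[OF assms(1)]) (rule that)
  obtain B where B: "countable B" "\<And>V. V \<in> B \<Longrightarrow> openin Y V" "\<And>U x. openin Y U \<Longrightarrow> x \<in> U \<Longrightarrow> \<exists>V\<in>B. x \<in> V \<and> V \<subseteq> U"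
    by (rule second_countableE[OF assms(2)]) (rule that)
  show ?thesis
    unfolding second_countable_def
  proof (intro exI[of _ "(\<lambda>(U, V). U \<times> V) ` (A \<times> B)"] conjI ballI allI impI)
    show "countable ((\<lambda>(U, V). U \<times> V) ` (A \<times> B))" using A(1) B(1) by auto
    show "openin (prod_topology X Y) W" if "W \<in> (\<lambda>(U, V). U \<times> V) ` (A \<times> B)" for W
      using that A(2) B(2) by (auto simp: openin_prod_Times_iff)
    fix U p assume Up: "openin (prod_topology X Y) U \<and> p \<in> U"
    obtain x y where p: "p = (x, y)" by force
    then obtain V W where VW: "openin X V" "openin Y W" "x \<in> V" "y \<in> W" "V \<times> W \<subseteq> U"
      using Up unfolding openin_prod_topology_alt by blast
    then obtain V' W' where "V' \<in> A" "x \<in> V'" "V' \<subseteq> V" "W' \<in> B" "y \<in> W'" "W' \<subseteq> W"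
      using A(3) B(3) by meson
    then show "\<exists>W\<in>(\<lambda>(U, V). U \<times> V) ` (A \<times> B). p \<in> W \<and> W \<subseteq> U"
      using VW p by (intro bexI[of _ "V' \<times> W'"]) auto
  qed
qed

lemma product_topology_basisE:
  assumes "openin (product_topology X I) U" "p \<in> U"
  obtains W where "p \<in> PiE I W" "\<And>i. openin (X i) (W i)" "PiE I W \<subseteq> U"
proof -
  obtain W where "p \<in> PiE I W" "\<forall>i. openin (X i) (W i)" "PiE I W \<subseteq> U"
    using product_topology_open_contains_basis[OF assms] by (elim exE conjE)
  then show ?thesis using that[of W] by simp
qed

lemma second_countable_product_topology_finite:
  assumes I: "finite I" and sc: "\<And>i. i \<in> I \<Longrightarrow> second_countable (X i)"
  shows "second_countable (product_topology X I)"
proof -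
  obtain A where A: "\<And>i. i \<in> I \<Longrightarrow> countable (A i)" "\<And>i V. i \<in> I \<Longrightarrow> V \<in> A i \<Longrightarrow> openin (X i) V"
    "\<And>i U x. i \<in> I \<Longrightarrow> openin (X i) U \<Longrightarrow> x \<in> U \<Longrightarrow> \<exists>V\<in>A i. x \<in> V \<and> V \<subseteq> U"
    by (rule second_countable_familyE[of I X, OF sc]) (assumption | rule that)+
  show ?thesis
    unfolding second_countable_def
  proof (intro exI[of _ "PiE I ` PiE I A"] conjI ballI allI impI)
    show "countable (PiE I ` PiE I A)" using A(1) I by (intro countable_image countable_PiE)
    show "openin (product_topology X I) W" if "W \<in> PiE I ` PiE I A" for W
      using that A(2) I by (auto simp: openin_PiE PiE_iff)
    fix U p assume "openin (product_topology X I) U \<and> p \<in> U"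
    then have "openin (product_topology X I) U" "p \<in> U" by auto
    then obtain W where W: "p \<in> PiE I W" "\<And>i. openin (X i) (W i)" "PiE I W \<subseteq> U"
      by (rule product_topology_basisE) (rule that)
    have "\<forall>i\<in>I. \<exists>V. V \<in> A i \<and> p i \<in> V \<and> V \<subseteq> W i"
      using A(3)[OF _ W(2)] PiE_mem[OF W(1)] by (metis (no_types))
    from bchoice[OF this] obtain V where V: "\<forall>i\<in>I. V i \<in> A i \<and> p i \<in> V i \<and> V i \<subseteq> W i" ..
    have "p \<in> PiE I V" "PiE I V \<subseteq> PiE I W" using V W(1) by (auto simp: PiE_iff)
    moreover have "PiE I V = PiE I (restrict V I)" by (rule PiE_cong) simp
    moreover have "restrict V I \<in> PiE I A" using V by auto
    ultimately show "\<exists>W\<in>PiE I ` PiE I A. p \<in> W \<and> W \<subseteq> U"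
      using W(3) by (metis imageI order_trans)
  qed
qed

text \<open>By second countability an open set is a countable union of open rectangles, so the Borel
  sets of the product topology lie in the product sigma-algebra. Maps into the full space can then
  be checked componentwise.\<close>

lemma measurable_id_prod_topology:
  assumes "second_countable X" "second_countable Y"
  shows "(\<lambda>p. p) \<in> borel_of X \<Otimes>\<^sub>M borel_of Y \<rightarrow>\<^sub>M borel_of (prod_topology X Y)"
proof (rule measurable_borel_ofI)
  obtain A where A: "countable A" "\<And>V. V \<in> A \<Longrightarrow> openin X V" "\<And>U x. openin X U \<Longrightarrow> x \<in> U \<Longrightarrow> \<exists>V\<in>A. x \<in> V \<and> V \<subseteq> U"
    by (rule second_countableE[OF assms(1)]) (rule that)
  obtain B where B: "countable B" "\<And>V. V \<in> B \<Longrightarrow> openin Y V" "\<And>U x. openin Y U \<Longrightarrow> x \<in> U \<Longrightarrow> \<exists>V\<in>B. x \<in> V \<and> V \<subseteq> U"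
    by (rule second_countableE[OF assms(2)]) (rule that)
  fix U assume U: "openin (prod_topology X Y) U"
  let ?R = "{(V, W). V \<in> A \<and> W \<in> B \<and> V \<times> W \<subseteq> U}"
  have "U \<subseteq> (\<Union>(V, W)\<in>?R. V \<times> W)"
  proof
    fix p assume p: "p \<in> U"
    then obtain V W where VW: "openin X V" "openin Y W" "fst p \<in> V" "snd p \<in> W" "V \<times> W \<subseteq> U"
      using U unfolding openin_prod_topology_alt by (metis prod.collapse)
    then obtain V' W' where "V' \<in> A" "fst p \<in> V'" "V' \<subseteq> V" "W' \<in> B" "snd p \<in> W'" "W' \<subseteq> W"
      using A(3) B(3) by meson
    then show "p \<in> (\<Union>(V, W)\<in>?R. V \<times> W)"
      using VW by (intro UN_I[of "(V', W')"]) (auto simp: mem_Times_iff)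
  qed
  then have "U = (\<Union>(V, W)\<in>?R. V \<times> W)" by auto
  moreover have "countable ?R" using A(1) B(1) by (rule countable_subset[of _ "A \<times> B", rotated, OF countable_SIGMA]) auto
  then have "(\<Union>(V, W)\<in>?R. V \<times> W) \<in> sets (borel_of X \<Otimes>\<^sub>M borel_of Y)"
    by (intro sets.countable_UN') (auto intro!: pair_measureI openin_borel_of A(2) B(2))
  ultimately have "U \<in> sets (borel_of X \<Otimes>\<^sub>M borel_of Y)" by simp
  then show "(\<lambda>p. p) -` U \<inter> space (borel_of X \<Otimes>\<^sub>M borel_of Y) \<in> sets (borel_of X \<Otimes>\<^sub>M borel_of Y)" by simp
qed (auto simp: space_pair_measure)

lemma measurable_id_product_topology:
  assumes I: "finite I" and sc: "\<And>i. i \<in> I \<Longrightarrow> second_countable (X i)"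
  shows "(\<lambda>p. p) \<in> PiM I (\<lambda>i. borel_of (X i)) \<rightarrow>\<^sub>M borel_of (product_topology X I)"
proof (rule measurable_borel_ofI)
  obtain A where A: "\<And>i. i \<in> I \<Longrightarrow> countable (A i)" "\<And>i V. i \<in> I \<Longrightarrow> V \<in> A i \<Longrightarrow> openin (X i) V"
    "\<And>i U x. i \<in> I \<Longrightarrow> openin (X i) U \<Longrightarrow> x \<in> U \<Longrightarrow> \<exists>V\<in>A i. x \<in> V \<and> V \<subseteq> U"
    by (rule second_countable_familyE[of I X, OF sc]) (assumption | rule that)+
  fix U assume U: "openin (product_topology X I) U"
  let ?R = "{V \<in> PiE I A. PiE I V \<subseteq> U}"
  have "U \<subseteq> (\<Union>V\<in>?R. PiE I V)"
  proof
    fix p assume "p \<in> U"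
    with U obtain W where W: "p \<in> PiE I W" "\<And>i. openin (X i) (W i)" "PiE I W \<subseteq> U"
      by (rule product_topology_basisE) (rule that)
    have "\<forall>i\<in>I. \<exists>V. V \<in> A i \<and> p i \<in> V \<and> V \<subseteq> W i"
      using A(3)[OF _ W(2)] PiE_mem[OF W(1)] by (metis (no_types))
    from bchoice[OF this] obtain V where V: "\<forall>i\<in>I. V i \<in> A i \<and> p i \<in> V i \<and> V i \<subseteq> W i" ..
    have "p \<in> PiE I V" "PiE I V \<subseteq> PiE I W" using V W(1) by (auto simp: PiE_iff)
    moreover have "PiE I V = PiE I (restrict V I)" by (rule PiE_cong) simp
    moreover have "restrict V I \<in> PiE I A" using V by auto
    ultimately show "p \<in> (\<Union>V\<in>?R. PiE I V)"
      using W(3) by (intro UN_I[of "restrict V I"]) auto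
  qed
  then have eq: "U = (\<Union>V\<in>?R. PiE I V)" by auto
  have "countable ?R"
    using countable_PiE[OF I A(1)] by (rule countable_subset[rotated]) auto
  moreover have "PiE I V \<in> sets (PiM I (\<lambda>i. borel_of (X i)))" if "V \<in> ?R" for V
    using that by (intro sets_PiM_I_finite I openin_borel_of A(2)) auto
  ultimately have "(\<Union>V\<in>?R. PiE I V) \<in> sets (PiM I (\<lambda>i. borel_of (X i)))"
    by (intro sets.countable_UN') auto
  with eq have "U \<in> sets (PiM I (\<lambda>i. borel_of (X i)))" by simp
  moreover have "U \<subseteq> space (PiM I (\<lambda>i. borel_of (X i)))" using openin_subset[OF U] by (simp add: space_PiM)
  ultimately show "(\<lambda>p. p) -` U \<inter> space (PiM I (\<lambda>i. borel_of (X i))) \<in> sets (PiM I (\<lambda>i. borel_of (X i)))"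
    by (simp add: Int_absorb2)
qed (simp add: space_PiM)

section \<open>Finite products of probability measures and kernels\<close>

lemma product_prob_space_extend:
  assumes "\<And>i. i \<in> I \<Longrightarrow> prob_space (M i)"
  shows "product_prob_space (\<lambda>i. if i \<in> I then M i else return (count_space UNIV) undefined)"
  by (rule product_prob_spaceI) (use assms in \<open>auto intro: prob_space_return\<close>)

lemma emeasure_PiM_prob:
  assumes I: "finite I" and M: "\<And>i. i \<in> I \<Longrightarrow> prob_space (M i)" and A: "\<And>i. i \<in> I \<Longrightarrow> A i \<in> sets (M i)"
  shows "emeasure (PiM I M) (PiE I A) = (\<Prod>i\<in>I. emeasure (M i) (A i))"
proof -
  \<comment> \<open>The locale \<open>product_prob_space\<close> asks for probability measures at
    every index; point masses fill the indices outside \<open>I\<close> and leave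
    \<open>PiM I\<close> unchanged.\<close>
  define M' where "M' i = (if i \<in> I then M i else return (count_space UNIV) undefined)" for i
  interpret product_prob_space M' I
    unfolding M'_def by (rule product_prob_space_extend) (rule M)
  have "PiM I M = PiM I M'" by (rule PiM_cong) (simp_all add: M'_def)
  then show ?thesis using I A by (simp add: emeasure_PiM M'_def)
qed

lemma PiM_prob_eqI:
  assumes I: "finite I" and M: "\<And>i. i \<in> I \<Longrightarrow> prob_space (M i)"
    and sets: "sets P = sets (PiM I M)"
    and eq: "\<And>A. (\<And>i. i \<in> I \<Longrightarrow> A i \<in> sets (M i)) \<Longrightarrow> emeasure P (PiE I A) = (\<Prod>i\<in>I. emeasure (M i) (A i))"
  shows "P = PiM I M"
proof -
  define M' where "M' i = (if i \<in> I then M i else return (count_space UNIV) undefined)" for i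
  interpret product_prob_space M' I
    unfolding M'_def by (rule product_prob_space_extend) (rule M)
  have eqM: "PiM I M = PiM I M'" by (rule PiM_cong) (simp_all add: M'_def)
  show ?thesis
    unfolding eqM by (rule PiM_eqI) (use I sets eq in \<open>auto simp: eqM M'_def\<close>)
qed

lemma PiM_return:
  assumes I: "finite I" and x: "\<And>i. i \<in> I \<Longrightarrow> x i \<in> space (N i)"
  shows "PiM I (\<lambda>i. return (N i) (x i)) = return (PiM I N) (restrict x I)"
proof (rule PiM_prob_eqI[symmetric, OF I])
  show "prob_space (return (N i) (x i))" if "i \<in> I" for i using x[OF that] by (rule prob_space_return)
  show "sets (return (PiM I N) (restrict x I)) = sets (PiM I (\<lambda>i. return (N i) (x i)))"
    by (simp cong: sets_PiM_cong)
  fix A assume A: "\<And>i. i \<in> I \<Longrightarrow> A i \<in> sets (return (N i) (x i))"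
  then have "PiE I A \<in> sets (PiM I N)" using I by (intro sets_PiM_I_finite) auto
  then have "emeasure (return (PiM I N) (restrict x I)) (PiE I A) = indicator (PiE I A) (restrict x I)"
    by simp
  also have "\<dots> = (\<Prod>i\<in>I. indicator (A i) (x i))"
    using I by (auto simp: indicator_def prod_zero_iff PiE_iff)
  also have "\<dots> = (\<Prod>i\<in>I. emeasure (return (N i) (x i)) (A i))"
    using A by (intro prod.cong) auto
  finally show "emeasure (return (PiM I N) (restrict x I)) (PiE I A) = (\<Prod>i\<in>I. emeasure (return (N i) (x i)) (A i))" .
qed

lemma measurable_PiM_kernel:
  assumes I: "finite I" and \<kappa>: "\<And>i. i \<in> I \<Longrightarrow> \<kappa> i \<in> M \<rightarrow>\<^sub>M prob_algebra (N i)"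
  shows "(\<lambda>x. PiM I (\<lambda>i. \<kappa> i x)) \<in> M \<rightarrow>\<^sub>M prob_algebra (PiM I N)"
proof (rule measurable_prob_algebra_generated[OF sets_PiM Int_stable_prod_algebra prod_algebra_sets_into_space])
  have \<kappa>': "prob_space (\<kappa> i x)" "sets (\<kappa> i x) = sets (N i)" if "i \<in> I" "x \<in> space M" for i x
    using measurable_space[OF \<kappa>[OF that(1)] that(2)] by (auto simp: space_prob_algebra)
  fix x assume x: "x \<in> space M"
  show "prob_space (PiM I (\<lambda>i. \<kappa> i x))" using \<kappa>' x by (intro prob_space_PiM) auto
  show "sets (PiM I (\<lambda>i. \<kappa> i x)) = sets (PiM I N)" using \<kappa>' x by (intro sets_PiM_cong) auto
next
  have \<kappa>': "prob_space (\<kappa> i x)" "sets (\<kappa> i x) = sets (N i)" if "i \<in> I" "x \<in> space M" for i x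
    using measurable_space[OF \<kappa>[OF that(1)] that(2)] by (auto simp: space_prob_algebra)
  fix A assume "A \<in> prod_algebra I N"
  then obtain X where X: "A = PiE I X" "\<And>i. i \<in> I \<Longrightarrow> X i \<in> sets (N i)"
    unfolding prod_algebra_eq_finite[OF I] by auto
  have "(\<lambda>x. \<Prod>i\<in>I. emeasure (\<kappa> i x) (X i)) \<in> borel_measurable M"
    using \<kappa> X(2) by (intro borel_measurable_prod_ennreal measurable_compose[OF measurable_prob_algebraD measurable_emeasure_subprob_algebra])
  also have "?this \<longleftrightarrow> (\<lambda>x. emeasure (PiM I (\<lambda>i. \<kappa> i x)) A) \<in> borel_measurable M"
    using \<kappa>' X I by (intro measurable_cong) (simp add: emeasure_PiM_prob)
  finally show "(\<lambda>x. emeasure (PiM I (\<lambda>i. \<kappa> i x)) A) \<in> borel_measurable M" .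
qed

text \<open>On boxes the integral factors, and only factor \<open>k\<close> sees \<open>w\<close>.
  Changing the kernel of one agent by a density is thereby a change of density for the joint law of
  the actions.\<close>

lemma PiM_density_component:
  assumes I: "finite I" "k \<in> I" and M: "\<And>i. i \<in> I \<Longrightarrow> prob_space (M i)"
    and w: "w \<in> borel_measurable (M k)" and dens: "prob_space (density (M k) w)"
  shows "PiM I (M(k := density (M k) w)) = density (PiM I M) (\<lambda>u. w (u k))"
proof (rule PiM_prob_eqI[symmetric, OF I(1)])
  define M' where "M' i = (if i \<in> I then M i else return (count_space UNIV) undefined)" for i
  interpret product_prob_space M' I
    unfolding M'_def by (rule product_prob_space_extend) (rule M)
  have eqM: "PiM I M = PiM I M'" by (rule PiM_cong) (simp_all add: M'_def)
  show "prob_space ((M(k := density (M k) w)) i)" if "i \<in> I" for i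
    using M[OF that] dens by simp
  show "sets (density (PiM I M) (\<lambda>u. w (u k))) = sets (PiM I (M(k := density (M k) w)))"
    by (auto intro!: sets_PiM_cong split: if_splits)
  fix A assume "\<And>i. i \<in> I \<Longrightarrow> A i \<in> sets ((M(k := density (M k) w)) i)"
  then have A: "A i \<in> sets (M i)" if "i \<in> I" for i using that by (cases "i = k") force+
  let ?g = "\<lambda>i u. (if i = k then w u else 1) * indicator (A i) u"
  have "(\<lambda>u. w (u k)) \<in> borel_measurable (PiM I M)"
    using measurable_component_singleton[OF I(2)] w by (rule measurable_compose)
  then have "emeasure (density (PiM I M) (\<lambda>u. w (u k))) (PiE I A) = (\<integral>\<^sup>+ u. w (u k) * indicator (PiE I A) u \<partial>PiM I M)"
    using A I(1) by (intro emeasure_density sets_PiM_I_finite)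
  also have "\<dots> = (\<integral>\<^sup>+ u. (\<Prod>i\<in>I. ?g i (u i)) \<partial>PiM I M)"
  proof (intro nn_integral_cong)
    fix u assume "u \<in> space (PiM I M)"
    then have "indicator (PiE I A) u = (\<Prod>i\<in>I. indicator (A i) (u i) :: ennreal)"
      using I(1) by (auto simp: indicator_def space_PiM PiE_iff)
    moreover have "(\<Prod>i\<in>I. if i = k then w (u i) else 1) = w (u k)" using I by simp
    ultimately show "w (u k) * indicator (PiE I A) u = (\<Prod>i\<in>I. ?g i (u i))"
      by (simp add: prod.distrib)
  qed
  also have "\<dots> = (\<integral>\<^sup>+ u. (\<Prod>i\<in>I. ?g i (u i)) \<partial>PiM I M')" by (simp only: eqM)
  also have "\<dots> = (\<Prod>i\<in>I. integral\<^sup>N (M' i) (?g i))"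
  proof (rule product_nn_integral_prod[OF I(1)])
    fix i assume "i \<in> I"
    then show "?g i \<in> borel_measurable (M' i)" using A w by (cases "i = k") (auto simp: M'_def)
  qed
  also have "\<dots> = (\<Prod>i\<in>I. emeasure ((M(k := density (M k) w)) i) (A i))"
    using A w by (intro prod.cong) (auto simp: M'_def emeasure_density)
  finally show "emeasure (density (PiM I M) (\<lambda>u. w (u k))) (PiE I A) = (\<Prod>i\<in>I. emeasure ((M(k := density (M k) w)) i) (A i))" .
qed

text \<open>Almost every point lies in exactly those \<open>Ob i\<close> that have measure 1; any
  such point serves as \<open>u\<close>. Points belonging to the same \<open>Ob i\<close> belong to
  the same sets of the generated sigma-algebra, so \<open>P\<close> cannot tell almost all points
  from \<open>u\<close>.\<close>

lemma (in borel_approx) zero_one_imp_return: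
  assumes P: "P \<in> space (prob_algebra (borel_of T))" and zo: "\<And>i. measure P (Ob i) \<in> {0, 1}"
  obtains u where "u \<in> topspace T" "P = return (borel_of T) u"
proof -
  interpret prob_space P using P by (simp add: space_prob_algebra)
  have sets: "sets P = sets (borel_of T)" and sp: "space P = topspace T"
    using P by (auto simp: space_prob_algebra dest: sets_eq_imp_space_eq)
  have Ob: "Ob i \<in> sets P" for i using openin_borel_of[OF Ob_open] by (simp add: sets)
  have "AE x in P. x \<in> Ob i \<longleftrightarrow> prob (Ob i) = 1" for i
  proof (cases "prob (Ob i) = 1")
    case True
    then show ?thesis using prob_eq_1[OF Ob] by simp
  next
    case False
    then have "prob (Ob i) = 0" using zo[of i] by simp
    then show ?thesis using prob_eq_0[OF Ob, of i] by simp
  qed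
  then have ae: "AE x in P. \<forall>i. x \<in> Ob i \<longleftrightarrow> prob (Ob i) = 1" by (subst AE_all_countable) blast
  have "\<exists>u. u \<in> space P \<and> (\<forall>i. u \<in> Ob i \<longleftrightarrow> prob (Ob i) = 1)"
  proof (rule ccontr)
    assume "\<nexists>u. u \<in> space P \<and> (\<forall>i. u \<in> Ob i \<longleftrightarrow> prob (Ob i) = 1)"
    then have "AE x in P. False" using ae AE_space by (elim AE_mp) (intro AE_I2, blast)
    then show False by simp
  qed
  then obtain u where u: "u \<in> topspace T" "\<And>i. u \<in> Ob i \<longleftrightarrow> prob (Ob i) = 1" by (auto simp: sp)
  have same: "x \<in> A \<longleftrightarrow> u \<in> A" if "A \<in> sigma_sets (topspace T) (range Ob)" "x \<in> topspace T" "\<forall>i. x \<in> Ob i \<longleftrightarrow> prob (Ob i) = 1" for A x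
    using that(1) by induction (use that u in auto)
  have "P = return (borel_of T) u"
  proof (rule measure_eqI)
    show "sets P = sets (return (borel_of T) u)" by (simp add: sets)
    fix A assume A: "A \<in> sets P"
    have "AE x in P. x \<in> A \<longleftrightarrow> u \<in> A"
      using ae AE_space by eventually_elim (use same A sp in \<open>auto simp: sets Ob_sets\<close>)
    then show "emeasure P A = emeasure (return (borel_of T) u) A"
      using A prob_eq_1[OF A] prob_eq_0[OF A] by (cases "u \<in> A") (auto simp: emeasure_eq_measure sets)
  qed
  then show ?thesis using that u by blast
qed

section \<open>Strategic measures\<close>

locale team =
  fixes OT :: "'w topology" and YT :: "nat \<Rightarrow> 'y topology" and UT :: "nat \<Rightarrow> 'u topology"
    and n :: nat and \<mu> :: "('w \<times> (nat \<Rightarrow> 'y)) measure"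
  assumes OT: "polish_top OT"
    and YT: "\<And>k. k \<in> {1..n} \<Longrightarrow> polish_top (YT k)"
    and UT: "\<And>k. k \<in> {1..n} \<Longrightarrow> polish_top (UT k)"
    and \<mu>: "\<mu> \<in> space (prob_algebra (borel_of (obs_top OT YT n)))"
begin

abbreviation "I \<equiv> {1..n}"
abbreviation "obs \<equiv> borel_of (obs_top OT YT n)"
abbreviation "full \<equiv> borel_of (full_top OT YT UT n)"
abbreviation "kernels \<kappa> \<equiv> \<forall>k\<in>I. \<kappa> k \<in> borel_of (YT k) \<rightarrow>\<^sub>M prob_algebra (borel_of (UT k))"

lemma metrizable_separable:
  assumes "polish_top T"
  shows "metrizable_space T" "separable_space T" "second_countable T"
  using assms by (auto simp: polish_top_def completely_metrizable_imp_metrizable_space second_countable_metrizable_separable)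

lemma metrizable_full: "metrizable_space (full_top OT YT UT n)"
proof -
  have "\<forall>k\<in>I. metrizable_space (prod_topology (YT k) (UT k))"
    using metrizable_separable(1)[OF YT] metrizable_separable(1)[OF UT]
    by (simp add: metrizable_space_prod_topology)
  then show ?thesis
    unfolding full_top_def using metrizable_separable(1)[OF OT]
    by (simp only: metrizable_space_prod_topology[of OT] metrizable_space_product_topology) auto
qed

lemma second_countable_component:
  "k \<in> I \<Longrightarrow> second_countable (YT k)" "k \<in> I \<Longrightarrow> second_countable (UT k)" "second_countable OT"
  using metrizable_separable(3) OT YT UT by blast+

lemma second_countable_components:
  "k \<in> I \<Longrightarrow> second_countable (prod_topology (YT k) (UT k))"
  "second_countable (product_topology (\<lambda>k. prod_topology (YT k) (UT k)) I)"
  by (intro second_countable_prod_topology second_countable_product_topology_finite second_countable_component finite_atLeastAtMost; assumption)+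

lemma second_countable_full: "second_countable (full_top OT YT UT n)"
  unfolding full_top_def
  by (intro second_countable_prod_topology second_countable_component(3) second_countable_components(2))

lemma separable_full: "separable_space (full_top OT YT UT n)"
  by (rule second_countable_imp_separable_space[OF second_countable_full])

lemma sets_\<mu>[measurable_cong]: "sets \<mu> = sets obs"
  using \<mu> by (simp add: space_prob_algebra)

lemma space_\<mu>: "space \<mu> = topspace (obs_top OT YT n)"
  using sets_eq_imp_space_eq[OF sets_\<mu>] by simp

lemma prob_\<mu>: "prob_space \<mu>"
  using \<mu> by (simp add: space_prob_algebra)

lemma measurable_obs_fst: "fst \<in> obs \<rightarrow>\<^sub>M borel_of OT"
  unfolding obs_top_def by (intro measurable_continuous_map continuous_map_fst)

lemma measurable_obs_component: "k \<in> I \<Longrightarrow> (\<lambda>p. snd p k) \<in> obs \<rightarrow>\<^sub>M borel_of (YT k)"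
  unfolding obs_top_def
  using continuous_map_compose[OF continuous_map_snd continuous_map_product_projection, of k I OT YT]
  by (intro measurable_continuous_map) (simp add: o_def)

lemma measurable_full_component:
  assumes "k \<in> I"
  shows "(\<lambda>x. fst (snd x k)) \<in> full \<rightarrow>\<^sub>M borel_of (YT k)" "(\<lambda>x. snd (snd x k)) \<in> full \<rightarrow>\<^sub>M borel_of (UT k)"
proof -
  have "continuous_map (full_top OT YT UT n) (prod_topology (YT k) (UT k)) (\<lambda>x. snd x k)"
    unfolding full_top_def
    using continuous_map_compose[OF continuous_map_snd continuous_map_product_projection[OF assms], of OT "\<lambda>k. prod_topology (YT k) (UT k)"]
    by (simp add: o_def)
  from continuous_map_compose[OF this continuous_map_fst] continuous_map_compose[OF this continuous_map_snd]
  show "(\<lambda>x. fst (snd x k)) \<in> full \<rightarrow>\<^sub>M borel_of (YT k)" "(\<lambda>x. snd (snd x k)) \<in> full \<rightarrow>\<^sub>M borel_of (UT k)"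
    by (auto intro!: measurable_continuous_map simp: o_def)
qed

lemma measurable_full_tuple:
  assumes a: "a \<in> M \<rightarrow>\<^sub>M borel_of OT" and b: "\<And>k. k \<in> I \<Longrightarrow> b k \<in> M \<rightarrow>\<^sub>M borel_of (YT k)"
    and c: "\<And>k. k \<in> I \<Longrightarrow> c k \<in> M \<rightarrow>\<^sub>M borel_of (UT k)"
  shows "(\<lambda>x. (a x, restrict (\<lambda>k. (b k x, c k x)) I)) \<in> M \<rightarrow>\<^sub>M full"
proof -
  have "(\<lambda>x. (b k x, c k x)) \<in> M \<rightarrow>\<^sub>M borel_of (prod_topology (YT k) (UT k))" if "k \<in> I" for k
    using measurable_compose[OF measurable_Pair[OF b[OF that] c[OF that]]
        measurable_id_prod_topology[OF second_countable_component(1,2)[OF that]]] .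
  then have "(\<lambda>x. restrict (\<lambda>k. (b k x, c k x)) I) \<in> M \<rightarrow>\<^sub>M PiM I (\<lambda>k. borel_of (prod_topology (YT k) (UT k)))"
    by (intro measurable_restrict)
  then have "(\<lambda>x. restrict (\<lambda>k. (b k x, c k x)) I) \<in> M \<rightarrow>\<^sub>M borel_of (product_topology (\<lambda>k. prod_topology (YT k) (UT k)) I)"
    by (rule measurable_compose[OF _ measurable_id_product_topology[OF finite_atLeastAtMost second_countable_components(1)]])
  from measurable_compose[OF measurable_Pair[OF a this]
      measurable_id_prod_topology[OF second_countable_component(3) second_countable_components(2)]]
  show ?thesis unfolding full_top_def .
qed

section \<open>The law of the full history as a kernel over the observations\<close>

definition attach :: "'w \<times> (nat \<Rightarrow> 'y) \<Rightarrow> (nat \<Rightarrow> 'u) \<Rightarrow> 'w \<times> (nat \<Rightarrow> 'y \<times> 'u)" where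
  "attach p u = (fst p, restrict (\<lambda>k. (snd p k, u k)) I)"

lemma measurable_attach2: "(\<lambda>(p, u). attach p u) \<in> obs \<Otimes>\<^sub>M PiM I (\<lambda>k. borel_of (UT k)) \<rightarrow>\<^sub>M full"
  unfolding attach_def case_prod_beta
proof (rule measurable_full_tuple)
  fix k assume k: "k \<in> I"
  show "(\<lambda>q. snd (fst q) k) \<in> obs \<Otimes>\<^sub>M PiM I (\<lambda>k. borel_of (UT k)) \<rightarrow>\<^sub>M borel_of (YT k)"
    using measurable_compose[OF measurable_fst measurable_obs_component[OF k]] by simp
  show "(\<lambda>q. snd q k) \<in> obs \<Otimes>\<^sub>M PiM I (\<lambda>k. borel_of (UT k)) \<rightarrow>\<^sub>M borel_of (UT k)"
    using measurable_compose[OF measurable_snd measurable_component_singleton[OF k]] by simp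
qed (use measurable_compose[OF measurable_fst measurable_obs_fst] in simp)

lemma measurable_attach:
  assumes "p \<in> topspace (obs_top OT YT n)"
  shows "attach p \<in> PiM I (\<lambda>k. borel_of (UT k)) \<rightarrow>\<^sub>M full"
  using measurable_compose[OF measurable_Pair1'[of p obs] measurable_attach2] assms by simp

text \<open>Given \<open>p\<close>, the actions are independent with laws
  \<open>\<kappa> k (snd p k)\<close>; the kernel is their joint law recorded together with
  \<open>p\<close>. The members of \<open>L_R\<close> become
  \<open>\<mu> \<bind> team_kernel \<kappa>\<close>, to which the rules for \<open>bind\<close>
  apply.\<close>

definition team_kernel :: "(nat \<Rightarrow> 'y \<Rightarrow> 'u measure) \<Rightarrow> 'w \<times> (nat \<Rightarrow> 'y) \<Rightarrow> ('w \<times> (nat \<Rightarrow> 'y \<times> 'u)) measure" where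
  "team_kernel \<kappa> p = distr (PiM I (\<lambda>k. \<kappa> k (snd p k))) full (attach p)"

lemma kernels_component:
  assumes "kernels \<kappa>" "k \<in> I"
  shows "(\<lambda>p. \<kappa> k (snd p k)) \<in> obs \<rightarrow>\<^sub>M prob_algebra (borel_of (UT k))"
  using measurable_compose[OF measurable_obs_component[OF assms(2)]] assms by blast

lemma kernels_prob:
  assumes "kernels \<kappa>" "k \<in> I" "p \<in> topspace (obs_top OT YT n)"
  shows "prob_space (\<kappa> k (snd p k))" "sets (\<kappa> k (snd p k)) = sets (borel_of (UT k))" "space (\<kappa> k (snd p k)) = topspace (UT k)"
  using measurable_space[OF kernels_component[OF assms(1,2)], of p] assms(3)
  by (auto simp: space_prob_algebra dest: sets_eq_imp_space_eq)

lemma sets_PiM_kernels: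
  assumes "kernels \<kappa>" "p \<in> topspace (obs_top OT YT n)"
  shows "sets (PiM I (\<lambda>k. \<kappa> k (snd p k))) = sets (PiM I (\<lambda>k. borel_of (UT k)))"
  using kernels_prob(2)[OF assms(1) _ assms(2)] by (intro sets_PiM_cong) auto

lemma measurable_attach_kernels:
  assumes "kernels \<kappa>" "p \<in> topspace (obs_top OT YT n)"
  shows "attach p \<in> PiM I (\<lambda>k. \<kappa> k (snd p k)) \<rightarrow>\<^sub>M full"
  using measurable_attach[OF assms(2)] measurable_cong_sets[OF sets_PiM_kernels[OF assms] refl, of full] by blast

lemma measurable_team_kernel:
  assumes "kernels \<kappa>"
  shows "team_kernel \<kappa> \<in> obs \<rightarrow>\<^sub>M prob_algebra full"
  unfolding team_kernel_def
  by (rule measurable_distr_prob_space2[OF measurable_PiM_kernel measurable_attach2])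
     (use kernels_component[OF assms] in auto)

lemma emeasure_bind_team_kernel:
  assumes "kernels \<kappa>" "B \<in> sets full"
  shows "emeasure (\<mu> \<bind> team_kernel \<kappa>) B = (\<integral>\<^sup>+ p. emeasure (team_kernel \<kappa> p) B \<partial>\<mu>)"
  by (rule emeasure_bind_prob_algebra[OF \<mu> measurable_team_kernel[OF assms(1)] assms(2)])

lemma bind_team_kernel_prob: "kernels \<kappa> \<Longrightarrow> \<mu> \<bind> team_kernel \<kappa> \<in> space (prob_algebra full)"
  using prob_space_bind'[OF \<mu> measurable_team_kernel] sets_bind'[OF \<mu> measurable_team_kernel]
  by (simp add: space_prob_algebra)

lemma L_R_iff: "P \<in> L_R OT YT UT n \<mu> \<longleftrightarrow> (\<exists>\<kappa>. kernels \<kappa> \<and> P = \<mu> \<bind> team_kernel \<kappa>)"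
proof -
  have eq: "(\<integral>\<^sup>+ (\<omega>, y). emeasure (PiM I (\<lambda>k. \<kappa> k (y k)))
      {u \<in> space (PiM I (\<lambda>k. \<kappa> k (y k))). (\<omega>, restrict (\<lambda>k. (y k, u k)) I) \<in> B} \<partial>\<mu>) = emeasure (\<mu> \<bind> team_kernel \<kappa>) B"
    if "kernels \<kappa>" "B \<in> sets full" for \<kappa> B
    unfolding emeasure_bind_team_kernel[OF that]
  proof (intro nn_integral_cong)
    fix p assume "p \<in> space \<mu>"
    then have "p \<in> topspace (obs_top OT YT n)" by (simp add: space_\<mu>)
    then show "(case p of (\<omega>, y) \<Rightarrow> emeasure (PiM I (\<lambda>k. \<kappa> k (y k)))
      {u \<in> space (PiM I (\<lambda>k. \<kappa> k (y k))). (\<omega>, restrict (\<lambda>k. (y k, u k)) I) \<in> B}) = emeasure (team_kernel \<kappa> p) B"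
      unfolding team_kernel_def using that
      by (subst emeasure_distr[OF measurable_attach_kernels])
         (auto simp: case_prod_beta attach_def vimage_def Int_def conj_commute)
  qed
  show ?thesis
  proof
    assume "P \<in> L_R OT YT UT n \<mu>"
    then obtain \<kappa> where P: "P \<in> space (prob_algebra full)" and \<kappa>: "kernels \<kappa>"
      and P_eq: "\<forall>B\<in>sets full. emeasure P B = (\<integral>\<^sup>+ (\<omega>, y). emeasure (PiM I (\<lambda>k. \<kappa> k (y k)))
        {u \<in> space (PiM I (\<lambda>k. \<kappa> k (y k))). (\<omega>, restrict (\<lambda>k. (y k, u k)) I) \<in> B} \<partial>\<mu>)"
      unfolding L_R_def mem_Collect_eq by (elim conjE exE)
    have B: "emeasure P B = emeasure (\<mu> \<bind> team_kernel \<kappa>) B" if "B \<in> sets full" for B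
      using P_eq that eq[OF \<kappa> that] by simp
    have "P = \<mu> \<bind> team_kernel \<kappa>"
      using P bind_team_kernel_prob[OF \<kappa>] by (intro measure_eqI B) (auto simp: space_prob_algebra)
    then show "\<exists>\<kappa>. kernels \<kappa> \<and> P = \<mu> \<bind> team_kernel \<kappa>" using \<kappa> by blast
  next
    assume "\<exists>\<kappa>. kernels \<kappa> \<and> P = \<mu> \<bind> team_kernel \<kappa>"
    then show "P \<in> L_R OT YT UT n \<mu>"
      unfolding L_R_def mem_Collect_eq
    proof (elim exE conjE, intro conjI exI ballI)
      fix \<kappa> assume \<kappa>: "kernels \<kappa>" "P = \<mu> \<bind> team_kernel \<kappa>"
      show "P \<in> space (prob_algebra full)" using bind_team_kernel_prob[OF \<kappa>(1)] \<kappa>(2) by simp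
      show "\<kappa> k \<in> borel_of (YT k) \<rightarrow>\<^sub>M prob_algebra (borel_of (UT k))" if "k \<in> I" for k using \<kappa>(1) that by blast
      show "emeasure P B = (\<integral>\<^sup>+ (\<omega>, y). emeasure (PiM I (\<lambda>k. \<kappa> k (y k)))
        {u \<in> space (PiM I (\<lambda>k. \<kappa> k (y k))). (\<omega>, restrict (\<lambda>k. (y k, u k)) I) \<in> B} \<partial>\<mu>)" if "B \<in> sets full" for B
        using eq[OF \<kappa>(1) that] \<kappa>(2) by simp
    qed
  qed
qed

definition "L_A = {strat_meas OT YT UT n \<mu> \<gamma> | \<gamma>. team_policy YT UT n \<gamma>}"

text \<open>A product of point masses is the point mass at the tuple of actions. Agreement almost
  surely suffices because the kernels enter only under the integral over
  \<open>\<mu>\<close>.\<close>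

lemma bind_team_kernel_eq_strat_meas:
  assumes \<kappa>: "kernels \<kappa>" and \<gamma>: "team_policy YT UT n \<gamma>"
    and ae: "AE p in \<mu>. \<forall>k\<in>I. \<kappa> k (snd p k) = return (borel_of (UT k)) (\<gamma> k (snd p k))"
  shows "\<mu> \<bind> team_kernel \<kappa> = strat_meas OT YT UT n \<mu> \<gamma>"
proof -
  let ?f = "\<lambda>p. attach p (\<lambda>k. \<gamma> k (snd p k))"
  have \<gamma>k: "(\<lambda>p. \<gamma> k (snd p k)) \<in> obs \<rightarrow>\<^sub>M borel_of (UT k)" if "k \<in> I" for k
    using measurable_compose[OF measurable_obs_component[OF that], of "\<gamma> k"] \<gamma> that unfolding team_policy_def by blast
  have f: "?f \<in> obs \<rightarrow>\<^sub>M full"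
    unfolding attach_def by (intro measurable_full_tuple measurable_obs_fst measurable_obs_component \<gamma>k)
  then have f\<mu>: "?f \<in> \<mu> \<rightarrow>\<^sub>M full" by (simp cong: measurable_cong_sets add: sets_\<mu>)
  have strat: "strat_meas OT YT UT n \<mu> \<gamma> = distr \<mu> full ?f"
    unfolding strat_meas_def by (intro distr_cong) (auto simp: attach_def)
  show ?thesis
    unfolding strat
  proof (rule measure_eqI)
    show "sets (\<mu> \<bind> team_kernel \<kappa>) = sets (distr \<mu> full ?f)"
      using bind_team_kernel_prob[OF \<kappa>] by (simp add: space_prob_algebra)
    fix B assume "B \<in> sets (\<mu> \<bind> team_kernel \<kappa>)"
    then have B: "B \<in> sets full" using bind_team_kernel_prob[OF \<kappa>] by (simp add: space_prob_algebra)
    have "emeasure (\<mu> \<bind> team_kernel \<kappa>) B = (\<integral>\<^sup>+ p. indicator B (?f p) \<partial>\<mu>)"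
      unfolding emeasure_bind_team_kernel[OF \<kappa> B]
    proof (rule nn_integral_cong_AE)
      show "AE p in \<mu>. emeasure (team_kernel \<kappa> p) B = indicator B (?f p)"
        using ae AE_space
      proof eventually_elim
        case (elim p)
        then have p: "p \<in> topspace (obs_top OT YT n)" by (simp add: space_\<mu>)
        have u: "\<gamma> k (snd p k) \<in> space (borel_of (UT k))" if "k \<in> I" for k
          using measurable_space[OF \<gamma>k[OF that], of p] p by simp
        have "PiM I (\<lambda>k. \<kappa> k (snd p k)) = PiM I (\<lambda>k. return (borel_of (UT k)) (\<gamma> k (snd p k)))"
          using elim by (intro PiM_cong) auto
        also have "\<dots> = return (PiM I (\<lambda>k. borel_of (UT k))) (restrict (\<lambda>k. \<gamma> k (snd p k)) I)"
          using u by (intro PiM_return) auto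
        finally have "team_kernel \<kappa> p = distr (return (PiM I (\<lambda>k. borel_of (UT k))) (restrict (\<lambda>k. \<gamma> k (snd p k)) I)) full (attach p)"
          by (simp add: team_kernel_def)
        also have "\<dots> = return full (attach p (restrict (\<lambda>k. \<gamma> k (snd p k)) I))"
          using u by (intro distr_return measurable_attach p) (auto simp: space_PiM)
        also have "attach p (restrict (\<lambda>k. \<gamma> k (snd p k)) I) = ?f p"
          by (auto simp: attach_def restrict_def)
        finally show ?case using B by simp
      qed
    qed
    also have "\<dots> = emeasure (distr \<mu> full ?f) B"
      using nn_integral_distr[OF f\<mu>, of "indicator B"] B by simp
    finally show "emeasure (\<mu> \<bind> team_kernel \<kappa>) B = emeasure (distr \<mu> full ?f) B" .
  qed
qed

lemma L_A_subset_L_R: "L_A \<subseteq> L_R OT YT UT n \<mu>"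
proof
  fix P assume "P \<in> L_A"
  then obtain \<gamma> where \<gamma>: "team_policy YT UT n \<gamma>" "P = strat_meas OT YT UT n \<mu> \<gamma>"
    unfolding L_A_def by blast
  let ?\<kappa> = "\<lambda>k y. return (borel_of (UT k)) (\<gamma> k y)"
  have "kernels ?\<kappa>"
    using \<gamma>(1) by (auto simp: team_policy_def intro!: measurable_compose[OF _ measurable_return_prob_space])
  then show "P \<in> L_R OT YT UT n \<mu>"
    unfolding L_R_iff using bind_team_kernel_eq_strat_meas[OF _ \<gamma>(1), of ?\<kappa>] \<gamma>(2) by auto
qed

end

section \<open>Independently randomized policies that are not midpoints\<close>

context team
begin

text \<open>The density \<open>1 \<plusminus> h\<close> with \<open>h = \<kappa>(-B) 1\<^sub>B - \<kappa>(B) 1\<^bsub>-B\<^esub>\<close>: \<open>h\<close> has conditional mean zero, so both tilted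
  kernels are stochastic and average to the original one; they differ unless \<open>\<kappa>(B)\<close> is 0 or 1.\<close>

definition tilt :: "(nat \<Rightarrow> 'y \<Rightarrow> 'u measure) \<Rightarrow> nat \<Rightarrow> 'u set \<Rightarrow> real \<Rightarrow> 'y \<Rightarrow> 'u \<Rightarrow> real" where
  "tilt \<kappa> k B s y u = 1 + s * ((1 - measure (\<kappa> k y) B) * indicator B u - measure (\<kappa> k y) B * (1 - indicator B u))"

definition tilted :: "(nat \<Rightarrow> 'y \<Rightarrow> 'u measure) \<Rightarrow> nat \<Rightarrow> 'u set \<Rightarrow> real \<Rightarrow> nat \<Rightarrow> 'y \<Rightarrow> 'u measure" where
  "tilted \<kappa> k B s = \<kappa>(k := \<lambda>y. density (\<kappa> k y) (\<lambda>u. ennreal (tilt \<kappa> k B s y u)))"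

lemma obs_component:
  assumes "k \<in> I" "p \<in> topspace (obs_top OT YT n)"
  shows "snd p k \<in> topspace (YT k)"
  using measurable_space[OF measurable_obs_component[OF assms(1)], of p] assms(2) by simp

context
  fixes \<kappa> :: "nat \<Rightarrow> 'y \<Rightarrow> 'u measure" and k :: nat
  assumes \<kappa>: "kernels \<kappa>" and k: "k \<in> I"
begin

lemma \<kappa>k: "\<kappa> k \<in> borel_of (YT k) \<rightarrow>\<^sub>M prob_algebra (borel_of (UT k))"
  using \<kappa> k by blast

lemma \<kappa>k_prob:
  assumes "y \<in> topspace (YT k)"
  shows "prob_space (\<kappa> k y)" "sets (\<kappa> k y) = sets (borel_of (UT k))" "space (\<kappa> k y) = topspace (UT k)"
  using measurable_space[OF \<kappa>k, of y] assms by (auto simp: space_prob_algebra dest: sets_eq_imp_space_eq)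

context
  fixes B :: "'u set"
  assumes B: "B \<in> sets (borel_of (UT k))"
begin

lemma measure_\<kappa>k_bounds: "y \<in> topspace (YT k) \<Longrightarrow> 0 \<le> measure (\<kappa> k y) B \<and> measure (\<kappa> k y) B \<le> 1"
  using prob_space.prob_le_1[OF \<kappa>k_prob(1)] by simp

lemma measurable_measure_\<kappa>k: "(\<lambda>y. measure (\<kappa> k y) B) \<in> borel_measurable (borel_of (YT k))"
  by (rule measurable_compose[OF \<kappa>k measurable_measure_prob_algebra[OF B]])

context
  fixes s :: real
  assumes s: "\<bar>s\<bar> \<le> 1"
begin

lemma tilt_bounds:
  assumes "y \<in> topspace (YT k)"
  shows "0 \<le> tilt \<kappa> k B s y u" "tilt \<kappa> k B s y u \<le> 2"
proof -
  define b where "b = measure (\<kappa> k y) B"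
  have b: "0 \<le> b" "b \<le> 1" using measure_\<kappa>k_bounds[OF assms] by (auto simp: b_def)
  have "\<bar>s * c\<bar> \<le> 1" if "\<bar>c\<bar> \<le> 1" for c
    unfolding abs_mult using s that by (intro mult_le_one) auto
  then have "\<bar>s * (1 - b)\<bar> \<le> 1" "\<bar>s * (- b)\<bar> \<le> 1" using b by (auto simp del: mult_minus_right)
  then have "0 \<le> 1 + s * (1 - b)" "1 + s * (1 - b) \<le> 2" "0 \<le> 1 + s * (- b)" "1 + s * (- b) \<le> 2" by linarith+
  then show "0 \<le> tilt \<kappa> k B s y u" "tilt \<kappa> k B s y u \<le> 2"
    unfolding tilt_def b_def[symmetric] by (cases "u \<in> B"; simp)+
qed

lemma measurable_tilt: "(\<lambda>(y, u). tilt \<kappa> k B s y u) \<in> borel_measurable (borel_of (YT k) \<Otimes>\<^sub>M borel_of (UT k))"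
  unfolding tilt_def case_prod_beta
proof -
  have [measurable]: "(\<lambda>q. measure (\<kappa> k (fst q)) B) \<in> borel_measurable (borel_of (YT k) \<Otimes>\<^sub>M borel_of (UT k))"
    by (rule measurable_compose[OF measurable_fst measurable_measure_\<kappa>k])
  note B[measurable]
  show "(\<lambda>q. 1 + s * ((1 - measure (\<kappa> k (fst q)) B) * indicator B (snd q) -
      measure (\<kappa> k (fst q)) B * (1 - indicator B (snd q)))) \<in> borel_measurable (borel_of (YT k) \<Otimes>\<^sub>M borel_of (UT k))"
    by measurable
qed

lemma measurable_tilt1: 
  assumes "y \<in> topspace (YT k)"
  shows "tilt \<kappa> k B s y \<in> borel_measurable (\<kappa> k y)"
proof -
  have "tilt \<kappa> k B s y \<in> borel_measurable (borel_of (UT k))"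
    unfolding tilt_def using B by measurable
  then show ?thesis using measurable_cong_sets[OF \<kappa>k_prob(2)[OF assms] refl, of borel] by blast
qed

text \<open>On \<open>B\<close> the density is the constant \<open>1 + s * (1 - b)\<close> with
  \<open>b\<close> the mass of \<open>B\<close>, so \<open>B\<close> receives
  \<open>b + s * (b * (1 - b))\<close>: the sign of \<open>s\<close> shows precisely where
  \<open>0 < b < 1\<close>.\<close>

lemma tilt_integral:
  assumes y: "y \<in> topspace (YT k)"
  shows "(\<integral>\<^sup>+ u. ennreal (tilt \<kappa> k B s y u) \<partial>\<kappa> k y) = 1"
    and "(\<integral>\<^sup>+ u. ennreal (tilt \<kappa> k B s y u) * indicator B u \<partial>\<kappa> k y)
      = ennreal (measure (\<kappa> k y) B + s * (measure (\<kappa> k y) B * (1 - measure (\<kappa> k y) B)))"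
proof -
  interpret prob_space "\<kappa> k y" by (rule \<kappa>k_prob[OF y])
  note [measurable] = measurable_tilt1[OF y]
  define b where "b = prob B"
  have b: "0 \<le> b" "b \<le> 1" by (auto simp: b_def)
  have Bs[measurable]: "B \<in> sets (\<kappa> k y)" using B \<kappa>k_prob[OF y] by simp
  have int: "integrable (\<kappa> k y) (indicator B :: _ \<Rightarrow> real)" by (simp add: emeasure_eq_measure)
  have "(\<integral>u. tilt \<kappa> k B s y u \<partial>\<kappa> k y) = 1 + s * ((1 - b) * b - b * (1 - b))"
    unfolding tilt_def b_def using int by (simp add: prob_space algebra_simps)
  then have "(\<integral>u. tilt \<kappa> k B s y u \<partial>\<kappa> k y) = 1" by (simp add: algebra_simps)
  moreover have "integrable (\<kappa> k y) (tilt \<kappa> k B s y)"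
    by (rule integrable_const_bound[where B = 2]) (use tilt_bounds[OF y] in auto)
  ultimately show "(\<integral>\<^sup>+ u. ennreal (tilt \<kappa> k B s y u) \<partial>\<kappa> k y) = 1"
    using tilt_bounds[OF y] by (subst nn_integral_eq_integral) auto
  have "(\<integral>\<^sup>+ u. ennreal (tilt \<kappa> k B s y u) * indicator B u \<partial>\<kappa> k y)
    = (\<integral>\<^sup>+ u. ennreal (1 + s * (1 - b)) * indicator B u \<partial>\<kappa> k y)"
    by (intro nn_integral_cong) (auto simp: tilt_def b_def indicator_def)
  also have "\<dots> = ennreal (1 + s * (1 - b)) * ennreal b"
    by (simp add: nn_integral_cmult_indicator emeasure_eq_measure b_def)
  also have "\<dots> = ennreal ((1 + s * (1 - b)) * b)"
    using b by (subst ennreal_mult'') auto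
  also have "(1 + s * (1 - b)) * b = b + s * (b * (1 - b))" by (simp add: algebra_simps)
  finally show "(\<integral>\<^sup>+ u. ennreal (tilt \<kappa> k B s y u) * indicator B u \<partial>\<kappa> k y)
      = ennreal (prob B + s * (prob B * (1 - prob B)))" unfolding b_def .
qed

lemma tilted_prob:
  assumes y: "y \<in> topspace (YT k)"
  shows "prob_space (tilted \<kappa> k B s k y)" "sets (tilted \<kappa> k B s k y) = sets (borel_of (UT k))"
proof -
  note [measurable] = measurable_tilt1[OF y]
  show "sets (tilted \<kappa> k B s k y) = sets (borel_of (UT k))" using \<kappa>k_prob[OF y] by (simp add: tilted_def)
  have "emeasure (density (\<kappa> k y) (\<lambda>u. ennreal (tilt \<kappa> k B s y u))) (space (\<kappa> k y)) = (\<integral>\<^sup>+ u. ennreal (tilt \<kappa> k B s y u) \<partial>\<kappa> k y)"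
    by (subst emeasure_density) (auto intro!: nn_integral_cong)
  then show "prob_space (tilted \<kappa> k B s k y)"
    by (intro prob_spaceI) (simp add: tilted_def tilt_integral(1)[OF y])
qed

lemma kernels_tilted: "kernels (tilted \<kappa> k B s)"
proof
  fix j assume j: "j \<in> I"
  show "tilted \<kappa> k B s j \<in> borel_of (YT j) \<rightarrow>\<^sub>M prob_algebra (borel_of (UT j))"
  proof (cases "j = k")
    case False
    then show ?thesis using \<kappa> j by (simp add: tilted_def)
  next
    case True
    have "tilted \<kappa> k B s k \<in> borel_of (YT k) \<rightarrow>\<^sub>M prob_algebra (borel_of (UT k))"
    proof (rule measurable_prob_algebra_generated[where \<Omega> = "topspace (UT k)" and G = "sets (borel_of (UT k))"])
      show "sets (borel_of (UT k)) = sigma_sets (topspace (UT k)) (sets (borel_of (UT k)))"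
        using sets.sigma_sets_eq[of "borel_of (UT k)"] by simp
      show "Int_stable (sets (borel_of (UT k)))" by (auto simp: Int_stable_def)
      show "sets (borel_of (UT k)) \<subseteq> Pow (topspace (UT k))" using sets.space_closed[of "borel_of (UT k)"] by simp
      fix A assume A[measurable]: "A \<in> sets (borel_of (UT k))"
      have "(\<lambda>(y, u). ennreal (tilt \<kappa> k B s y u) * indicator A u) \<in> borel_measurable (borel_of (YT k) \<Otimes>\<^sub>M borel_of (UT k))"
        using measurable_tilt by measurable
      then have "(\<lambda>y. \<integral>\<^sup>+ u. ennreal (tilt \<kappa> k B s y u) * indicator A u \<partial>\<kappa> k y) \<in> borel_measurable (borel_of (YT k))"
        by (rule nn_integral_measurable_subprob_algebra2[OF _ measurable_prob_algebraD[OF \<kappa>k]])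
      also have "?this \<longleftrightarrow> (\<lambda>y. emeasure (tilted \<kappa> k B s k y) A) \<in> borel_measurable (borel_of (YT k))"
        using A measurable_tilt1 \<kappa>k_prob(2) by (intro measurable_cong) (simp add: tilted_def emeasure_density)
      finally show "(\<lambda>y. emeasure (tilted \<kappa> k B s k y) A) \<in> borel_measurable (borel_of (YT k))" .
    qed (use tilted_prob in auto)
    then show ?thesis using True by simp
  qed
qed

abbreviation "dens x \<equiv> ennreal (tilt \<kappa> k B s (fst (snd x k)) (snd (snd x k)))"

lemma measurable_dens: "(\<lambda>x. tilt \<kappa> k B s (fst (snd x k)) (snd (snd x k))) \<in> borel_measurable full"
  using measurable_compose[OF measurable_Pair[OF measurable_full_component[OF k]] measurable_tilt] by (simp add: case_prod_beta)

text \<open>The density involves only the observation and the action of agent \<open>k\<close>,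
  which can be read off the full history. It therefore passes through \<open>attach\<close> from the
  law of the actions to that of the history.\<close>

lemma team_kernel_tilted:
  assumes p: "p \<in> topspace (obs_top OT YT n)"
  shows "team_kernel (tilted \<kappa> k B s) p = density (team_kernel \<kappa> p) dens"
proof -
  let ?M = "\<lambda>j. \<kappa> j (snd p j)"
  let ?w = "\<lambda>u. ennreal (tilt \<kappa> k B s (snd p k) u)"
  note y = obs_component[OF k p]
  have "PiM I (\<lambda>j. tilted \<kappa> k B s j (snd p j)) = PiM I (?M(k := density (?M k) ?w))"
    by (rule PiM_cong) (auto simp: tilted_def)
  also have "\<dots> = density (PiM I ?M) (\<lambda>u. ?w (u k))"
    using tilted_prob(1)[OF y] measurable_tilt1[OF y] kernels_prob(1)[OF \<kappa> _ p] k
    by (intro PiM_density_component) (auto simp: tilted_def)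
  also have "\<dots> = density (PiM I ?M) (\<lambda>u. dens (attach p u))"
    using k by (simp add: attach_def)
  finally have "team_kernel (tilted \<kappa> k B s) p = distr (density (PiM I ?M) (\<lambda>u. dens (attach p u))) full (attach p)"
    by (simp add: team_kernel_def)
  also have "\<dots> = density (distr (PiM I ?M) full (attach p)) dens"
    using measurable_dens measurable_attach_kernels[OF \<kappa> p] by (intro density_distr[symmetric]) auto
  finally show ?thesis by (simp add: team_kernel_def)
qed

text \<open>One function \<open>dens\<close> serves for all \<open>p\<close>, so it comes out of the
  mixture over \<open>\<mu>\<close>. Averaging tilted measures is thus averaging densities against a
  common measure.\<close>

lemma bind_team_kernel_tilted: "\<mu> \<bind> team_kernel (tilted \<kappa> k B s) = density (\<mu> \<bind> team_kernel \<kappa>) dens"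
proof (rule measure_eqI)
  show "sets (\<mu> \<bind> team_kernel (tilted \<kappa> k B s)) = sets (density (\<mu> \<bind> team_kernel \<kappa>) dens)"
    using bind_team_kernel_prob[OF \<kappa>] bind_team_kernel_prob[OF kernels_tilted] by (simp add: space_prob_algebra)
  fix A assume "A \<in> sets (\<mu> \<bind> team_kernel (tilted \<kappa> k B s))"
  then have A: "A \<in> sets full" using bind_team_kernel_prob[OF kernels_tilted] by (simp add: space_prob_algebra)
  have Q: "sets (\<mu> \<bind> team_kernel \<kappa>) = sets full" using bind_team_kernel_prob[OF \<kappa>] by (simp add: space_prob_algebra)
  have dm: "dens \<in> borel_measurable full" using measurable_dens by measurable
  have tk: "team_kernel \<kappa> \<in> \<mu> \<rightarrow>\<^sub>M subprob_algebra full"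
    using measurable_prob_algebraD[OF measurable_team_kernel[OF \<kappa>]] measurable_cong_sets[OF sets_\<mu> refl] by blast
  have "emeasure (\<mu> \<bind> team_kernel (tilted \<kappa> k B s)) A = (\<integral>\<^sup>+ p. emeasure (density (team_kernel \<kappa> p) dens) A \<partial>\<mu>)"
    unfolding emeasure_bind_team_kernel[OF kernels_tilted A]
    by (intro nn_integral_cong) (simp add: team_kernel_tilted space_\<mu>)
  also have "\<dots> = (\<integral>\<^sup>+ p. \<integral>\<^sup>+ x. dens x * indicator A x \<partial>team_kernel \<kappa> p \<partial>\<mu>)"
    using A dm by (intro nn_integral_cong emeasure_density) (simp_all add: team_kernel_def)
  also have "\<dots> = (\<integral>\<^sup>+ x. dens x * indicator A x \<partial>(\<mu> \<bind> team_kernel \<kappa>))"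
    using A dm by (intro nn_integral_bind[OF _ tk, symmetric]) auto
  also have "\<dots> = emeasure (density (\<mu> \<bind> team_kernel \<kappa>) dens) A"
    using A dm Q by (intro emeasure_density[symmetric]) (auto cong: measurable_cong_sets)
  finally show "emeasure (\<mu> \<bind> team_kernel (tilted \<kappa> k B s)) A = emeasure (density (\<mu> \<bind> team_kernel \<kappa>) dens) A" .
qed

lemma integral_tilted:
  assumes "g \<in> borel_measurable full"
  shows "(\<integral>x. g x \<partial>(\<mu> \<bind> team_kernel (tilted \<kappa> k B s))) =
    (\<integral>x. tilt \<kappa> k B s (fst (snd x k)) (snd (snd x k)) * g x \<partial>(\<mu> \<bind> team_kernel \<kappa>) :: real)"
proof -
  have Q: "sets (\<mu> \<bind> team_kernel \<kappa>) = sets full" "space (\<mu> \<bind> team_kernel \<kappa>) = topspace (full_top OT YT UT n)"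
    using bind_team_kernel_prob[OF \<kappa>] by (auto simp: space_prob_algebra dest: sets_eq_imp_space_eq)
  have "0 \<le> tilt \<kappa> k B s (fst (snd x k)) (snd (snd x k))" if "x \<in> topspace (full_top OT YT UT n)" for x
    using measurable_space[OF measurable_full_component(1)[OF k], of x] that by (intro tilt_bounds) simp
  then show ?thesis
    unfolding bind_team_kernel_tilted using assms measurable_dens Q
    by (subst integral_density) (auto cong: measurable_cong_sets intro!: AE_I2)
qed

text \<open>The event that the action of agent \<open>k\<close> lies in \<open>B\<close> is the
  statistic by which opposite tilts are told apart.\<close>

lemma emeasure_tilted:
  "emeasure (\<mu> \<bind> team_kernel (tilted \<kappa> k B s)) {x \<in> topspace (full_top OT YT UT n). snd (snd x k) \<in> B} =
    (\<integral>\<^sup>+ p. ennreal (measure (\<kappa> k (snd p k)) B + s * (measure (\<kappa> k (snd p k)) B * (1 - measure (\<kappa> k (snd p k)) B))) \<partial>\<mu>)"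
    (is "emeasure _ ?A = _")
proof -
  have A: "?A \<in> sets full"
    using measurable_sets[OF measurable_full_component(2)[OF k] B] by (simp add: vimage_def Int_def conj_commute)
  show ?thesis
    unfolding emeasure_bind_team_kernel[OF kernels_tilted A]
  proof (intro nn_integral_cong)
    fix p assume "p \<in> space \<mu>"
    then have p: "p \<in> topspace (obs_top OT YT n)" by (simp add: space_\<mu>)
    note y = obs_component[OF k p]
    let ?M = "\<lambda>j. tilted \<kappa> k B s j (snd p j)"
    have M: "prob_space (?M j)" "space (?M j) = topspace (UT j)" if "j \<in> I" for j
      using kernels_prob[OF kernels_tilted that p] by auto
    have "space (PiM I ?M) = (\<Pi>\<^sub>E j\<in>I. topspace (UT j))"
      unfolding space_PiM using M(2) by (intro PiE_cong) auto
    moreover have "attach p u \<in> topspace (full_top OT YT UT n)" if "u \<in> space (PiM I ?M)" for u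
      using measurable_space[OF measurable_attach_kernels[OF kernels_tilted p] that] by simp
    moreover have "snd (snd (attach p u) k) = u k" for u using k by (simp add: attach_def)
    moreover have "B \<subseteq> topspace (UT k)" using sets.sets_into_space[OF B] by simp
    ultimately have "attach p -` ?A \<inter> space (PiM I ?M) = {u \<in> \<Pi>\<^sub>E j\<in>I. topspace (UT j). u k \<in> B}"
      by auto
    also have "\<dots> = (\<Pi>\<^sub>E j\<in>I. if j = k then B else topspace (UT j))"
    proof (intro set_eqI iffI)
      fix u assume "u \<in> (\<Pi>\<^sub>E j\<in>I. if j = k then B else topspace (UT j))"
      then have u: "\<And>j. j \<in> I \<Longrightarrow> u j \<in> (if j = k then B else topspace (UT j))" "u \<in> extensional I"
        by (auto simp: PiE_iff)
      have "u j \<in> topspace (UT j)" if "j \<in> I" for j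
        using u(1)[OF that] sets.sets_into_space[OF B] by (auto split: if_splits)
      then show "u \<in> {u \<in> \<Pi>\<^sub>E j\<in>I. topspace (UT j). u k \<in> B}"
        using u(2) u(1)[OF k] by (simp add: PiE_iff)
    qed (auto simp: PiE_iff)
    finally have "attach p -` ?A \<inter> space (PiM I ?M) = (\<Pi>\<^sub>E j\<in>I. if j = k then B else topspace (UT j))" .
    then have "emeasure (team_kernel (tilted \<kappa> k B s) p) ?A = emeasure (PiM I ?M) (\<Pi>\<^sub>E j\<in>I. if j = k then B else topspace (UT j))"
      unfolding team_kernel_def using A by (subst emeasure_distr[OF measurable_attach_kernels[OF kernels_tilted p]]) auto
    also have "\<dots> = (\<Prod>j\<in>I. emeasure (?M j) (if j = k then B else topspace (UT j)))"
    proof (intro emeasure_PiM_prob M(1))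
      show "(if j = k then B else topspace (UT j)) \<in> sets (?M j)" if "j \<in> I" for j
        using B kernels_prob(2)[OF kernels_tilted that p] sets.top[of "?M j"] M(2)[OF that] by auto
    qed simp_all
    also have "\<dots> = (\<Prod>j\<in>I. if j = k then emeasure (?M k) B else 1)"
      using prob_space.emeasure_space_1[OF M(1)] M(2) by (intro prod.cong) (auto split: if_splits)
    also have "\<dots> = emeasure (?M k) B" using k by simp
    also have "\<dots> = (\<integral>\<^sup>+ u. ennreal (tilt \<kappa> k B s (snd p k) u) * indicator B u \<partial>\<kappa> k (snd p k))"
      using B \<kappa>k_prob[OF y] measurable_tilt1[OF y] by (simp add: tilted_def emeasure_density)
    finally show "emeasure (team_kernel (tilted \<kappa> k B s) p) ?A = 
      ennreal (measure (\<kappa> k (snd p k)) B + s * (measure (\<kappa> k (snd p k)) B * (1 - measure (\<kappa> k (snd p k)) B)))"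
      by (simp add: tilt_integral(2)[OF y])
  qed
qed

end

end

end

text \<open>Comparing the probability of an action in \<open>B\<close> under both tilts shows that
  the non-negative function \<open>b p * (1 - b p)\<close> has integral 0. The contrapositive is
  what makes splits proper.\<close>

lemma tilted_distinct:
  assumes \<kappa>: "kernels \<kappa>" and k: "k \<in> I" and B: "B \<in> sets (borel_of (UT k))"
    and eq: "\<mu> \<bind> team_kernel (tilted \<kappa> k B 1) = \<mu> \<bind> team_kernel (tilted \<kappa> k B (-1))"
  shows "AE p in \<mu>. measure (\<kappa> k (snd p k)) B \<in> {0, 1}"
proof -
  interpret prob_space \<mu> by (rule prob_\<mu>)
  define b where "b p = measure (\<kappa> k (snd p k)) B" for p :: "'w \<times> (nat \<Rightarrow> 'y)"
  have b01: "0 \<le> b p" "b p \<le> 1" if "p \<in> space \<mu>" for p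
    using measure_\<kappa>k_bounds[OF \<kappa> k B, of "snd p k"] obs_component[OF k, of p] that by (auto simp: b_def space_\<mu>)
  have "b \<in> borel_measurable obs"
    unfolding b_def using measurable_compose[OF measurable_obs_component[OF k] measurable_measure_\<kappa>k[OF \<kappa> k B]] .
  then have bm[measurable]: "b \<in> borel_measurable \<mu>" by (simp cong: measurable_cong_sets add: sets_\<mu>)
  have c01: "0 \<le> b p * (1 - b p)" "b p * (1 - b p) \<le> b p" if "p \<in> space \<mu>" for p
    using b01[OF that] by (auto simp: mult_left_le)
  have eq': "(\<integral>\<^sup>+ p. ennreal (b p + 1 * (b p * (1 - b p))) \<partial>\<mu>) = (\<integral>\<^sup>+ p. ennreal (b p + (-1) * (b p * (1 - b p))) \<partial>\<mu>)"
    unfolding b_def using emeasure_tilted[OF \<kappa> k B, of 1] emeasure_tilted[OF \<kappa> k B, of "-1"] eq by simp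
  have int_b: "integrable \<mu> b"
    using b01 by (intro integrable_const_bound[where B = 1]) auto
  have int_c: "integrable \<mu> (\<lambda>p. b p * (1 - b p))"
    using b01 by (intro integrable_const_bound[where B = 1]) (auto intro!: AE_I2 mult_le_one simp: abs_mult)
  have "(\<integral>\<^sup>+ p. ennreal (b p + 1 * (b p * (1 - b p))) \<partial>\<mu>) = ennreal (\<integral>p. b p + 1 * (b p * (1 - b p)) \<partial>\<mu>)"
    using int_b int_c b01 c01 by (intro nn_integral_eq_integral) (auto intro!: AE_I2 add_nonneg_nonneg)
  moreover have "(\<integral>\<^sup>+ p. ennreal (b p + (-1) * (b p * (1 - b p))) \<partial>\<mu>) = ennreal (\<integral>p. b p + (-1) * (b p * (1 - b p)) \<partial>\<mu>)"
    using int_b int_c c01 by (intro nn_integral_eq_integral) (auto intro!: AE_I2)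
  moreover have "0 \<le> (\<integral>p. b p + 1 * (b p * (1 - b p)) \<partial>\<mu>)" "0 \<le> (\<integral>p. b p + (-1) * (b p * (1 - b p)) \<partial>\<mu>)"
    using b01 c01 by (auto intro!: integral_nonneg_AE AE_I2)
  ultimately have "(\<integral>p. b p + 1 * (b p * (1 - b p)) \<partial>\<mu>) = (\<integral>p. b p + (-1) * (b p * (1 - b p)) \<partial>\<mu>)"
    using eq' by simp
  then have "(\<integral>p. b p * (1 - b p) \<partial>\<mu>) = 0" using int_b int_c by simp
  then have "AE p in \<mu>. b p * (1 - b p) = 0"
    using integral_nonneg_eq_0_iff_AE[OF int_c] c01 by (auto intro: AE_I2)
  then show ?thesis by eventually_elim (auto simp: b_def)
qed

text \<open>Zero-one values on the countably many \<open>Ob i\<close> hold off one common null set,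
  and there the kernel is Dirac. The location of the point mass is picked by choice but is
  measurable all the same: it lies in \<open>U\<close> exactly when the kernel gives
  \<open>U\<close> mass 1.\<close>

lemma L_R_zero_one_imp_L_A:
  assumes \<kappa>: "kernels \<kappa>"
    and zo: "\<And>k B. k \<in> I \<Longrightarrow> B \<in> sets (borel_of (UT k)) \<Longrightarrow> AE p in \<mu>. measure (\<kappa> k (snd p k)) B \<in> {0, 1}"
  shows "\<mu> \<bind> team_kernel \<kappa> \<in> L_A"
proof -
  have "\<exists>\<gamma>. \<gamma> \<in> borel_of (YT k) \<rightarrow>\<^sub>M borel_of (UT k) \<and> (AE p in \<mu>. \<kappa> k (snd p k) = return (borel_of (UT k)) (\<gamma> (snd p k)))"
    if k: "k \<in> I" for k
  proof -
    obtain Ob f where "borel_approx (UT k) Ob f"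
      using ex_borel_approx metrizable_separable[OF UT[OF k]] by metis
    then interpret borel_approx "UT k" Ob f .
    have Ob: "Ob i \<in> sets (borel_of (UT k))" for i by (intro openin_borel_of Ob_open)
    note \<kappa>k = \<kappa>k[OF \<kappa> k]
    define G where "G = {y \<in> topspace (YT k). \<forall>i. measure (\<kappa> k y) (Ob i) \<in> {0, 1}}"
    have m: "(\<lambda>y. measure (\<kappa> k y) B) \<in> borel_measurable (borel_of (YT k))" if "B \<in> sets (borel_of (UT k))" for B
      by (rule measurable_measure_\<kappa>k[OF \<kappa> k that])
    have "G = {y \<in> space (borel_of (YT k)). \<forall>i. measure (\<kappa> k y) (Ob i) = 0 \<or> measure (\<kappa> k y) (Ob i) = 1}"
      by (simp add: G_def)
    also have "\<dots> \<in> sets (borel_of (YT k))" using m[OF Ob] by measurable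
    finally have G: "G \<in> sets (borel_of (YT k))" .
    have "\<exists>u. u \<in> topspace (UT k) \<and> \<kappa> k y = return (borel_of (UT k)) u" if "y \<in> G" for y
    proof -
      have "\<kappa> k y \<in> space (prob_algebra (borel_of (UT k)))"
        using measurable_space[OF \<kappa>k, of y] that by (simp add: G_def)
      from zero_one_imp_return[OF this] show ?thesis using that unfolding G_def by blast
    qed
    then obtain g where g: "\<And>y. y \<in> G \<Longrightarrow> g y \<in> topspace (UT k) \<and> \<kappa> k y = return (borel_of (UT k)) (g y)"
      by metis
    \<comment> \<open>Default action for observations outside \<open>G\<close>; it exists once
      \<open>YT k\<close> has a point, since the kernel there is a probability measure on
      \<open>UT k\<close>.\<close>
    define u0 where "u0 = (SOME u. u \<in> topspace (UT k))"
    have u0: "u0 \<in> topspace (UT k)" if "y \<in> topspace (YT k)" for y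
    proof -
      have "topspace (UT k) \<noteq> {}"
        using prob_space.not_empty[OF \<kappa>k_prob(1)[OF \<kappa> k that]] \<kappa>k_prob(3)[OF \<kappa> k that] by simp
      then show ?thesis unfolding u0_def by (simp add: some_in_eq)
    qed
    define \<gamma> where "\<gamma> y = (if y \<in> G then g y else u0)" for y
    have "\<gamma> \<in> borel_of (YT k) \<rightarrow>\<^sub>M borel_of (UT k)"
    proof (rule measurable_borel_ofI)
      show "\<gamma> y \<in> topspace (UT k)" if "y \<in> space (borel_of (YT k))" for y
        using g u0 that by (auto simp: \<gamma>_def)
      fix U assume "openin (UT k) U"
      then have U: "U \<in> sets (borel_of (UT k))" by (rule openin_borel_of)
      have "g y \<in> U \<longleftrightarrow> measure (\<kappa> k y) U = 1" if "y \<in> G" for y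
        using g[OF that] U by (auto simp: measure_return indicator_def split: if_splits)
      then have "\<gamma> -` U \<inter> space (borel_of (YT k)) = {y \<in> space (borel_of (YT k)). y \<in> G \<and> measure (\<kappa> k y) U = 1}
          \<union> (if u0 \<in> U then space (borel_of (YT k)) - G else {})"
        using sets.sets_into_space[OF G] by (auto simp: \<gamma>_def split: if_splits)
      moreover have "{y \<in> space (borel_of (YT k)). y \<in> G \<and> measure (\<kappa> k y) U = 1} \<in> sets (borel_of (YT k))"
        using m[OF U] G by measurable
      ultimately show "\<gamma> -` U \<inter> space (borel_of (YT k)) \<in> sets (borel_of (YT k))"
        using sets.compl_sets[OF G] by (simp add: sets.Un)
    qed
    moreover have "AE p in \<mu>. \<forall>i. measure (\<kappa> k (snd p k)) (Ob i) \<in> {0, 1}"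
      unfolding AE_all_countable using zo[OF k Ob] by blast
    then have "AE p in \<mu>. \<kappa> k (snd p k) = return (borel_of (UT k)) (\<gamma> (snd p k))"
      using AE_space
    proof eventually_elim
      case (elim p)
      then have "snd p k \<in> G" using obs_component[OF k, of p] by (simp add: G_def space_\<mu>)
      then show ?case using g by (simp add: \<gamma>_def)
    qed
    ultimately show ?thesis by blast
  qed
  then have "\<forall>k\<in>I. \<exists>\<gamma>. \<gamma> \<in> borel_of (YT k) \<rightarrow>\<^sub>M borel_of (UT k) \<and>
      (AE p in \<mu>. \<kappa> k (snd p k) = return (borel_of (UT k)) (\<gamma> (snd p k)))" by simp
  from bchoice[OF this] obtain \<gamma> where \<gamma>: "\<forall>k\<in>I. \<gamma> k \<in> borel_of (YT k) \<rightarrow>\<^sub>M borel_of (UT k) \<and>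
      (AE p in \<mu>. \<kappa> k (snd p k) = return (borel_of (UT k)) (\<gamma> k (snd p k)))" ..
  then have "AE p in \<mu>. \<forall>k\<in>I. \<kappa> k (snd p k) = return (borel_of (UT k)) (\<gamma> k (snd p k))"
    by (intro AE_finite_allI) auto
  moreover have "team_policy YT UT n \<gamma>" using \<gamma> by (simp add: team_policy_def)
  ultimately show ?thesis
    unfolding L_A_def using bind_team_kernel_eq_strat_meas[OF \<kappa>] by blast
qed

text \<open>Some set \<open>B\<close> has conditional mass strictly between 0 and 1 on a non-null
  set of observations of some agent \<open>k\<close>. Tilting with \<open>s = 1\<close> and
  \<open>s = -1\<close> changes the kernel of this agent alone, so both halves remain independently
  randomized, and the two densities add up to 2.\<close>

lemma L_R_split:
  assumes Q: "Q \<in> L_R OT YT UT n \<mu>" "Q \<notin> L_A"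
  shows "\<exists>Q1\<in>L_R OT YT UT n \<mu>. \<exists>Q2\<in>L_R OT YT UT n \<mu>. Q1 \<noteq> Q2 \<and>
    (\<forall>g. continuous_map (full_top OT YT UT n) euclideanreal g \<longrightarrow> bounded (g ` topspace (full_top OT YT UT n)) \<longrightarrow>
      (\<integral>x. g x \<partial>Q) = ((\<integral>x. g x \<partial>Q1) + (\<integral>x. g x \<partial>Q2)) / 2)"
proof -
  obtain \<kappa> where \<kappa>: "kernels \<kappa>" "Q = \<mu> \<bind> team_kernel \<kappa>" using Q(1) unfolding L_R_iff by blast
  obtain k B where k: "k \<in> I" and B: "B \<in> sets (borel_of (UT k))"
    and nae: "\<not> (AE p in \<mu>. measure (\<kappa> k (snd p k)) B \<in> {0, 1})"
    using L_R_zero_one_imp_L_A[OF \<kappa>(1)] Q(2) \<kappa>(2) by blast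
  let ?Q = "\<lambda>s. \<mu> \<bind> team_kernel (tilted \<kappa> k B s)"
  have "?Q 1 \<noteq> ?Q (-1)" using tilted_distinct[OF \<kappa>(1) k B] nae by blast
  moreover have "?Q s \<in> L_R OT YT UT n \<mu>" if "\<bar>s\<bar> \<le> 1" for s
    unfolding L_R_iff using kernels_tilted[OF \<kappa>(1) k B that] by blast
  then have "?Q 1 \<in> L_R OT YT UT n \<mu>" "?Q (-1) \<in> L_R OT YT UT n \<mu>" by simp_all
  moreover have "(\<integral>x. g x \<partial>Q) = ((\<integral>x. g x \<partial>?Q 1) + (\<integral>x. g x \<partial>?Q (-1))) / 2"
    if g: "continuous_map (full_top OT YT UT n) euclideanreal g" "bounded (g ` topspace (full_top OT YT UT n))" for g
  proof -
    interpret Q: prob_space Q using bind_team_kernel_prob[OF \<kappa>(1)] \<kappa>(2) by (simp add: space_prob_algebra)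
    have sQ: "sets Q = sets full" "space Q = topspace (full_top OT YT UT n)"
      using bind_team_kernel_prob[OF \<kappa>(1)] \<kappa>(2) by (auto simp: space_prob_algebra dest: sets_eq_imp_space_eq)
    have gm: "g \<in> borel_measurable full" by (rule measurable_continuous_map_real[OF g(1)])
    obtain c where c: "\<And>x. x \<in> topspace (full_top OT YT UT n) \<Longrightarrow> \<bar>g x\<bar> \<le> c"
      using g(2) by (auto simp: bounded_iff)
    let ?t = "\<lambda>s x. tilt \<kappa> k B s (fst (snd x k)) (snd (snd x k))"
    have tb: "\<bar>?t s x\<bar> \<le> 2" if "\<bar>s\<bar> \<le> 1" "x \<in> topspace (full_top OT YT UT n)" for s x
      using tilt_bounds[OF \<kappa>(1) k B that(1), of "fst (snd x k)"] measurable_space[OF measurable_full_component(1)[OF k], of x] that(2)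
      by simp
    have int: "integrable Q (\<lambda>x. ?t s x * g x)" if "\<bar>s\<bar> \<le> 1" for s
    proof (rule Q.integrable_const_bound[where B = "2 * c"])
      show "AE x in Q. norm (?t s x * g x) \<le> 2 * c"
        using c tb[OF that] by (auto intro!: AE_I2 mult_mono simp: sQ abs_mult)
      show "(\<lambda>x. ?t s x * g x) \<in> borel_measurable Q"
        using measurable_dens[OF \<kappa>(1) k B that] gm sQ by (auto cong: measurable_cong_sets)
    qed
    have "(\<integral>x. g x \<partial>?Q 1) + (\<integral>x. g x \<partial>?Q (-1)) = (\<integral>x. ?t 1 x * g x \<partial>Q) + (\<integral>x. ?t (-1) x * g x \<partial>Q)"
      using integral_tilted[OF \<kappa>(1) k B _ gm] \<kappa>(2) by simp
    also have "\<dots> = (\<integral>x. ?t 1 x * g x + ?t (-1) x * g x \<partial>Q)"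
      using int by simp
    also have "\<dots> = (\<integral>x. 2 * g x \<partial>Q)"
      by (intro Bochner_Integration.integral_cong) (auto simp: tilt_def algebra_simps)
    finally show ?thesis by simp
  qed
  ultimately show ?thesis by blast
qed

section \<open>Common randomness as mixtures of deterministic teams\<close>

lemma L_C_eq_mixtures: "L_C OT YT UT n \<mu> = mixtures (full_top OT YT UT n) L_A (W_space n)"
proof (rule set_eqI)
  fix P
  show "P \<in> L_C OT YT UT n \<mu> \<longleftrightarrow> P \<in> mixtures (full_top OT YT UT n) L_A (W_space n)"
  proof
    assume "P \<in> L_C OT YT UT n \<mu>"
    then show "P \<in> mixtures (full_top OT YT UT n) L_A (W_space n)"
      unfolding L_C_def mixtures_def mem_Collect_eq
    proof (elim conjE exE, intro conjI bexI exI)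
      fix \<eta> \<gamma>
      assume "\<forall>z\<in>space (W_space n). team_policy YT UT n (\<gamma> z)"
      then show "\<forall>z\<in>space (W_space n). strat_meas OT YT UT n \<mu> (\<gamma> z) \<in> L_A" by (auto simp: L_A_def)
    qed
  next
    assume "P \<in> mixtures (full_top OT YT UT n) L_A (W_space n)"
    then obtain \<eta> t where P: "P \<in> space (prob_algebra full)" "\<eta> \<in> space (prob_algebra (W_space n))"
      and tA: "\<forall>z\<in>space (W_space n). t z \<in> L_A" and t: "t \<in> W_space n \<rightarrow>\<^sub>M borel_of (weak_topology (full_top OT YT UT n))"
      and B: "\<forall>B\<in>sets full. emeasure P B = (\<integral>\<^sup>+ z. emeasure (t z) B \<partial>\<eta>)"
      unfolding mixtures_def by blast
    have "\<forall>z\<in>space (W_space n). \<exists>\<gamma>. team_policy YT UT n \<gamma> \<and> t z = strat_meas OT YT UT n \<mu> \<gamma>"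
      using tA by (auto simp: L_A_def)
    from bchoice[OF this] obtain \<gamma> where \<gamma>: "\<forall>z\<in>space (W_space n). team_policy YT UT n (\<gamma> z) \<and> t z = strat_meas OT YT UT n \<mu> (\<gamma> z)" ..
    have sp: "space \<eta> = space (W_space n)" using P(2) by (auto simp: space_prob_algebra dest: sets_eq_imp_space_eq)
    show "P \<in> L_C OT YT UT n \<mu>"
      unfolding L_C_def mem_Collect_eq
    proof (intro conjI exI ballI)
      show "(\<lambda>z. strat_meas OT YT UT n \<mu> (\<gamma> z)) \<in> W_space n \<rightarrow>\<^sub>M borel_of (weak_topology (full_top OT YT UT n))"
        using t \<gamma> measurable_cong[of "W_space n" t "\<lambda>z. strat_meas OT YT UT n \<mu> (\<gamma> z)"] by simp
      fix B' assume "B' \<in> sets full"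
      then have "emeasure P B' = (\<integral>\<^sup>+ z. emeasure (t z) B' \<partial>\<eta>)" using B by blast
      also have "\<dots> = (\<integral>\<^sup>+ z. emeasure (strat_meas OT YT UT n \<mu> (\<gamma> z)) B' \<partial>\<eta>)"
        using \<gamma> sp by (intro nn_integral_cong) simp
      finally show "emeasure P B' = (\<integral>\<^sup>+ z. emeasure (strat_meas OT YT UT n \<mu> (\<gamma> z)) B' \<partial>\<eta>)" .
    qed (use P \<gamma> in blast)+
  qed
qed

end

text \<open>One coordinate of the cube can carry the whole mixing parameter;
  \<open>1 \<le> n\<close> ensures that coordinate 1 exists, and clamping defines the embedding on
  the entire line.\<close>

lemma W_space_retract:
  assumes "1 \<le> n"
  obtains r i where "r \<in> borel_measurable (W_space n)" "i \<in> borel \<rightarrow>\<^sub>M W_space n" "\<And>t. t \<in> {0..1::real} \<Longrightarrow> r (i t) = t"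
proof
  let ?U = "restrict_space borel {0..1::real}"
  show "(\<lambda>z. z 1) \<in> borel_measurable (W_space n)"
  proof -
    have "(\<lambda>z. z 1) \<in> W_space n \<rightarrow>\<^sub>M ?U"
      unfolding W_space_def using assms by (intro measurable_component_singleton) auto
    moreover have "(\<lambda>x. x) \<in> ?U \<rightarrow>\<^sub>M borel" by (intro measurable_restrict_space1) simp
    ultimately show ?thesis by (rule measurable_compose)
  qed
  let ?c = "\<lambda>t::real. max 0 (min 1 t)"
  have "?c \<in> borel \<rightarrow>\<^sub>M ?U" by (intro measurable_restrict_space2) auto
  then show "(\<lambda>t. restrict (\<lambda>_. ?c t) {1..n}) \<in> borel \<rightarrow>\<^sub>M W_space n"
    unfolding W_space_def by (intro measurable_restrict)
  show "restrict (\<lambda>_. ?c t) {1..n} 1 = t" if "t \<in> {0..1}" for t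
    using that assms by (simp add: max_def min_def)
qed

text \<open>With no agents the cube is a single point and cannot carry a real parameter, so the
  general argument does not cover this case. All strategic measures coincide, as there is no action
  to choose.\<close>

lemma L_C_no_agents_unique:
  assumes "P \<in> L_C OT YT UT 0 \<mu>" "Q \<in> L_C OT YT UT 0 \<mu>"
  shows "P = Q"
proof -
  have strat: "strat_meas OT YT UT 0 \<mu> \<gamma> = strat_meas OT YT UT 0 \<mu> \<gamma>'" for \<gamma> \<gamma>'
    by (simp add: strat_meas_def restrict_def)
  have "P \<in> space (prob_algebra (borel_of (full_top OT YT UT 0))) \<and>
     (\<forall>B\<in>sets (borel_of (full_top OT YT UT 0)). emeasure P B = emeasure (strat_meas OT YT UT 0 \<mu> undefined) B)"
    if "P \<in> L_C OT YT UT 0 \<mu>" for P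
    using that unfolding L_C_def mem_Collect_eq
  proof (elim conjE exE, intro conjI ballI)
    fix \<eta> \<gamma> B
    assume \<eta>: "\<eta> \<in> space (prob_algebra (W_space 0))" and B: "B \<in> sets (borel_of (full_top OT YT UT 0))"
      and P: "\<forall>B\<in>sets (borel_of (full_top OT YT UT 0)). emeasure P B = (\<integral>\<^sup>+ z. emeasure (strat_meas OT YT UT 0 \<mu> (\<gamma> z)) B \<partial>\<eta>)"
    have "emeasure P B = (\<integral>\<^sup>+ z. emeasure (strat_meas OT YT UT 0 \<mu> undefined) B \<partial>\<eta>)"
      unfolding bspec[OF P B] by (subst strat[of "\<gamma> _" undefined]) (rule refl)
    also have "\<dots> = emeasure (strat_meas OT YT UT 0 \<mu> undefined) B"
      using \<eta> by (simp add: space_prob_algebra prob_space.emeasure_space_1)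
    finally show "emeasure P B = emeasure (strat_meas OT YT UT 0 \<mu> undefined) B" .
  qed
  from this[OF assms(1)] this[OF assms(2)] show ?thesis
    by (intro measure_eqI) (auto simp: space_prob_algebra)
qed

theorem theorem2:
  fixes OT :: "'w topology" and YT :: "nat \<Rightarrow> 'y topology" and UT :: "nat \<Rightarrow> 'u topology"
    and n :: nat and \<mu> :: "('w \<times> (nat \<Rightarrow> 'y)) measure"
  assumes "polish_top OT"
    and "\<forall>k\<in>{1..n}. polish_top (YT k)"
    and "\<forall>k\<in>{1..n}. polish_top (UT k)"
    and "\<mu> \<in> space (prob_algebra (borel_of (obs_top OT YT n)))"
    and "compactin (weak_topology (full_top OT YT UT n)) (L_R OT YT UT n \<mu>)"
  shows "compactin (weak_topology (full_top OT YT UT n)) (L_C OT YT UT n \<mu>)"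
proof (cases "n = 0")
  case True
  have "finite (L_C OT YT UT n \<mu>)"
  proof (cases "L_C OT YT UT n \<mu> = {}")
    case False
    then obtain P where "P \<in> L_C OT YT UT n \<mu>" by blast
    then have "L_C OT YT UT n \<mu> \<subseteq> {P}" using L_C_no_agents_unique True by blast
    then show ?thesis using finite_subset by blast
  qed simp
  moreover have "L_C OT YT UT n \<mu> \<subseteq> topspace (weak_topology (full_top OT YT UT n))"
    by (auto simp: L_C_def)
  ultimately show ?thesis by (simp add: finite_imp_compactin)
next
  case False
  interpret team OT YT UT n \<mu> using assms(1-4) by unfold_locales auto
  obtain r :: "(nat \<Rightarrow> real) \<Rightarrow> real" and i where W: "r \<in> borel_measurable (W_space n)" "i \<in> borel \<rightarrow>\<^sub>M W_space n"
    "\<And>t. t \<in> {0..1::real} \<Longrightarrow> r (i t) = t"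
    using W_space_retract[of n] False by (metis One_nat_def Suc_leI neq0_conv)
  show ?thesis
    unfolding L_C_eq_mixtures
  proof (rule compactin_mixtures[OF metrizable_full separable_full assms(5) L_A_subset_L_R])
    show "r \<in> borel_measurable (W_space n)" "i \<in> borel \<rightarrow>\<^sub>M W_space n" by fact+
  qed (fact L_R_split W(3))+
qed

end
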